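(* The composition of the functors $$\widehat{\mathbf{CHaus}}\xrightarrow{\ \mathbf{Res}\ }\widehat{\beta\mathbf{Sets}}\xrightarrow{\ {}^{+}\ }\widehat{\beta\mathbf{Sets}}_{\times}\xrightarrow{\ \mathbf{Ext}\ }\mathbf{CSets}$$ is isomorphic to the functor ${}^{\sharp}:\widehat{\mathbf{CHaus}}\to\mathbf{CSets}$ which associates to a presheaf its associated sheaf (that is, the left adjoint of the inclusion $\mathbf{CSets}\to\widehat{\mathbf{CHaus}}$).
   Context: $\mathbf{Sets}$ denotes a fixed essentially small, nonempty, full category of sets, closed under bijections and subsets, such that the power set $\mathcal P(S)$ is in $\mathbf{Sets}$ whenever $S$ is (for example, the category of sets of cardinality $<\kappa$ for an uncountable strong limit cardinal $\kappa$). $\mathbf{CHaus}$ is the category of compact Hausdorff spaces with underlying set in $\mathbf{Sets}$ and continuous maps; its epimorphisms are the continuous surjections. For $X$ in $\mathbf{CHaus}$, $|X|$ is its underlying set. For a set $S$, $\beta S$ is the compact Hausdorff space of ultrafilters on $S$ (the Stone-Čech compactification of the discrete space $S$). $\beta\mathbf{Sets}$ is the full subcategory of $\mathbf{CHaus}$ formed by the objects $\beta S$, $S\in\mathbf{Sets}$; its finite coproducts are those of $\mathbf{CHaus}$. $\widehat{\mathbf{CHaus}}$ and $\widehat{\beta\mathbf{Sets}}$ are the categories of contravariant functors to $\mathbf{Sets}$ from $\mathbf{CHaus}$ and $\beta\mathbf{Sets}$, with natural transformations. $\widehat{\beta\mathbf{Sets}}_{\times}$ is the full subcategory of functors sending finite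 coproducts to finite products. $\mathbf{CSets}$ (condensed sets) is the full subcategory of $\widehat{\mathbf{CHaus}}$ of functors $\mathcal F$ that send finite coproducts to finite products and such that $\mathcal F(X)\to \mathrm{eq}(\mathcal F(Y)\rightrightarrows\mathcal F(Y\times_X Y))$ is a bijection for every epimorphism $Y\to X$ in $\mathbf{CHaus}$; these are the sheaves for the topology of finite jointly epimorphic families. $\mathbf{Res}$ is restriction to $\beta\mathbf{Sets}$. The functor $\mathbf{Ext}$. For $X$ in $\mathbf{CHaus}$ put $B(X)=\beta|X|$ and let $\xi_X:B(X)\to X$ send an ultrafilter to its limit. Put $\widetilde B(X)=B(X)\times_X B(X)$ (fibre product along $\xi_X$ on both factors), with projections $p_1,p_2$ to $B(X)$, put $B^{(2)}(X)=B(\widetilde B(X))$, and $\pi_i=p_i\circ\xi_{\widetilde B(X)}:B^{(2)}(X)\to B(X)$. All are functorial in $X$. For $\mathcal F\in\widehat{\beta\mathbf{Sets}}$, $\mathbf{Ext}(\mathcal F)=\widehat{\mathcal F}$ is given by $\widehat{\mathcal F}(X)=\mathrm{eq}\big(\mathcal F(B(X))\rightrightarrows\mathcal F(B^{(2)}(X))\big)$, the arrows being $\mathcal F(\pi_1),\mathcal F(\pi_2)$. It maps $\widehat{\beta\mathbf{Sets}}_{\times}$ into $\mathbf{CSets}$. The functor ${}^+$. For a set $S$, let $\mathcal U_S$ be the category whose objects are the finite partitions $U=\{U_i\}_{i\in I}$ of $S$ into nonempty subsets, except that for $S=\emptyset$ there are exactly two objects: the covering $\{\emptyset\}$ and the empty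 covering. A morphism $\psi:V=\{V_j\}_{j\in J}\to U=\{U_i\}_{i\in I}$ is a map $\psi:J\to I$ with $U_i=\bigsqcup_{j\in\psi^{-1}(i)}V_j$ for all $i$ (there is at most one). For $\mathcal F\in\widehat{\beta\mathbf{Sets}}$ let $\mathcal F_S:\mathcal U_S\to\mathbf{Sets}$ be the contravariant functor $\mathcal F_S(U)=\prod_{i\in I}\mathcal F(\beta U_i)$, where $\mathcal F_S(\psi):\mathcal F_S(U)\to\mathcal F_S(V)$ has $j$-th component the projection to $\mathcal F(\beta U_{\psi(j)})$ followed by the map $\mathcal F(\beta U_{\psi(j)})\to\mathcal F(\beta V_j)$ induced by the inclusion $V_j\hookrightarrow U_{\psi(j)}$. Then $\mathcal F^+(\beta S)=\mathrm{colim}\,\mathcal F_S$, a filtered colimit over $\mathcal U_S^{op}$. For a continuous map $f:\beta S\to\beta T$, the map $\mathcal F^+(\beta T)\to\mathcal F^+(\beta S)$ is induced as follows: a finite partition $\{U_i\}$ of $T$ gives the clopen partition $\{\beta U_i\}$ of $\beta T$, whose preimage under $f$ is a clopen partition $\{\beta V_i\}$ of $\beta S$ with $\{V_i\}$ a partition of $S$ (discard empty pieces), and one uses the maps $\mathcal F(\beta U_i)\to\mathcal F(\beta V_i)$ induced by $f$. A natural transformation $\mathcal F\to\mathcal G$ induces $\mathcal F^+\to\mathcal G^+$ componentwise. $\mathcal F^+$ lies in $\widehat{\beta\mathbf{Sets}}_{\times}$, and ${}^+$ is left adjoint to the inclusion $\widehat{\beta\mathbf{Sets}}_{\times}\to\widehat{\beta\mathbf{Sets}}$.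 *)

theory Defs
  imports "HOL-Analysis.Analysis" "HOL-Library.Equipollence" "HOL-Library.Disjoint_Sets"
begin

section \<open>Categories, functors, natural transformations\<close>

text \<open>
  A morphism carries no record of its source and target, so composition takes the three objects
  as arguments: \<open>Cmp C X Y Z g f\<close> is the composite of \<open>f : X \<rightarrow> Y\<close> and \<open>g : Y \<rightarrow> Z\<close>.
  Equality of morphisms is equality in HOL; morphisms that are functions or families are
  therefore always taken in \<open>extensional\<close> form.
\<close>

record ('o, 'm) cat =
  Obj :: "'o set"
  Arr :: "'o \<Rightarrow> 'o \<Rightarrow> 'm set"
  Idt :: "'o \<Rightarrow> 'm"
  Cmp :: "'o \<Rightarrow> 'o \<Rightarrow> 'o \<Rightarrow> 'm \<Rightarrow> 'm \<Rightarrow> 'm"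

definition opcat :: "('o, 'm) cat \<Rightarrow> ('o, 'm) cat" where
  "opcat C = \<lparr> Obj = Obj C, Arr = (\<lambda>X Y. Arr C Y X), Idt = Idt C,
               Cmp = (\<lambda>X Y Z g f. Cmp C Z Y X f g) \<rparr>"

definition full_subcat :: "('o, 'm) cat \<Rightarrow> ('o \<Rightarrow> bool) \<Rightarrow> ('o, 'm) cat" where
  "full_subcat C P = C \<lparr> Obj := {X \<in> Obj C. P X} \<rparr>"

definition is_iso :: "('o, 'm) cat \<Rightarrow> 'o \<Rightarrow> 'o \<Rightarrow> 'm \<Rightarrow> bool" where
  "is_iso C X Y f \<longleftrightarrow> f \<in> Arr C X Y \<and>
     (\<exists>g \<in> Arr C Y X. Cmp C X Y X g f = Idt C X \<and> Cmp C Y X Y f g = Idt C Y)"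

definition is_epi :: "('o, 'm) cat \<Rightarrow> 'o \<Rightarrow> 'o \<Rightarrow> 'm \<Rightarrow> bool" where
  "is_epi C X Y f \<longleftrightarrow> X \<in> Obj C \<and> Y \<in> Obj C \<and> f \<in> Arr C X Y \<and>
     (\<forall>Z \<in> Obj C. \<forall>g \<in> Arr C Y Z. \<forall>h \<in> Arr C Y Z.
        Cmp C X Y Z g f = Cmp C X Y Z h f \<longrightarrow> g = h)"

definition is_coproduct ::
    "('o, 'm) cat \<Rightarrow> 'i set \<Rightarrow> ('i \<Rightarrow> 'o) \<Rightarrow> 'o \<Rightarrow> ('i \<Rightarrow> 'm) \<Rightarrow> bool" where
  "is_coproduct C I X c \<iota> \<longleftrightarrow>
     c \<in> Obj C \<and> (\<forall>i\<in>I. X i \<in> Obj C \<and> \<iota> i \<in> Arr C (X i) c) \<and>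
     (\<forall>d \<in> Obj C. \<forall>g. (\<forall>i\<in>I. g i \<in> Arr C (X i) d) \<longrightarrow>
        (\<exists>!h. h \<in> Arr C c d \<and> (\<forall>i\<in>I. Cmp C (X i) c d h (\<iota> i) = g i)))"

record ('o, 'm, 'p, 'n) ftor =
  FOb :: "'o \<Rightarrow> 'p"
  FAr :: "'o \<Rightarrow> 'o \<Rightarrow> 'm \<Rightarrow> 'n"

definition is_functor :: "('o, 'm) cat \<Rightarrow> ('p, 'n) cat \<Rightarrow> ('o, 'm, 'p, 'n) ftor \<Rightarrow> bool" where
  "is_functor C D F \<longleftrightarrow>
     (\<forall>X \<in> Obj C. FOb F X \<in> Obj D \<and> FAr F X X (Idt C X) = Idt D (FOb F X)) \<and>
     (\<forall>X \<in> Obj C. \<forall>Y \<in> Obj C. \<forall>f \<in> Arr C X Y. FAr F X Y f \<in> Arr D (FOb F X) (FOb F Y)) \<and>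
     (\<forall>X \<in> Obj C. \<forall>Y \<in> Obj C. \<forall>Z \<in> Obj C. \<forall>f \<in> Arr C X Y. \<forall>g \<in> Arr C Y Z.
        FAr F X Z (Cmp C X Y Z g f)
          = Cmp D (FOb F X) (FOb F Y) (FOb F Z) (FAr F Y Z g) (FAr F X Y f))"

definition ftor_comp ::
    "('p, 'n, 'q, 'l) ftor \<Rightarrow> ('o, 'm, 'p, 'n) ftor \<Rightarrow> ('o, 'm, 'q, 'l) ftor" where
  "ftor_comp G F = \<lparr> FOb = (\<lambda>X. FOb G (FOb F X)),
                    FAr = (\<lambda>X Y f. FAr G (FOb F X) (FOb F Y) (FAr F X Y f)) \<rparr>"

definition inclusion :: "('o, 'm, 'o, 'm) ftor" where
  "inclusion = \<lparr> FOb = (\<lambda>X. X), FAr = (\<lambda>X Y f. f) \<rparr>"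

definition nat_trans ::
    "('o, 'm) cat \<Rightarrow> ('p, 'n) cat \<Rightarrow> ('o, 'm, 'p, 'n) ftor \<Rightarrow> ('o, 'm, 'p, 'n) ftor
      \<Rightarrow> ('o \<Rightarrow> 'n) \<Rightarrow> bool" where
  "nat_trans C D F G \<eta> \<longleftrightarrow>
     (\<forall>X \<in> Obj C. \<eta> X \<in> Arr D (FOb F X) (FOb G X)) \<and>
     (\<forall>X \<in> Obj C. \<forall>Y \<in> Obj C. \<forall>f \<in> Arr C X Y.
        Cmp D (FOb F X) (FOb F Y) (FOb G Y) (\<eta> Y) (FAr F X Y f)
          = Cmp D (FOb F X) (FOb G X) (FOb G Y) (FAr G X Y f) (\<eta> X))"

definition isomorphic_functors ::
    "('o, 'm) cat \<Rightarrow> ('p, 'n) cat \<Rightarrow> ('o, 'm, 'p, 'n) ftor \<Rightarrow> ('o, 'm, 'p, 'n) ftor \<Rightarrow> bool" where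
  "isomorphic_functors C D F G \<longleftrightarrow> is_functor C D F \<and> is_functor C D G \<and>
     (\<exists>\<eta>. nat_trans C D F G \<eta> \<and> (\<forall>X \<in> Obj C. is_iso D (FOb F X) (FOb G X) (\<eta> X)))"

definition left_adjoint ::
    "('o, 'm) cat \<Rightarrow> ('p, 'n) cat \<Rightarrow> ('o, 'm, 'p, 'n) ftor \<Rightarrow> ('p, 'n, 'o, 'm) ftor \<Rightarrow> bool" where
  "left_adjoint C D L R \<longleftrightarrow> is_functor C D L \<and> is_functor D C R \<and>
     (\<exists>\<phi>. (\<forall>c \<in> Obj C. \<forall>d \<in> Obj D. bij_betw (\<phi> c d) (Arr D (FOb L c) d) (Arr C c (FOb R d))) \<and>
          (\<forall>c \<in> Obj C. \<forall>c' \<in> Obj C. \<forall>d \<in> Obj D. \<forall>d' \<in> Obj D.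
             \<forall>f \<in> Arr C c' c. \<forall>k \<in> Arr D d d'. \<forall>h \<in> Arr D (FOb L c) d.
               \<phi> c' d' (Cmp D (FOb L c') d d' k (Cmp D (FOb L c') (FOb L c) d h (FAr L c' c f)))
                 = Cmp C c' (FOb R d) (FOb R d') (FAr R d d' k)
                     (Cmp C c' c (FOb R d) (\<phi> c d h) f)))"


section \<open>The category of small sets and presheaves\<close>

text \<open>
  An essentially small category of sets is given, up to equivalence, by a set of subsets of a
  sufficiently large type \<open>'u\<close>. As \<open>Pow S\<close> does not live in \<open>'u\<close> itself, closure under power
  sets says that \<open>Pow S\<close> is equipollent to a small set.
\<close>

definition sets_universe :: "'u set set \<Rightarrow> bool" where
  "sets_universe \<S> \<longleftrightarrow> \<S> \<noteq> {} \<and>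
     (\<forall>S \<in> \<S>. \<forall>T. T \<subseteq> S \<longrightarrow> T \<in> \<S>) \<and>
     (\<forall>S \<in> \<S>. \<forall>T :: 'u set. S \<approx> T \<longrightarrow> T \<in> \<S>) \<and>
     (\<forall>S \<in> \<S>. \<exists>T \<in> \<S>. Pow S \<approx> T)"

text \<open>
  A set \<open>A\<close> over another type is moved into \<open>'u\<close> along a chosen injection. When \<open>A\<close> is
  equipollent to a member of a \<open>sets_universe\<close>, the image is a member too.
\<close>

definition enc :: "'b set \<Rightarrow> 'b \<Rightarrow> 'u" where
  "enc A = (SOME e. inj_on e A)"

definition dec :: "'b set \<Rightarrow> 'u \<Rightarrow> 'b" where
  "dec A = inv_into A (enc A)"

definition Sets :: "'u set set \<Rightarrow> ('u set, 'u \<Rightarrow> 'u) cat" where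
  "Sets \<S> = \<lparr> Obj = \<S>, Arr = (\<lambda>A B. A \<rightarrow>\<^sub>E B), Idt = (\<lambda>A. \<lambda>x\<in>A. x),
              Cmp = (\<lambda>A B C g f. compose A g f) \<rparr>"

type_synonym ('o, 'm, 'u) presheaf = "('o, 'm, 'u set, 'u \<Rightarrow> 'u) ftor"

text \<open>
  Presheaves are not normalised outside the objects and morphisms of \<open>C\<close>; two that differ only
  there are isomorphic objects.
\<close>

definition PSh :: "'u set set \<Rightarrow> ('o, 'm) cat \<Rightarrow> (('o, 'm, 'u) presheaf, 'o \<Rightarrow> 'u \<Rightarrow> 'u) cat" where
  "PSh \<S> C = \<lparr> Obj = {F. is_functor (opcat C) (Sets \<S>) F},
     Arr = (\<lambda>F G. {\<eta> \<in> extensional (Obj C). nat_trans (opcat C) (Sets \<S>) F G \<eta>}),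
     Idt = (\<lambda>F. \<lambda>X\<in>Obj C. Idt (Sets \<S>) (FOb F X)),
     Cmp = (\<lambda>F G H \<beta> \<alpha>. \<lambda>X\<in>Obj C. Cmp (Sets \<S>) (FOb F X) (FOb G X) (FOb H X) (\<beta> X) (\<alpha> X)) \<rparr>"

definition coproducts_to_products :: "('o, 'm) cat \<Rightarrow> ('o, 'm, 'u) presheaf \<Rightarrow> bool" where
  "coproducts_to_products C F \<longleftrightarrow>
     (\<forall>(I :: nat set) X c \<iota>. finite I \<longrightarrow> is_coproduct C I X c \<iota> \<longrightarrow>
        bij_betw (\<lambda>s. \<lambda>i\<in>I. FAr F c (X i) (\<iota> i) s) (FOb F c) (\<Pi>\<^sub>E i\<in>I. FOb F (X i)))"


section \<open>Compact Hausdorff spaces and \<open>\<beta>S\<close>\<close>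

definition CHaus :: "'u set set \<Rightarrow> ('u topology, 'u \<Rightarrow> 'u) cat" where
  "CHaus \<S> = \<lparr> Obj = {X. compact_space X \<and> Hausdorff_space X \<and> topspace X \<in> \<S>},
     Arr = (\<lambda>X Y. {f \<in> extensional (topspace X). continuous_map X Y f}),
     Idt = (\<lambda>X. \<lambda>x\<in>topspace X. x),
     Cmp = (\<lambda>X Y Z g f. compose (topspace X) g f) \<rparr>"

definition enc_top :: "'b topology \<Rightarrow> 'u topology" where
  "enc_top X = pullback_topology (enc (topspace X) ` topspace X) (dec (topspace X)) X"

definition fibprod_space ::
    "'u topology \<Rightarrow> 'u topology \<Rightarrow> ('u \<Rightarrow> 'u) \<Rightarrow> ('u \<Rightarrow> 'u) \<Rightarrow> ('u \<times> 'u) topology" where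
  "fibprod_space X Y f g = subtopology (prod_topology X Y) {(x, y). f x = g y}"

definition fibprod ::
    "'u topology \<Rightarrow> 'u topology \<Rightarrow> ('u \<Rightarrow> 'u) \<Rightarrow> ('u \<Rightarrow> 'u) \<Rightarrow> 'u topology" where
  "fibprod X Y f g = enc_top (fibprod_space X Y f g)"

definition fibprod_pr1 ::
    "'u topology \<Rightarrow> 'u topology \<Rightarrow> ('u \<Rightarrow> 'u) \<Rightarrow> ('u \<Rightarrow> 'u) \<Rightarrow> 'u \<Rightarrow> 'u" where
  "fibprod_pr1 X Y f g =
     (\<lambda>p\<in>topspace (fibprod X Y f g). fst (dec (topspace (fibprod_space X Y f g)) p))"

definition fibprod_pr2 ::
    "'u topology \<Rightarrow> 'u topology \<Rightarrow> ('u \<Rightarrow> 'u) \<Rightarrow> ('u \<Rightarrow> 'u) \<Rightarrow> 'u \<Rightarrow> 'u" where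
  "fibprod_pr2 X Y f g =
     (\<lambda>p\<in>topspace (fibprod X Y f g). snd (dec (topspace (fibprod_space X Y f g)) p))"

definition ultrafilters :: "'u set \<Rightarrow> 'u set set set" where
  "ultrafilters S = {\<U>. \<U> \<subseteq> Pow S \<and> S \<in> \<U> \<and> {} \<notin> \<U> \<and>
     (\<forall>A\<in>\<U>. \<forall>B\<in>\<U>. A \<inter> B \<in> \<U>) \<and>
     (\<forall>A\<in>\<U>. \<forall>B. A \<subseteq> B \<longrightarrow> B \<subseteq> S \<longrightarrow> B \<in> \<U>) \<and>
     (\<forall>A. A \<subseteq> S \<longrightarrow> A \<in> \<U> \<or> S - A \<in> \<U>)}"

definition uf_space :: "'u set \<Rightarrow> 'u set set topology" where
  "uf_space S = topology_generated_by ((\<lambda>A. {\<U> \<in> ultrafilters S. A \<in> \<U>}) ` Pow S)"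

definition beta :: "'u set \<Rightarrow> 'u topology" where
  "beta S = enc_top (uf_space S)"

abbreviation uf_of :: "'u set \<Rightarrow> 'u \<Rightarrow> 'u set set" where
  "uf_of S p \<equiv> dec (topspace (uf_space S)) p"

definition hat :: "'u set \<Rightarrow> 'u set \<Rightarrow> 'u set" where
  "hat S A = {p \<in> topspace (beta S). A \<in> uf_of S p}"

definition beta_map :: "'u set \<Rightarrow> 'u set \<Rightarrow> ('u \<Rightarrow> 'u) \<Rightarrow> 'u \<Rightarrow> 'u" where
  "beta_map S T f = (\<lambda>p\<in>topspace (beta S).
     enc (topspace (uf_space T)) {A. A \<subseteq> T \<and> {x\<in>S. f x \<in> A} \<in> uf_of S p})"

text \<open>
  The objects \<open>\<beta>S\<close> are named by \<open>S\<close>, which is recovered from the set of ultrafilters on \<open>S\<close> but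
  not from its image in \<open>'u\<close>.
\<close>

definition betaSets :: "'u set set \<Rightarrow> ('u set, 'u \<Rightarrow> 'u) cat" where
  "betaSets \<S> = \<lparr> Obj = \<S>,
     Arr = (\<lambda>S T. Arr (CHaus \<S>) (beta S) (beta T)),
     Idt = (\<lambda>S. Idt (CHaus \<S>) (beta S)),
     Cmp = (\<lambda>S T R g f. Cmp (CHaus \<S>) (beta S) (beta T) (beta R) g f) \<rparr>"

definition PShx :: "'u set set \<Rightarrow> (('u set, 'u \<Rightarrow> 'u, 'u) presheaf, 'u set \<Rightarrow> 'u \<Rightarrow> 'u) cat" where
  "PShx \<S> = full_subcat (PSh \<S> (betaSets \<S>)) (coproducts_to_products (betaSets \<S>))"

definition epi_descent :: "'u set set \<Rightarrow> ('u topology, 'u \<Rightarrow> 'u, 'u) presheaf \<Rightarrow> bool" where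
  "epi_descent \<S> F \<longleftrightarrow> (\<forall>Y X e. is_epi (CHaus \<S>) Y X e \<longrightarrow>
     bij_betw (FAr F X Y e) (FOb F X)
       {s \<in> FOb F Y. FAr F Y (fibprod Y Y e e) (fibprod_pr1 Y Y e e) s
                   = FAr F Y (fibprod Y Y e e) (fibprod_pr2 Y Y e e) s})"

definition CSets ::
    "'u set set \<Rightarrow> (('u topology, 'u \<Rightarrow> 'u, 'u) presheaf, 'u topology \<Rightarrow> 'u \<Rightarrow> 'u) cat" where
  "CSets \<S> = full_subcat (PSh \<S> (CHaus \<S>))
     (\<lambda>F. coproducts_to_products (CHaus \<S>) F \<and> epi_descent \<S> F)"


section \<open>The functor \<open>Res\<close>\<close>

definition Res_ob ::
    "('u topology, 'u \<Rightarrow> 'u, 'u) presheaf \<Rightarrow> ('u set, 'u \<Rightarrow> 'u, 'u) presheaf" where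
  "Res_ob F = \<lparr> FOb = (\<lambda>S. FOb F (beta S)), FAr = (\<lambda>S T f. FAr F (beta S) (beta T) f) \<rparr>"

definition Res :: "'u set set \<Rightarrow>
    (('u topology, 'u \<Rightarrow> 'u, 'u) presheaf, 'u topology \<Rightarrow> 'u \<Rightarrow> 'u,
     ('u set, 'u \<Rightarrow> 'u, 'u) presheaf, 'u set \<Rightarrow> 'u \<Rightarrow> 'u) ftor" where
  "Res \<S> = \<lparr> FOb = Res_ob, FAr = (\<lambda>F G \<alpha>. \<lambda>S\<in>Obj (betaSets \<S>). \<alpha> (beta S)) \<rparr>"


section \<open>The functor \<open>Ext\<close>\<close>

definition uf_limit :: "'u topology \<Rightarrow> 'u \<Rightarrow> 'u" where
  "uf_limit X = (\<lambda>p\<in>topspace (beta (topspace X)).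
     THE x. x \<in> topspace X \<and> (\<forall>V. openin X V \<longrightarrow> x \<in> V \<longrightarrow> V \<in> uf_of (topspace X) p))"

definition Btilde :: "'u topology \<Rightarrow> 'u topology" where
  "Btilde X = fibprod (beta (topspace X)) (beta (topspace X)) (uf_limit X) (uf_limit X)"

definition B_pi1 :: "'u topology \<Rightarrow> 'u \<Rightarrow> 'u" where
  "B_pi1 X = compose (topspace (beta (topspace (Btilde X))))
     (fibprod_pr1 (beta (topspace X)) (beta (topspace X)) (uf_limit X) (uf_limit X))
     (uf_limit (Btilde X))"

definition B_pi2 :: "'u topology \<Rightarrow> 'u \<Rightarrow> 'u" where
  "B_pi2 X = compose (topspace (beta (topspace (Btilde X))))
     (fibprod_pr2 (beta (topspace X)) (beta (topspace X)) (uf_limit X) (uf_limit X))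
     (uf_limit (Btilde X))"

definition Ext_set :: "('u set, 'u \<Rightarrow> 'u, 'u) presheaf \<Rightarrow> 'u topology \<Rightarrow> 'u set" where
  "Ext_set F X = {s \<in> FOb F (topspace X).
     FAr F (topspace X) (topspace (Btilde X)) (B_pi1 X) s
       = FAr F (topspace X) (topspace (Btilde X)) (B_pi2 X) s}"

definition Ext_ob ::
    "('u set, 'u \<Rightarrow> 'u, 'u) presheaf \<Rightarrow> ('u topology, 'u \<Rightarrow> 'u, 'u) presheaf" where
  "Ext_ob F = \<lparr> FOb = Ext_set F,
     FAr = (\<lambda>X Y f. \<lambda>s\<in>Ext_set F X.
       FAr F (topspace X) (topspace Y) (beta_map (topspace Y) (topspace X) f) s) \<rparr>"

definition Ext :: "'u set set \<Rightarrow>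
    (('u set, 'u \<Rightarrow> 'u, 'u) presheaf, 'u set \<Rightarrow> 'u \<Rightarrow> 'u,
     ('u topology, 'u \<Rightarrow> 'u, 'u) presheaf, 'u topology \<Rightarrow> 'u \<Rightarrow> 'u) ftor" where
  "Ext \<S> = \<lparr> FOb = Ext_ob,
     FAr = (\<lambda>F G \<alpha>. \<lambda>X\<in>Obj (CHaus \<S>). \<lambda>s\<in>Ext_set F X. \<alpha> (topspace X) s) \<rparr>"


section \<open>The functor \<open>Plus\<close>\<close>

definition colim_pts :: "('j, 'm) cat \<Rightarrow> ('j, 'm, 'b set, 'b \<Rightarrow> 'b) ftor \<Rightarrow> ('j \<times> 'b) set" where
  "colim_pts J D = (SIGMA j : Obj J. FOb D j)"

definition colim_rel ::
    "('j, 'm) cat \<Rightarrow> ('j, 'm, 'b set, 'b \<Rightarrow> 'b) ftor \<Rightarrow> ('j \<times> 'b) rel" where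
  "colim_rel J D = (let r = {((j, x), (k, y)). j \<in> Obj J \<and> k \<in> Obj J \<and> x \<in> FOb D j \<and>
                              (\<exists>m \<in> Arr J j k. y = FAr D j k m x)}
                    in (r \<union> r\<inverse>)\<^sup>*)"

definition colim :: "('j, 'm) cat \<Rightarrow> ('j, 'm, 'b set, 'b \<Rightarrow> 'b) ftor \<Rightarrow> ('j \<times> 'b) set set" where
  "colim J D = colim_pts J D // colim_rel J D"

text \<open>
  A covering is the set of its blocks. \<open>partition_on {} {}\<close> holds and accounts for the empty
  covering of the empty set. Blocks of one covering are pairwise disjoint, so the union in
  \<open>Arr\<close> is a disjoint union.
\<close>

definition Cov :: "'u set \<Rightarrow> ('u set set, 'u set \<Rightarrow> 'u set) cat" where
  "Cov S = \<lparr> Obj = {U. finite U \<and> partition_on S U} \<union> (if S = {} then {{{}}} else {}),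
     Arr = (\<lambda>V U. {\<psi> \<in> V \<rightarrow>\<^sub>E U. \<forall>u\<in>U. u = \<Union> {v \<in> V. \<psi> v = u}}),
     Idt = (\<lambda>U. \<lambda>u\<in>U. u),
     Cmp = (\<lambda>W V U g f. compose W g f) \<rparr>"

definition prod_on_cov :: "('u set, 'u \<Rightarrow> 'u, 'u) presheaf \<Rightarrow>
    ('u set set, 'u set \<Rightarrow> 'u set, ('u set \<Rightarrow> 'u) set, ('u set \<Rightarrow> 'u) \<Rightarrow> ('u set \<Rightarrow> 'u)) ftor" where
  "prod_on_cov F = \<lparr> FOb = (\<lambda>U. \<Pi>\<^sub>E u\<in>U. FOb F u),
     FAr = (\<lambda>U V \<psi>. \<lambda>s \<in> (\<Pi>\<^sub>E u\<in>U. FOb F u).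
       \<lambda>v\<in>V. FAr F (\<psi> v) v (beta_map v (\<psi> v) (\<lambda>x. x)) (s (\<psi> v))) \<rparr>"

definition plus_colim :: "('u set, 'u \<Rightarrow> 'u, 'u) presheaf \<Rightarrow> 'u set
    \<Rightarrow> ('u set set \<times> ('u set \<Rightarrow> 'u)) set set" where
  "plus_colim F S = colim (opcat (Cov S)) (prod_on_cov F)"

text \<open>A point of \<open>F\<^sup>+(\<beta>S)\<close> is represented by a covering \<open>U\<close> of \<open>S\<close> and an \<open>s\<close> in \<open>\<Prod>\<^sub>i F(\<beta>U\<^sub>i)\<close>.\<close>

definition plus_class ::
    "('u set, 'u \<Rightarrow> 'u, 'u) presheaf \<Rightarrow> 'u set \<Rightarrow> 'u set set \<times> ('u set \<Rightarrow> 'u) \<Rightarrow> 'u" where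
  "plus_class F S q = enc (plus_colim F S) (colim_rel (opcat (Cov S)) (prod_on_cov F) `` {q})"

text \<open>
  The map out of \<open>F\<^sup>+(\<beta>S)\<close> induced by a map on representatives: \<open>dec\<close> turns a point back into
  its equivalence class, on which \<open>h\<close> has to be constant.
\<close>

definition plus_lift :: "('u set, 'u \<Rightarrow> 'u, 'u) presheaf \<Rightarrow> 'u set
    \<Rightarrow> ('u set set \<times> ('u set \<Rightarrow> 'u) \<Rightarrow> 'u) \<Rightarrow> 'u \<Rightarrow> 'u" where
  "plus_lift F S h = (\<lambda>c \<in> enc (plus_colim F S) ` plus_colim F S.
     the_elem (h ` dec (plus_colim F S) c))"

text \<open>
  For \<open>f : \<beta>S \<rightarrow> \<beta>T\<close> and \<open>u \<subseteq> T\<close>, the set \<open>v \<subseteq> S\<close> whose clopen \<open>\<beta>v \<subseteq> \<beta>S\<close> is the preimage of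
  the clopen \<open>\<beta>u \<subseteq> \<beta>T\<close>, and the map \<open>\<beta>v \<rightarrow> \<beta>u\<close> that \<open>f\<close> restricts to.
\<close>

definition clopen_preimage :: "'u set \<Rightarrow> 'u set \<Rightarrow> ('u \<Rightarrow> 'u) \<Rightarrow> 'u set \<Rightarrow> 'u set" where
  "clopen_preimage S T f u =
     (THE v. v \<subseteq> S \<and> {p \<in> topspace (beta S). f p \<in> hat T u} = hat S v)"

definition restricted_map ::
    "'u set \<Rightarrow> 'u set \<Rightarrow> ('u \<Rightarrow> 'u) \<Rightarrow> 'u set \<Rightarrow> 'u set \<Rightarrow> 'u \<Rightarrow> 'u" where
  "restricted_map S T f v u = (\<lambda>p\<in>topspace (beta v).
     THE q. q \<in> topspace (beta u) \<and> beta_map u T (\<lambda>x. x) q = f (beta_map v S (\<lambda>x. x) p))"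

definition cov_preimage :: "'u set \<Rightarrow> 'u set \<Rightarrow> ('u \<Rightarrow> 'u) \<Rightarrow> 'u set set \<Rightarrow> 'u set set" where
  "cov_preimage S T f U = clopen_preimage S T f ` U - {{}}"

definition section_preimage :: "('u set, 'u \<Rightarrow> 'u, 'u) presheaf \<Rightarrow> 'u set \<Rightarrow> 'u set \<Rightarrow> ('u \<Rightarrow> 'u)
    \<Rightarrow> 'u set set \<Rightarrow> ('u set \<Rightarrow> 'u) \<Rightarrow> 'u set \<Rightarrow> 'u" where
  "section_preimage F S T f U s = (\<lambda>v \<in> cov_preimage S T f U.
     let u = (THE u. u \<in> U \<and> clopen_preimage S T f u = v)
     in FAr F u v (restricted_map S T f v u) (s u))"

definition plus_ob ::
    "('u set, 'u \<Rightarrow> 'u, 'u) presheaf \<Rightarrow> ('u set, 'u \<Rightarrow> 'u, 'u) presheaf" where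
  "plus_ob F = \<lparr> FOb = (\<lambda>S. enc (plus_colim F S) ` plus_colim F S),
     FAr = (\<lambda>T S f. plus_lift F T
       (\<lambda>(U, s). plus_class F S (cov_preimage S T f U, section_preimage F S T f U s))) \<rparr>"

definition Plus :: "'u set set \<Rightarrow>
    (('u set, 'u \<Rightarrow> 'u, 'u) presheaf, 'u set \<Rightarrow> 'u \<Rightarrow> 'u,
     ('u set, 'u \<Rightarrow> 'u, 'u) presheaf, 'u set \<Rightarrow> 'u \<Rightarrow> 'u) ftor" where
  "Plus \<S> = \<lparr> FOb = plus_ob,
     FAr = (\<lambda>F G \<alpha>. \<lambda>S\<in>Obj (betaSets \<S>).
       plus_lift F S (\<lambda>(U, s). plus_class G S (U, \<lambda>u\<in>U. \<alpha> u (s u)))) \<rparr>"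

end

theory Submission
  imports Defs
begin

text \<open>
  The spaces \<open>\<beta>S\<close> are projective in \<open>CHaus\<close> and every \<open>X\<close> is a quotient of \<open>\<beta>|X|\<close>. By
  projectivity, \<open>Ext F X\<close> consists of those \<open>s\<close> in \<open>F(\<beta>|X|)\<close> on which any two maps
  \<open>f, g : \<beta>R \<rightarrow> \<beta>|X|\<close> with \<open>\<xi> \<circ> f = \<xi> \<circ> g\<close> act equally. Epimorphisms of \<open>CHaus\<close> are
  surjective, hence split on underlying sets, and this gives descent for \<open>Ext F\<close>. Sending \<open>x\<close> in
  \<open>P(X)\<close> to the class of its restriction along \<open>\<xi> : \<beta>|X| \<rightarrow> X\<close>, with the covering of \<open>|X|\<close> by
  itself, is a natural map from \<open>P\<close> to the composite functor at \<open>P\<close>. It is bijective when \<open>P\<close> is a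
  sheaf, and in general every section of the composite is locally in its image. Hence it is the unit
  of an adjunction, and left adjoints are unique up to isomorphism.
\<close>

subsection \<open>Smallness\<close>

text \<open>The adjunction is not assembled from one for \<open>Plus\<close> and an equivalence for
  \<open>Ext\<close>; the natural map \<open>eta\<close> is shown to be a universal arrow. At a
  sheaf G it is invertible for two independent reasons: finite products let sections on a finite
  partition glue, so \<open>Plus\<close> adds nothing, and descent along \<xi> identifies G(X) with
  the sections over \<beta>|X| singled out by \<open>Ext\<close>. A map P -> G extends by applying
  the composite functor and inverting \<open>eta\<close> at G. Three obstacles shape the rest.
  Epimorphisms and coproducts are known only through cancellation and universal properties, so maps
  into test spaces inside the universe must detect surjectivity and disjointness. The universe is
  closed only under subsets, bijections and power sets, so each size bound needs an explicit
  embedding. The colimit defining \<open>Plus\<close> is a quotient by a generated equivalence; it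
  is replaced by \<open>prel\<close>, agreement on a finite partition, which also describes pullback
  along any map \<beta>S -> \<beta>T, so that one composition lemma serves both transitivity and
  functoriality.\<close>

definition small :: "'u set set \<Rightarrow> 'b set \<Rightarrow> bool" where
  "small \<S> A \<longleftrightarrow> (\<exists>T\<in>\<S>. A \<approx> T)"

lemma enc_dec: "p \<in> enc A ` A \<Longrightarrow> enc A (dec A p) = p"
  by (simp add: dec_def f_inv_into_f)

lemma dec_in: "p \<in> enc A ` A \<Longrightarrow> dec A p \<in> A"
  by (simp add: dec_def inv_into_into)

lemma topspace_enc_top: "topspace (enc_top X) = enc (topspace X) ` topspace X"
  by (auto simp: enc_top_def topspace_pullback_topology dec_in)

locale small_sets =
  fixes \<S> :: "'u set set"
  assumes universe: "sets_universe \<S>"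
begin

lemma small_in: "S \<in> \<S> \<Longrightarrow> small \<S> S"
  by (auto simp: small_def)

lemma subset_in: "S \<in> \<S> \<Longrightarrow> T \<subseteq> S \<Longrightarrow> T \<in> \<S>"
  using universe unfolding sets_universe_def by blast

lemma eqpoll_in: "S \<in> \<S> \<Longrightarrow> S \<approx> T \<Longrightarrow> T \<in> \<S>" for T :: "'u set"
  using universe unfolding sets_universe_def by blast

lemma small_lepoll:
  assumes "small \<S> B" "A \<lesssim> B" shows "small \<S> A"
proof -
  obtain T where T: "T \<in> \<S>" "B \<approx> T" using assms by (auto simp: small_def)
  then have "A \<lesssim> T" using assms lepoll_trans2 by blast
  then obtain f where f: "inj_on f A" "f ` A \<subseteq> T" unfolding lepoll_def by blast
  then have "A \<approx> f ` A" using eqpoll_sym inj_on_image_eqpoll_self by blast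
  then show ?thesis using subset_in[OF T(1) f(2)] by (auto simp: small_def)
qed

lemma small_subset: "small \<S> B \<Longrightarrow> A \<subseteq> B \<Longrightarrow> small \<S> A"
  using small_lepoll subset_imp_lepoll by blast

lemma small_inj_on: "small \<S> B \<Longrightarrow> inj_on f A \<Longrightarrow> (\<And>x. x \<in> A \<Longrightarrow> f x \<in> B) \<Longrightarrow> small \<S> A"
  by (rule small_lepoll) (auto simp: lepoll_def)

lemma small_image: "small \<S> A \<Longrightarrow> small \<S> (f ` A)"
  using small_lepoll image_lepoll by blast

lemma small_iff_in: "small \<S> A \<longleftrightarrow> A \<in> \<S>" for A :: "'u set"
  using eqpoll_in eqpoll_sym by (auto simp: small_def)

lemma small_Pow:
  assumes "small \<S> A" shows "small \<S> (Pow A)"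
proof -
  obtain T where T: "T \<in> \<S>" "A \<approx> T" using assms by (auto simp: small_def)
  then obtain f where f: "bij_betw f A T" by (auto simp: eqpoll_def)
  then have "bij_betw ((`) f) (Pow A) (Pow T)" by (rule bij_betw_Pow)
  then have "Pow A \<approx> Pow T" by (auto simp: eqpoll_def)
  moreover obtain T' where "T' \<in> \<S>" "Pow T \<approx> T'"
    using universe T(1) unfolding sets_universe_def by meson
  ultimately show ?thesis using eqpoll_trans by (auto simp: small_def)
qed

lemma small_empty [simp]: "small \<S> {}"
proof -
  have "\<S> \<noteq> {}" using universe unfolding sets_universe_def by (rule conjunct1)
  then obtain S where "S \<in> \<S>" by (meson ex_in_conv)
  then show ?thesis by (rule small_lepoll[OF small_in empty_lepoll])
qed

lemma small_singleton [simp]: "small \<S> {x}"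
proof (rule small_lepoll)
  show "small \<S> (Pow {})" by (rule small_Pow) simp
qed (simp add: singleton_lepoll)

text \<open>Kuratowski pairs \<open>{{a}, {a, b}}\<close> embed the square into the double power
  set; power sets are the only enlarging operation that \<open>sets_universe\<close> grants.\<close>

lemma small_square:
  assumes "small \<S> B" shows "small \<S> (B \<times> B)"
proof (rule small_inj_on)
  show "small \<S> (Pow (Pow B))" using assms by (intro small_Pow)
  have "a = c \<and> b = d" if "{{a}, {a, b}} = {{c}, {c, d}}" for a b c d :: 'b
    using that unfolding doubleton_eq_iff singleton_insert_inj_eq' by blast
  then have "inj (\<lambda>(a :: 'b, b). {{a}, {a, b}})"
    by (intro injI) (simp only: prod.case split_paired_all prod.inject)
  then show "inj_on (\<lambda>(a, b). {{a}, {a, b}}) (B \<times> B)"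
    by (rule inj_on_subset) simp
qed auto

text \<open>Cardinals are comparable, so the product embeds into the square of the larger factor,
  even when the factors live over different types.\<close>

lemma small_Times:
  fixes A :: "'b set" and B :: "'c set"
  assumes "small \<S> A" "small \<S> B" shows "small \<S> (A \<times> B)"
proof -
  have "A \<lesssim> B \<or> B \<lesssim> A"
    unfolding lepoll_def card_of_ordLeq
    by (rule ordLeq_total[OF card_of_Well_order card_of_Well_order])
  then show ?thesis
  proof
    assume "A \<lesssim> B"
    then have "A \<times> B \<lesssim> B \<times> B" by (intro times_lepoll_mono) auto
    then show ?thesis using small_square assms small_lepoll by blast
  next
    assume "B \<lesssim> A"
    then have "A \<times> B \<lesssim> A \<times> A" by (intro times_lepoll_mono) auto
    then show ?thesis using small_square assms small_lepoll by blast
  qed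
qed

text \<open>Empty sets encode the new point and singletons the old ones. The added point serves
  later as the point at infinity of a one-point compactification and as a marker value in test
  objects.\<close>

lemma small_option:
  assumes "small \<S> A" shows "small \<S> (insert None (Some ` A))"
proof (rule small_inj_on)
  show "small \<S> (Pow A \<times> Pow (Pow A))" using assms by (intro small_Times small_Pow)
  show "inj_on (\<lambda>x. case x of None \<Rightarrow> ({}, {}) | Some y \<Rightarrow> ({y}, {{y}})) (insert None (Some ` A))"
    by (auto simp: inj_on_def)
qed auto

text \<open>\<open>enc\<close> is an unconditional choice; smallness supplies an injection into the
  carrier type for it to pick. The good behaviour of \<open>dec\<close> and \<open>enc_top\<close>
  rests on this.\<close>

lemma inj_on_enc:
  fixes A :: "'b set"
  assumes "small \<S> A" shows "inj_on (enc A :: 'b \<Rightarrow> 'u) A"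
proof -
  obtain T where "T \<in> \<S>" "A \<approx> T" using assms by (auto simp: small_def)
  then have "\<exists>e :: 'b \<Rightarrow> 'u. inj_on e A" by (auto simp: eqpoll_def bij_betw_def)
  then show ?thesis unfolding enc_def by (rule someI_ex)
qed

lemma enc_image_in:
  fixes A :: "'b set"
  assumes "small \<S> A" shows "(enc A :: 'b \<Rightarrow> 'u) ` A \<in> \<S>"
  using small_image[OF assms] small_iff_in by blast

lemma dec_enc [simp]: "small \<S> A \<Longrightarrow> x \<in> A \<Longrightarrow> dec A (enc A x :: 'u) = x"
  by (simp add: dec_def inj_on_enc)

lemma homeomorphic_map_enc:
  assumes "small \<S> (topspace X)"
  shows "homeomorphic_map X (enc_top X :: 'u topology) (enc (topspace X))"
proof -
  let ?e = "enc (topspace X) :: _ \<Rightarrow> 'u"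
  note inj = inj_on_enc[OF assms]
  have op: "openin (enc_top X) V \<longleftrightarrow> (\<exists>U. openin X U \<and> V = ?e ` U)" for V :: "'u set"
  proof -
    have "dec (topspace X) -` U \<inter> ?e ` topspace X = ?e ` U" if "openin X U" for U
      using openin_subset[OF that] assms by force
    then show ?thesis
      unfolding enc_top_def openin_pullback_topology by (intro iff_exI conj_cong refl) simp
  qed
  show ?thesis
  proof (rule bijective_open_imp_homeomorphic_map)
    have "{x \<in> topspace X. ?e x \<in> ?e ` U} = U" if "openin X U" for U
      using openin_subset[OF that] inj_on_image_mem_iff[OF inj] by blast
    then show "continuous_map X (enc_top X) ?e"
      unfolding continuous_map_def op topspace_enc_top by auto
  qed (auto simp: open_map_def op topspace_enc_top inj)
qed

lemma continuous_map_enc: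
  "small \<S> (topspace X) \<Longrightarrow> continuous_map X (enc_top X :: 'u topology) (enc (topspace X))"
  using homeomorphic_map_enc homeomorphic_imp_continuous_map by blast

lemma continuous_map_dec:
  assumes "small \<S> (topspace X)"
  shows "continuous_map (enc_top X :: 'u topology) X (dec (topspace X))"
proof -
  obtain g where g: "homeomorphic_maps X (enc_top X :: 'u topology) (enc (topspace X)) g"
    using homeomorphic_map_enc[OF assms] homeomorphic_map_maps by blast
  then have "continuous_map (enc_top X :: 'u topology) X g"
    by (simp add: homeomorphic_maps_def)
  moreover have "g p = dec (topspace X) p" if "p \<in> topspace (enc_top X :: 'u topology)" for p
    using that g assms by (auto simp: homeomorphic_maps_def topspace_enc_top)
  ultimately show ?thesis using continuous_map_eq by blast
qed

lemma compact_space_enc_top: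
  "small \<S> (topspace X) \<Longrightarrow> compact_space (enc_top X :: 'u topology) \<longleftrightarrow> compact_space X"
  using homeomorphic_map_enc homeomorphic_compact_space homeomorphic_map_imp_homeomorphic_space
  by blast

lemma Hausdorff_space_enc_top:
  "small \<S> (topspace X) \<Longrightarrow> Hausdorff_space (enc_top X :: 'u topology) \<longleftrightarrow> Hausdorff_space X"
  using homeomorphic_map_enc homeomorphic_Hausdorff_space homeomorphic_map_imp_homeomorphic_space
  by blast

lemma enc_top_in_CHaus:
  assumes "compact_space X" "Hausdorff_space X" "small \<S> (topspace X)"
  shows "enc_top X \<in> Obj (CHaus \<S>)"
  using assms
  by (simp add: CHaus_def compact_space_enc_top Hausdorff_space_enc_top topspace_enc_top enc_image_in)

end


subsection \<open>The space of ultrafilters\<close>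

lemma ultrafilters_subset: "\<U> \<in> ultrafilters S \<Longrightarrow> A \<in> \<U> \<Longrightarrow> A \<subseteq> S"
  by (auto simp: ultrafilters_def)

lemma ultrafilters_Int: "\<U> \<in> ultrafilters S \<Longrightarrow> A \<in> \<U> \<Longrightarrow> B \<in> \<U> \<Longrightarrow> A \<inter> B \<in> \<U>"
  by (auto simp: ultrafilters_def)

lemma ultrafilters_mono: "\<U> \<in> ultrafilters S \<Longrightarrow> A \<in> \<U> \<Longrightarrow> A \<subseteq> B \<Longrightarrow> B \<subseteq> S \<Longrightarrow> B \<in> \<U>"
  unfolding ultrafilters_def by blast

lemma ultrafilters_not_empty: "\<U> \<in> ultrafilters S \<Longrightarrow> {} \<notin> \<U>"
  by (auto simp: ultrafilters_def)

lemma ultrafilters_top: "\<U> \<in> ultrafilters S \<Longrightarrow> S \<in> \<U>"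
  by (auto simp: ultrafilters_def)

lemma ultrafilters_Diff: "\<U> \<in> ultrafilters S \<Longrightarrow> A \<subseteq> S \<Longrightarrow> S - A \<in> \<U> \<longleftrightarrow> A \<notin> \<U>"
proof
  assume U: "\<U> \<in> ultrafilters S" and A: "A \<subseteq> S"
  have "A \<in> \<U> \<or> S - A \<in> \<U>" using U A unfolding ultrafilters_def by simp
  moreover have "A \<inter> (S - A) = {}" by blast
  ultimately show "S - A \<in> \<U> \<Longrightarrow> A \<notin> \<U>" "A \<notin> \<U> \<Longrightarrow> S - A \<in> \<U>"
    using ultrafilters_Int[OF U] ultrafilters_not_empty[OF U] by metis+
qed

lemma ultrafilters_Un:
  assumes "\<U> \<in> ultrafilters S" "A \<subseteq> S" "B \<subseteq> S"
  shows "A \<union> B \<in> \<U> \<longleftrightarrow> A \<in> \<U> \<or> B \<in> \<U>"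
proof
  assume *: "A \<union> B \<in> \<U>"
  show "A \<in> \<U> \<or> B \<in> \<U>"
  proof (rule ccontr)
    assume "\<not> ?thesis"
    then have "S - A \<in> \<U>" "S - B \<in> \<U>" using assms ultrafilters_Diff by blast+
    then have "((S - A) \<inter> (S - B)) \<inter> (A \<union> B) \<in> \<U>" using assms * by (blast intro: ultrafilters_Int)
    moreover have "((S - A) \<inter> (S - B)) \<inter> (A \<union> B) = {}" by blast
    ultimately show False using ultrafilters_not_empty assms by metis
  qed
qed (use assms ultrafilters_mono in blast)

lemma topspace_uf_space: "topspace (uf_space S) = ultrafilters S"
  by (auto simp: uf_space_def dest: ultrafilters_top)

lemma openin_uf_space_basic: "A \<subseteq> S \<Longrightarrow> openin (uf_space S) {\<U> \<in> ultrafilters S. A \<in> \<U>}"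
  unfolding uf_space_def by (rule topology_generated_by_Basis) auto

lemma continuous_map_uf_space:
  "continuous_map X (uf_space S) f \<longleftrightarrow> f \<in> topspace X \<rightarrow> ultrafilters S \<and>
     (\<forall>A. A \<subseteq> S \<longrightarrow> openin X {x \<in> topspace X. A \<in> f x})" (is "_ \<longleftrightarrow> ?R")
proof
  assume f: "continuous_map X (uf_space S) f"
  then have im: "f \<in> topspace X \<rightarrow> ultrafilters S"
    by (simp add: continuous_map_def topspace_uf_space)
  moreover have "openin X {x \<in> topspace X. A \<in> f x}" if "A \<subseteq> S" for A
  proof -
    have "{x \<in> topspace X. A \<in> f x} = {x \<in> topspace X. f x \<in> {\<U> \<in> ultrafilters S. A \<in> \<U>}}"
      using im by auto
    then show ?thesis
      using openin_continuous_map_preimage[OF f openin_uf_space_basic[OF that]] by simp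
  qed
  ultimately show ?R by blast
next
  assume R: ?R
  have "f -` {\<U> \<in> ultrafilters S. A \<in> \<U>} \<inter> topspace X = {x \<in> topspace X. A \<in> f x}" for A
    using R by auto
  then show "continuous_map X (uf_space S) f"
    unfolding uf_space_def continuous_on_generated_topo_iff using R
    by (auto simp: image_subset_iff Pi_iff intro!: bexI[of _ S] dest: ultrafilters_top)
qed

text \<open>
  Ultrafilters are the points of the Cantor cube over \<open>Pow S\<close> that satisfy closed conditions, so
  compactness is an instance of Tychonoff's theorem.
\<close>

lemma compact_space_uf_space: "compact_space (uf_space S)"
proof -
  define P where "P = product_topology (\<lambda>_ :: 'a set. discrete_topology (UNIV :: bool set)) (Pow S)"
  have tP: "topspace P = (\<Pi>\<^sub>E A\<in>Pow S. UNIV)" by (simp add: P_def)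
  have cP: "compact_space P"
    by (simp add: P_def compact_space_product_topology compact_space_discrete_topology)
  have eval: "continuous_map P (discrete_topology UNIV) (\<lambda>g. g A)" if "A \<subseteq> S" for A
    unfolding P_def by (rule continuous_map_product_projection) (use that in auto)
  have pre: "{g \<in> topspace P. g A} = {g \<in> topspace P. g A \<in> {True}}"
    "{g \<in> topspace P. \<not> g A} = {g \<in> topspace P. g A \<in> {False}}" for A by auto
  have clo: "closedin P {g \<in> topspace P. g A}" "closedin P {g \<in> topspace P. \<not> g A}" if "A \<subseteq> S" for A
    unfolding pre
    by (rule closedin_continuous_map_preimage[OF eval[OF that]], simp)+
  have ope: "openin P {g \<in> topspace P. g A}" if "A \<subseteq> S" for A
    unfolding pre
    by (rule openin_continuous_map_preimage[OF eval[OF that]], simp)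
  \<comment> \<open>With membership of \<open>A\<close> coded as \<open>g A\<close>,
    \<open>C1\<close> is closure under intersections, \<open>C2\<close> upward closure (a superset
    of \<open>A\<close> is written as \<open>A \<union> B\<close>) and \<open>C3\<close> the
    dichotomy. Each is a finite union of cylinders over single coordinates, hence closed.\<close>
  define C1 where "C1 = (\<lambda>(A, B). {g \<in> topspace P. \<not> g A} \<union> {g \<in> topspace P. \<not> g B} \<union> {g \<in> topspace P. g (A \<inter> B)})"
  define C2 where "C2 = (\<lambda>(A, B). {g \<in> topspace P. \<not> g A} \<union> {g \<in> topspace P. g (A \<union> B)})"
  define C3 where "C3 = (\<lambda>A. {g \<in> topspace P. g A} \<union> {g \<in> topspace P. g (S - A)})"
  define K where "K = {g \<in> topspace P. g S} \<inter> {g \<in> topspace P. \<not> g {}} \<inter>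
     \<Inter> (C1 ` (Pow S \<times> Pow S)) \<inter> \<Inter> (C2 ` (Pow S \<times> Pow S)) \<inter> \<Inter> (C3 ` (Pow S))"
  have "closedin P K"
    unfolding K_def
    apply (intro closedin_Int closedin_Inter clo)
    by (auto simp: C1_def C2_def C3_def intro!: closedin_Un clo)
  then have "compactin P K" using cP closedin_compact_space by blast
  moreover have KP: "K \<subseteq> topspace P" by (auto simp: K_def)
  ultimately have cK: "compact_space (subtopology P K)" by (simp add: compactin_subspace)
  define h where "h = (\<lambda>g :: 'a set \<Rightarrow> bool. {A \<in> Pow S. g A})"
  have hK: "h g \<in> ultrafilters S" if g: "g \<in> K" for g
  proof -
    have i: "g (A \<inter> B)" if "g A" "g B" "A \<subseteq> S" "B \<subseteq> S" for A B
      using g that by (auto simp: K_def C1_def)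
    have m: "g B" if "g A" "A \<subseteq> B" "B \<subseteq> S" for A B
    proof -
      have "g (A \<union> B)" using g that by (auto simp: K_def C2_def)
      then show ?thesis using that by (simp add: Un_absorb1)
    qed
    have c: "g A \<or> g (S - A)" if "A \<subseteq> S" for A
      using g that by (auto simp: K_def C3_def)
    have "g S" "\<not> g {}" using g by (auto simp: K_def)
    then show ?thesis using i m c unfolding ultrafilters_def h_def by blast
  qed
  have "continuous_map (subtopology P K) (uf_space S) h"
    unfolding continuous_map_uf_space
  proof (intro conjI allI impI)
    fix A assume A: "A \<subseteq> S"
    have "{x \<in> topspace (subtopology P K). A \<in> h x} = {g \<in> topspace P. g A} \<inter> K"
      using A by (auto simp: h_def)
    then show "openin (subtopology P K) {x \<in> topspace (subtopology P K). A \<in> h x}"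
      using ope[OF A] by (auto simp: openin_subtopology)
  qed (use hK in auto)
  then have "compactin (uf_space S) (h ` topspace (subtopology P K))"
    using cK image_compactin unfolding compact_space_def by blast
  moreover have "h ` topspace (subtopology P K) = ultrafilters S"
  proof
    show "ultrafilters S \<subseteq> h ` topspace (subtopology P K)"
    proof
      fix \<U> assume U: "\<U> \<in> ultrafilters S"
      let ?g = "\<lambda>A\<in>Pow S. A \<in> \<U>"
      have "?g \<in> K"
        using U unfolding K_def tP C1_def C2_def C3_def
        by (auto dest: ultrafilters_top ultrafilters_not_empty ultrafilters_Int simp: ultrafilters_Un ultrafilters_Diff)
      moreover have "h ?g = \<U>" using U by (auto simp: h_def dest: ultrafilters_subset)
      ultimately show "\<U> \<in> h ` topspace (subtopology P K)" using KP by force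
    qed
  qed (use hK in auto)
  ultimately show ?thesis by (simp add: compact_space_def topspace_uf_space)
qed

text \<open>Ultrafilters are maximal, so distinct ones are incomparable: some \<open>A\<close> lies
  in the first and \<open>S - A\<close> in the second, and the two corresponding basic open sets are
  disjoint.\<close>

lemma Hausdorff_space_uf_space: "Hausdorff_space (uf_space S)"
  unfolding Hausdorff_space_def topspace_uf_space
proof (intro allI impI)
  fix \<U> \<V> assume *: "\<U> \<in> ultrafilters S \<and> \<V> \<in> ultrafilters S \<and> \<U> \<noteq> \<V>"
  have "\<exists>A. A \<in> \<U> \<and> A \<notin> \<V>" if "\<U> \<in> ultrafilters S" "\<V> \<in> ultrafilters S" "\<U> \<noteq> \<V>" for \<U> \<V>
  proof (rule ccontr)
    assume n: "\<nexists>A. A \<in> \<U> \<and> A \<notin> \<V>"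
    have "A \<in> \<U>" if "A \<in> \<V>" for A
      using that n ultrafilters_Diff \<open>\<U> \<in> ultrafilters S\<close> \<open>\<V> \<in> ultrafilters S\<close>
      by (metis ultrafilters_subset)
    then show False using n that(3) by blast
  qed
  then obtain A where A: "A \<in> \<U>" "A \<notin> \<V>" using * by blast
  then have AS: "A \<subseteq> S" using * ultrafilters_subset by blast
  let ?b = "\<lambda>A. {\<U> \<in> ultrafilters S. A \<in> \<U>}"
  show "\<exists>U V. openin (uf_space S) U \<and> openin (uf_space S) V \<and> \<U> \<in> U \<and> \<V> \<in> V \<and> disjnt U V"
  proof (intro exI conjI)
    show "openin (uf_space S) (?b A)" "openin (uf_space S) (?b (S - A))"
      using AS by (auto intro: openin_uf_space_basic)
    show "disjnt (?b A) (?b (S - A))" using AS by (auto simp: disjnt_def ultrafilters_Diff)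
    show "\<U> \<in> ?b A" "\<V> \<in> ?b (S - A)" using A AS * by (auto simp: ultrafilters_Diff)
  qed
qed


subsection \<open>The spaces \<open>\<beta>S\<close>\<close>

abbreviation "tb S \<equiv> topspace (beta S)"

text \<open>An ultrafilter contains \<open>A \<inter> B\<close> exactly when it contains both sets,
  so the generating sets already form a basis. This is the intersection case of an induction over
  the generated topology.\<close>

lemma uf_space_basic_nhds:
  assumes "openin (uf_space S) V" "\<U> \<in> V"
  shows "\<exists>A\<in>\<U>. {\<V> \<in> ultrafilters S. A \<in> \<V>} \<subseteq> V"
proof -
  have VS: "V \<subseteq> ultrafilters S" using assms openin_subset topspace_uf_space by metis
  have "generate_topology_on ((\<lambda>A. {\<U> \<in> ultrafilters S. A \<in> \<U>}) ` Pow S) V"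
    using assms by (simp add: uf_space_def openin_topology_generated_by_iff)
  then have "\<forall>\<U>\<in>V \<inter> ultrafilters S. \<exists>A\<in>\<U>. {\<V> \<in> ultrafilters S. A \<in> \<V>} \<subseteq> V"
  proof induction
    case (Int a b)
    show ?case
    proof
      fix \<U> assume U: "\<U> \<in> a \<inter> b \<inter> ultrafilters S"
      then obtain A B where AB: "A \<in> \<U>" "{\<V> \<in> ultrafilters S. A \<in> \<V>} \<subseteq> a"
        "B \<in> \<U>" "{\<V> \<in> ultrafilters S. B \<in> \<V>} \<subseteq> b"
        using Int by (meson IntD1 IntD2 IntI)
      have "A \<in> \<V> \<and> B \<in> \<V>" if "\<V> \<in> ultrafilters S" "A \<inter> B \<in> \<V>" for \<V>
      proof -
        have "A \<subseteq> S" "B \<subseteq> S" using U AB ultrafilters_subset by blast+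
        then show ?thesis using that ultrafilters_mono[OF that(1,2)] by simp
      qed
      then have "{\<V> \<in> ultrafilters S. A \<inter> B \<in> \<V>} \<subseteq> a \<inter> b" using AB by auto
      moreover have "A \<inter> B \<in> \<U>" using U AB ultrafilters_Int by blast
      ultimately show "\<exists>A\<in>\<U>. {\<V> \<in> ultrafilters S. A \<in> \<V>} \<subseteq> a \<inter> b" by blast
    qed
  next
    case (UN K)
    show ?case
    proof
      fix \<U> assume "\<U> \<in> \<Union>K \<inter> ultrafilters S"
      then obtain k where k: "k \<in> K" "\<U> \<in> k \<inter> ultrafilters S" by blast
      from bspec[OF UN.IH[OF k(1)] k(2)]
      obtain A where "A \<in> \<U>" "{\<V> \<in> ultrafilters S. A \<in> \<V>} \<subseteq> k" by (rule bexE)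
      then show "\<exists>A\<in>\<U>. {\<V> \<in> ultrafilters S. A \<in> \<V>} \<subseteq> \<Union>K"
        by (intro bexI[of _ A] subset_trans[OF _ Union_upper[OF k(1)]])
    qed
  next
    case (Basis s)
    then show ?case by blast
  qed simp
  then show ?thesis using assms VS by blast
qed

text \<open>The principal ultrafilter at \<open>x\<close>, that is, the canonical map from the
  discrete set \<open>S\<close> to its Stone-Cech compactification.\<close>

definition pt :: "'u set \<Rightarrow> 'u \<Rightarrow> 'u" where
  "pt S x = enc (topspace (uf_space S)) {A. A \<subseteq> S \<and> x \<in> A}"

lemma principal_ultrafilter: "x \<in> S \<Longrightarrow> {A. A \<subseteq> S \<and> x \<in> A} \<in> ultrafilters S"
  by (auto simp: ultrafilters_def)

lemma ultrafilter_image: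
  assumes "f \<in> S \<rightarrow> T" "\<U> \<in> ultrafilters S"
  shows "{A. A \<subseteq> T \<and> {x \<in> S. f x \<in> A} \<in> \<U>} \<in> ultrafilters T"
proof -
  have 1: "{x \<in> S. f x \<in> T} = S" using assms by auto
  have 2: "{x \<in> S. f x \<in> A \<inter> B} = {x \<in> S. f x \<in> A} \<inter> {x \<in> S. f x \<in> B}" for A B by auto
  have 3: "{x \<in> S. f x \<in> T - A} = S - {x \<in> S. f x \<in> A}" for A using assms by auto
  have 4: "{x \<in> S. f x \<in> B} \<in> \<U>" if "{x \<in> S. f x \<in> A} \<in> \<U>" "A \<subseteq> B" for A B
    by (rule ultrafilters_mono[OF assms(2) that(1)]) (use that in auto)
  have 5: "{x \<in> S. f x \<in> A} \<subseteq> S" for A by auto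
  show ?thesis
    unfolding ultrafilters_def[of T]
  proof (rule CollectI, intro conjI ballI allI impI)
    fix A B assume "A \<in> {A. A \<subseteq> T \<and> {x \<in> S. f x \<in> A} \<in> \<U>}" "A \<subseteq> B" "B \<subseteq> T"
    then show "B \<in> {A. A \<subseteq> T \<and> {x \<in> S. f x \<in> A} \<in> \<U>}" using 4[of A B] by simp
  next
    fix A assume "A \<subseteq> T"
    then show "A \<in> {A. A \<subseteq> T \<and> {x \<in> S. f x \<in> A} \<in> \<U>} \<or>
        T - A \<in> {A. A \<subseteq> T \<and> {x \<in> S. f x \<in> A} \<in> \<U>}"
      unfolding mem_Collect_eq 3 ultrafilters_Diff[OF assms(2) 5] by simp
  next
    fix A B
    assume "A \<in> {A. A \<subseteq> T \<and> {x \<in> S. f x \<in> A} \<in> \<U>}" "B \<in> {A. A \<subseteq> T \<and> {x \<in> S. f x \<in> A} \<in> \<U>}"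
    then show "A \<inter> B \<in> {A. A \<subseteq> T \<and> {x \<in> S. f x \<in> A} \<in> \<U>}"
      unfolding mem_Collect_eq 2 by (simp add: ultrafilters_Int[OF assms(2)] le_infI1)
  qed (use ultrafilters_top[OF assms(2)] ultrafilters_not_empty[OF assms(2)] in \<open>auto simp: 1\<close>)
qed

context small_sets
begin

lemma small_ultrafilters: "S \<in> \<S> \<Longrightarrow> small \<S> (ultrafilters S)"
  by (rule small_subset[OF small_Pow[OF small_Pow[OF small_in]]]) (auto simp: ultrafilters_def)

lemma small_topspace_uf: "S \<in> \<S> \<Longrightarrow> small \<S> (topspace (uf_space S))"
  by (simp add: topspace_uf_space small_ultrafilters)

lemma topspace_beta: "tb S = enc (topspace (uf_space S)) ` ultrafilters S"
  by (simp add: beta_def topspace_enc_top topspace_uf_space)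

lemma uf_of_in: "p \<in> tb S \<Longrightarrow> uf_of S p \<in> ultrafilters S"
  using dec_in[of p "topspace (uf_space S)"] by (simp add: topspace_beta topspace_uf_space)

lemma enc_uf_of: "p \<in> tb S \<Longrightarrow> enc (topspace (uf_space S)) (uf_of S p) = p"
  by (simp add: topspace_beta topspace_uf_space enc_dec)

lemma uf_of_enc: "S \<in> \<S> \<Longrightarrow> \<U> \<in> ultrafilters S \<Longrightarrow>
    uf_of S (enc (topspace (uf_space S)) \<U> :: 'u) = \<U>"
  by (simp add: topspace_uf_space small_ultrafilters)

lemma beta_in_CHaus: "S \<in> \<S> \<Longrightarrow> beta S \<in> Obj (CHaus \<S>)"
  unfolding beta_def
  by (intro enc_top_in_CHaus compact_space_uf_space Hausdorff_space_uf_space small_topspace_uf)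

lemma mem_hat: "p \<in> hat S A \<longleftrightarrow> p \<in> tb S \<and> A \<in> uf_of S p"
  by (simp add: hat_def)

lemma hat_subset: "p \<in> hat S A \<Longrightarrow> p \<in> tb S"
  by (simp add: hat_def)

text \<open>One inclusion suffices because ultrafilters are maximal: a set missing from
  \<open>p\<close> has its complement in \<open>p\<close>, hence in \<open>q\<close>.\<close>

lemma beta_eqI:
  assumes "p \<in> tb S" "q \<in> tb S"
    "\<And>A. A \<subseteq> S \<Longrightarrow> p \<in> hat S A \<Longrightarrow> q \<in> hat S A"
  shows "p = q"
proof -
  note pq = uf_of_in[OF assms(1)] uf_of_in[OF assms(2)]
  have *: "A \<in> uf_of S q" if "A \<in> uf_of S p" for A
    using assms that ultrafilters_subset[OF pq(1) that] unfolding mem_hat by blast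
  have "A \<in> uf_of S p" if "A \<in> uf_of S q" for A
  proof (rule ccontr)
    assume "A \<notin> uf_of S p"
    then have "S - A \<in> uf_of S q"
      using *[of "S - A"] ultrafilters_Diff[OF pq(1)] ultrafilters_subset[OF pq(2) that] by simp
    then show False using ultrafilters_Diff[OF pq(2)] ultrafilters_subset[OF pq(2) that] that by simp
  qed
  then have "uf_of S p = uf_of S q" using * by blast
  then show ?thesis using enc_uf_of assms by metis
qed

lemma hat_top: "hat S S = tb S"
  by (auto simp: mem_hat intro: ultrafilters_top[OF uf_of_in])

lemma hat_empty [simp]: "hat S {} = {}"
  by (auto simp: mem_hat dest: ultrafilters_not_empty[OF uf_of_in])

lemma hat_Int: "A \<subseteq> S \<Longrightarrow> B \<subseteq> S \<Longrightarrow> hat S (A \<inter> B) = hat S A \<inter> hat S B"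
  by (auto simp: mem_hat intro: ultrafilters_Int[OF uf_of_in]
      ultrafilters_mono[OF uf_of_in _ Int_lower1] ultrafilters_mono[OF uf_of_in _ Int_lower2])

lemma hat_Un: "A \<subseteq> S \<Longrightarrow> B \<subseteq> S \<Longrightarrow> hat S (A \<union> B) = hat S A \<union> hat S B"
  by (auto simp: mem_hat ultrafilters_Un[OF uf_of_in])

lemma hat_Diff: "A \<subseteq> S \<Longrightarrow> hat S (S - A) = tb S - hat S A"
  by (auto simp: mem_hat ultrafilters_Diff[OF uf_of_in])

lemma hat_mono: "A \<subseteq> B \<Longrightarrow> B \<subseteq> S \<Longrightarrow> hat S A \<subseteq> hat S B"
  by (auto simp: mem_hat intro: ultrafilters_mono[OF uf_of_in])

lemma hat_Union: "finite \<A> \<Longrightarrow> (\<And>A. A \<in> \<A> \<Longrightarrow> A \<subseteq> S) \<Longrightarrow> hat S (\<Union>\<A>) = (\<Union>A\<in>\<A>. hat S A)"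
  by (induction \<A> rule: finite_induct) (simp_all add: hat_Un Sup_le_iff)

lemma openin_hat:
  assumes "S \<in> \<S>" "A \<subseteq> S" shows "openin (beta S) (hat S A)"
proof -
  have "hat S A = {p \<in> tb S. uf_of S p \<in> {\<U> \<in> ultrafilters S. A \<in> \<U>}}"
    by (auto simp: mem_hat intro: uf_of_in)
  then show ?thesis
    using openin_continuous_map_preimage[OF continuous_map_dec[OF small_topspace_uf[OF assms(1)]]
        openin_uf_space_basic[OF assms(2)]]
    by (simp add: beta_def)
qed

lemma closedin_hat:
  assumes "S \<in> \<S>" "A \<subseteq> S" shows "closedin (beta S) (hat S A)"
proof -
  have "hat S A = tb S - hat S (S - A)"
    using hat_Diff[of "S - A" S] assms(2) by (simp add: double_diff)
  then show ?thesis using openin_hat[OF assms(1), of "S - A"] by auto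
qed

lemma beta_basic_nhds:
  assumes S: "S \<in> \<S>" and V: "openin (beta S) V" "p \<in> V"
  obtains A where "A \<subseteq> S" "p \<in> hat S A" "hat S A \<subseteq> V"
proof -
  let ?e = "enc (topspace (uf_space S)) :: _ \<Rightarrow> 'u"
  have p: "p \<in> tb S" using V(2) openin_subset[OF V(1)] by (rule subsetD[rotated])
  have "openin (uf_space S) {\<U> \<in> topspace (uf_space S). ?e \<U> \<in> V}"
    using continuous_map_enc[OF small_topspace_uf[OF S]] V(1)
    by (intro openin_continuous_map_preimage) (auto simp: beta_def)
  moreover have "uf_of S p \<in> {\<U> \<in> topspace (uf_space S). ?e \<U> \<in> V}"
    using V uf_of_in[OF p] enc_uf_of[OF p] by (simp add: topspace_uf_space)
  ultimately have "\<exists>A\<in>uf_of S p. {\<V> \<in> ultrafilters S. A \<in> \<V>} \<subseteq> {\<U> \<in> topspace (uf_space S). ?e \<U> \<in> V}"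
    by (rule uf_space_basic_nhds)
  then obtain A where A: "A \<in> uf_of S p"
    "{\<V> \<in> ultrafilters S. A \<in> \<V>} \<subseteq> {\<U> \<in> topspace (uf_space S). ?e \<U> \<in> V}"
    by (rule bexE)
  show ?thesis
  proof
    show "A \<subseteq> S" by (rule ultrafilters_subset[OF uf_of_in[OF p] A(1)])
    show "p \<in> hat S A" using A p by (simp add: mem_hat)
    show "hat S A \<subseteq> V"
    proof
      fix q assume "q \<in> hat S A"
      then have q: "q \<in> tb S" "A \<in> uf_of S q" by (simp_all add: mem_hat)
      then have "?e (uf_of S q) \<in> V" using subsetD[OF A(2), of "uf_of S q"] uf_of_in[OF q(1)] by simp
      then show "q \<in> V" using enc_uf_of[OF q(1)] by simp
    qed
  qed
qed

lemma continuous_map_beta: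
  assumes "S \<in> \<S>"
  shows "continuous_map X (beta S) f \<longleftrightarrow> f \<in> topspace X \<rightarrow> tb S \<and>
    (\<forall>A. A \<subseteq> S \<longrightarrow> openin X {x \<in> topspace X. f x \<in> hat S A})" (is "_ \<longleftrightarrow> ?R")
proof
  assume f: "continuous_map X (beta S) f"
  then show ?R
    using openin_continuous_map_preimage[OF f openin_hat[OF assms]]
    by (simp add: continuous_map_def)
next
  assume R: ?R
  let ?e = "enc (topspace (uf_space S)) :: _ \<Rightarrow> 'u"
  have "{x \<in> topspace X. A \<in> uf_of S (f x)} = {x \<in> topspace X. f x \<in> hat S A}" for A
    using R by (auto simp: mem_hat)
  then have "continuous_map X (uf_space S) (\<lambda>x. uf_of S (f x))"
    unfolding continuous_map_uf_space using R by (auto intro!: uf_of_in)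
  then have "continuous_map X (beta S) (?e \<circ> (\<lambda>x. uf_of S (f x)))"
    unfolding beta_def
    by (rule continuous_map_compose[OF _ continuous_map_enc[OF small_topspace_uf[OF assms]]])
  moreover have "(?e \<circ> (\<lambda>x. uf_of S (f x))) x = f x" if "x \<in> topspace X" for x
    using R that by (simp add: Pi_iff enc_uf_of)
  ultimately show "continuous_map X (beta S) f" using continuous_map_eq by blast
qed

lemma pt_in: "x \<in> S \<Longrightarrow> pt S x \<in> tb S"
  by (simp add: pt_def topspace_beta principal_ultrafilter)

lemma pt_hat: "S \<in> \<S> \<Longrightarrow> x \<in> S \<Longrightarrow> A \<subseteq> S \<Longrightarrow> pt S x \<in> hat S A \<longleftrightarrow> x \<in> A"
  by (simp add: mem_hat pt_in) (simp add: pt_def uf_of_enc principal_ultrafilter)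

lemma hat_subsetD:
  assumes "S \<in> \<S>" "A \<subseteq> S" "B \<subseteq> S" "hat S A \<subseteq> hat S B" shows "A \<subseteq> B"
proof
  fix x assume "x \<in> A"
  then have "x \<in> S" "pt S x \<in> hat S A" using assms pt_hat by (simp_all add: subsetD)
  then show "x \<in> B" using assms pt_hat[OF assms(1) \<open>x \<in> S\<close> assms(3)] by (simp add: subsetD)
qed

lemma hat_eqD:
  assumes "S \<in> \<S>" "A \<subseteq> S" "B \<subseteq> S" "hat S A = hat S B" shows "A = B"
  using hat_subsetD[OF assms(1-3)] hat_subsetD[OF assms(1,3,2)] assms(4) by simp

text \<open>A nonempty basic open set \<open>hat S A\<close> has \<open>A\<close> nonempty, and any
  element of \<open>A\<close> gives a principal ultrafilter inside it.\<close>

lemma pt_dense: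
  assumes "S \<in> \<S>" shows "beta S closure_of (pt S ` S) = tb S"
proof -
  have "\<exists>x\<in>S. pt S x \<in> V" if V: "openin (beta S) V" "p \<in> V" for p V
  proof -
    obtain A where A: "A \<subseteq> S" "p \<in> hat S A" "hat S A \<subseteq> V" using beta_basic_nhds[OF assms V] .
    then have "A \<noteq> {}" by auto
    then obtain x where "x \<in> A" by blast
    then show ?thesis using A pt_hat[OF assms, of x A] by blast
  qed
  then show ?thesis unfolding closure_of_def by fast
qed

text \<open>Both sides are clopen with the same trace on the principal ultrafilters. Each of the two
  differences is therefore open, and by density it would contain a principal ultrafilter if it were
  nonempty.\<close>

lemma clopen_is_hat:
  assumes S: "S \<in> \<S>" and K: "openin (beta S) K" "closedin (beta S) K"
  shows "K = hat S {x \<in> S. pt S x \<in> K}"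
proof -
  let ?A = "{x \<in> S. pt S x \<in> K}"
  have dense: "\<exists>x\<in>S. pt S x \<in> V" if "openin (beta S) V" "V \<noteq> {}" for V
  proof -
    have "V \<inter> beta S closure_of (pt S ` S) \<noteq> {}"
      unfolding pt_dense[OF S] using that openin_subset[OF that(1)] by (simp add: Int_absorb2)
    then have "V \<inter> pt S ` S \<noteq> {}" using openin_Int_closure_of_eq_empty[OF that(1)] by simp
    then show ?thesis by blast
  qed
  have *: "\<exists>x\<in>A. x \<in> ?A" if A: "A \<subseteq> S" and ne: "K \<inter> hat S A \<noteq> {}" for A
  proof -
    obtain x where "x \<in> S" "pt S x \<in> K \<inter> hat S A"
      using dense[OF openin_Int[OF K(1) openin_hat[OF S A]] ne] by (rule bexE)
    then show ?thesis using pt_hat[OF S _ A] by (intro bexI[of _ x]) simp_all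
  qed
  have **: "\<exists>x\<in>A. x \<notin> ?A" if A: "A \<subseteq> S" and ne: "hat S A - K \<noteq> {}" for A
  proof -
    obtain x where "x \<in> S" "pt S x \<in> hat S A - K"
      using dense[OF openin_diff[OF openin_hat[OF S A] K(2)] ne] by (rule bexE)
    then show ?thesis using pt_hat[OF S _ A] by (intro bexI[of _ x]) simp_all
  qed
  show ?thesis
  proof (intro equalityI subsetI)
    fix p assume p: "p \<in> K"
    show "p \<in> hat S ?A"
    proof (rule ccontr)
      assume "p \<notin> hat S ?A"
      then have "p \<in> K \<inter> hat S (S - ?A)"
        using hat_Diff[of ?A S] p openin_subset[OF K(1)] by auto
      then show False using *[of "S - ?A"] by blast
    qed
  next
    fix p assume p: "p \<in> hat S ?A"
    show "p \<in> K"
    proof (rule ccontr)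
      assume "p \<notin> K"
      then show False using **[of ?A] p by blast
    qed
  qed
qed


subsection \<open>Morphisms of \<open>CHaus\<close> and \<open>betaSets\<close>\<close>

abbreviation "CH \<equiv> CHaus \<S>"
abbreviation "BS \<equiv> betaSets \<S>"
abbreviation "bhom S T \<equiv> Arr CH (beta S) (beta T)"

lemma Obj_CH: "X \<in> Obj CH \<longleftrightarrow> compact_space X \<and> Hausdorff_space X \<and> topspace X \<in> \<S>"
  by (simp add: CHaus_def)

lemma Arr_CH: "f \<in> Arr CH X Y \<longleftrightarrow> f \<in> extensional (topspace X) \<and> continuous_map X Y f"
  by (simp add: CHaus_def)

lemma Idt_CH: "Idt CH X = (\<lambda>x\<in>topspace X. x)"
  by (simp add: CHaus_def)

lemma Cmp_CH: "Cmp CH X Y Z g f = compose (topspace X) g f"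
  by (simp add: CHaus_def)

lemma Obj_BS [simp]: "Obj BS = \<S>"
  by (simp add: betaSets_def)

lemma Arr_BS [simp]: "Arr BS S T = bhom S T"
  by (simp add: betaSets_def)

lemma Idt_BS: "Idt BS S = (\<lambda>x\<in>tb S. x)"
  by (simp add: betaSets_def Idt_CH)

lemma Cmp_BS: "Cmp BS S T R g f = compose (tb S) g f"
  by (simp add: betaSets_def Cmp_CH)

lemma Arr_CH_in: "f \<in> Arr CH X Y \<Longrightarrow> x \<in> topspace X \<Longrightarrow> f x \<in> topspace Y"
  by (auto simp: Arr_CH continuous_map_def)

lemma Arr_CH_eqI:
  "f \<in> Arr CH X Y \<Longrightarrow> g \<in> Arr CH X Y' \<Longrightarrow> (\<And>x. x \<in> topspace X \<Longrightarrow> f x = g x) \<Longrightarrow> f = g"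
  by (auto simp: Arr_CH intro: extensionalityI)

lemma compose_Arr_CH [intro]:
  assumes "f \<in> Arr CH X Y" "g \<in> Arr CH Y Z" shows "compose (topspace X) g f \<in> Arr CH X Z"
proof -
  have "continuous_map X Z (g \<circ> f)" using assms continuous_map_compose by (auto simp: Arr_CH)
  then have "continuous_map X Z (compose (topspace X) g f)"
    by (rule continuous_map_eq) (simp add: compose_def)
  then show ?thesis by (simp add: Arr_CH)
qed

lemma restrict_Arr_CH: "continuous_map X Y f \<Longrightarrow> restrict f (topspace X) \<in> Arr CH X Y"
  by (auto simp: Arr_CH elim: continuous_map_eq)

lemma id_Arr_CH [intro]: "(\<lambda>x\<in>topspace X. x) \<in> Arr CH X X"
  by (rule restrict_Arr_CH) simp

text \<open>Principal ultrafilters are dense and the target is Hausdorff. Identities between maps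
  out of \<beta>S are therefore checked on elements of \<open>S\<close>.\<close>

lemma beta_Arr_eqI:
  assumes S: "S \<in> \<S>" and Z: "Hausdorff_space Z"
    and f: "f \<in> Arr CH (beta S) Z" and g: "g \<in> Arr CH (beta S) Z"
    and eq: "\<And>x. x \<in> S \<Longrightarrow> f (pt S x) = g (pt S x)"
  shows "f = g"
proof (rule Arr_CH_eqI[OF f g])
  fix p assume "p \<in> tb S"
  then have "p \<in> beta S closure_of (pt S ` S)" using pt_dense[OF S] by simp
  then show "f p = g p"
    by (rule forall_in_closure_of_eq[OF _ Z]) (use f g eq in \<open>auto simp: Arr_CH\<close>)
qed

lemma is_epi_if_surj:
  assumes "X \<in> Obj CH" "Y \<in> Obj CH" "e \<in> Arr CH X Y" "e ` topspace X = topspace Y"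
  shows "is_epi CH X Y e"
  unfolding is_epi_def Cmp_CH
proof (intro conjI ballI impI assms)
  fix Z g h assume *: "g \<in> Arr CH Y Z" "h \<in> Arr CH Y Z" "compose (topspace X) g e = compose (topspace X) h e"
  show "g = h"
  proof (rule Arr_CH_eqI[OF *(1,2)])
    fix y assume "y \<in> topspace Y"
    then obtain x where "x \<in> topspace X" "y = e x" using assms by blast
    then show "g y = h y" using *(3) by (metis compose_eq)
  qed
qed


subsection \<open>Functoriality of \<open>\<beta>\<close>\<close>

lemma uf_of_beta_map:
  assumes "T \<in> \<S>" "f \<in> S \<rightarrow> T" "p \<in> tb S"
  shows "beta_map S T f p \<in> tb T"
    and "uf_of T (beta_map S T f p) = {A. A \<subseteq> T \<and> {x \<in> S. f x \<in> A} \<in> uf_of S p}"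
  using ultrafilter_image[OF assms(2) uf_of_in[OF assms(3)]] assms
  by (auto simp: beta_map_def topspace_beta uf_of_enc)

lemma beta_map_hat:
  assumes "T \<in> \<S>" "f \<in> S \<rightarrow> T" "p \<in> tb S" "A \<subseteq> T"
  shows "beta_map S T f p \<in> hat T A \<longleftrightarrow> p \<in> hat S {x \<in> S. f x \<in> A}"
  using assms uf_of_beta_map[OF assms(1-3)] by (simp add: mem_hat)

lemma beta_map_Arr:
  assumes "S \<in> \<S>" "T \<in> \<S>" "f \<in> S \<rightarrow> T"
  shows "beta_map S T f \<in> bhom S T"
proof -
  have "{p \<in> tb S. beta_map S T f p \<in> hat T A} = hat S {x \<in> S. f x \<in> A}" if "A \<subseteq> T" for A
    using beta_map_hat[OF assms(2,3) _ that] by (auto dest: hat_subset)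
  then show ?thesis
    using assms uf_of_beta_map(1)[OF assms(2,3)] openin_hat[OF assms(1)]
    by (auto simp: Arr_CH continuous_map_beta extensional_def) (simp add: beta_map_def)
qed

lemma beta_map_pt:
  assumes "S \<in> \<S>" "T \<in> \<S>" "f \<in> S \<rightarrow> T" "x \<in> S"
  shows "beta_map S T f (pt S x) = pt T (f x)"
proof (rule beta_eqI)
  fix A assume "A \<subseteq> T" "beta_map S T f (pt S x) \<in> hat T A"
  moreover have "f x \<in> T" using assms by auto
  ultimately show "pt T (f x) \<in> hat T A"
    using beta_map_hat[OF assms(2,3) pt_in[OF assms(4)] \<open>A \<subseteq> T\<close>] assms pt_hat[of S x "{x \<in> S. f x \<in> A}"]
    by (simp add: pt_hat)
qed (use assms in \<open>auto intro!: pt_in uf_of_beta_map(1)\<close>)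

lemma beta_map_cong: "(\<And>x. x \<in> S \<Longrightarrow> f x = g x) \<Longrightarrow> beta_map S T f = beta_map S T g"
  unfolding beta_map_def by (metis (mono_tags, lifting) Collect_cong)

lemma beta_map_compose:
  assumes "S \<in> \<S>" "T \<in> \<S>" "R \<in> \<S>" "f \<in> S \<rightarrow> T" "g \<in> T \<rightarrow> R"
  shows "compose (tb S) (beta_map T R g) (beta_map S T f) = beta_map S R (\<lambda>x. g (f x))"
proof (rule beta_Arr_eqI[OF assms(1)])
  show "Hausdorff_space (beta R)" using beta_in_CHaus assms by (simp add: Obj_CH)
  show "compose (tb S) (beta_map T R g) (beta_map S T f) \<in> bhom S R"
    by (rule compose_Arr_CH[OF beta_map_Arr[OF assms(1,2,4)] beta_map_Arr[OF assms(2,3,5)]])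
  show "beta_map S R (\<lambda>x. g (f x)) \<in> bhom S R"
    using assms by (intro beta_map_Arr) auto
  fix x assume "x \<in> S"
  moreover have "(\<lambda>x. g (f x)) \<in> S \<rightarrow> R" "f x \<in> T" using assms \<open>x \<in> S\<close> by auto
  ultimately show "compose (tb S) (beta_map T R g) (beta_map S T f) (pt S x) = beta_map S R (\<lambda>x. g (f x)) (pt S x)"
    using assms by (simp add: compose_eq pt_in beta_map_pt)
qed

lemma beta_map_id:
  assumes "S \<in> \<S>" "\<And>x. x \<in> S \<Longrightarrow> f x = x"
  shows "beta_map S S f = (\<lambda>p\<in>tb S. p)"
proof (rule beta_Arr_eqI[OF assms(1)])
  show "Hausdorff_space (beta S)" using beta_in_CHaus assms by (simp add: Obj_CH)
  have f: "f \<in> S \<rightarrow> S" using assms by simp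
  then show "beta_map S S f \<in> bhom S S" using assms by (intro beta_map_Arr)
  show "(\<lambda>p\<in>tb S. p) \<in> bhom S S" by (rule id_Arr_CH)
  fix x assume "x \<in> S"
  then show "beta_map S S f (pt S x) = (\<lambda>p\<in>tb S. p) (pt S x)"
    using assms f by (simp add: beta_map_pt pt_in)
qed


subsection \<open>Limits of ultrafilters\<close>

text \<open>Existence is compactness: otherwise finitely many open sets outside the ultrafilter
  would cover \<open>X\<close>, but a finite union of such sets stays outside. Uniqueness is
  Hausdorffness: disjoint neighbourhoods cannot both belong to an ultrafilter.\<close>

lemma uf_limit_exists:
  assumes X: "X \<in> Obj CH" and p: "p \<in> tb (topspace X)"
  shows "\<exists>!x. x \<in> topspace X \<and> (\<forall>V. openin X V \<longrightarrow> x \<in> V \<longrightarrow> V \<in> uf_of (topspace X) p)"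
proof (rule ex_ex1I)
  let ?U = "uf_of (topspace X) p"
  note U = uf_of_in[OF p]
  show "\<exists>x. x \<in> topspace X \<and> (\<forall>V. openin X V \<longrightarrow> x \<in> V \<longrightarrow> V \<in> ?U)"
  proof (rule ccontr)
    assume "\<not> ?thesis"
    then have "\<forall>x\<in>topspace X. \<exists>V. openin X V \<and> x \<in> V \<and> V \<notin> ?U" by blast
    then have "topspace X \<subseteq> \<Union>{V. openin X V \<and> V \<notin> ?U}" by blast
    moreover have "compactin X (topspace X)" using X by (simp add: Obj_CH compact_space_def)
    ultimately obtain \<F> where F: "finite \<F>" "\<F> \<subseteq> {V. openin X V \<and> V \<notin> ?U}" "topspace X \<subseteq> \<Union>\<F>"
      unfolding compactin_def by (metis (no_types, lifting) mem_Collect_eq)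
    have "\<Union>\<F> \<subseteq> topspace X \<and> \<Union>\<F> \<notin> ?U" using F(1,2)
    proof (induction \<F> rule: finite_induct)
      case (insert V \<F>)
      then have V: "openin X V" "V \<notin> ?U" and F: "\<Union>\<F> \<subseteq> topspace X" "\<Union>\<F> \<notin> ?U" by simp_all
      then show ?case
        using ultrafilters_Un[OF U openin_subset[OF V(1)] F(1)] openin_subset[OF V(1)] by simp
    qed (use ultrafilters_not_empty[OF U] in simp)
    then show False using F(3) ultrafilters_top[OF U] by (metis subset_antisym)
  qed
next
  fix x y
  assume *: "x \<in> topspace X \<and> (\<forall>V. openin X V \<longrightarrow> x \<in> V \<longrightarrow> V \<in> uf_of (topspace X) p)"
    "y \<in> topspace X \<and> (\<forall>V. openin X V \<longrightarrow> y \<in> V \<longrightarrow> V \<in> uf_of (topspace X) p)"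
  show "x = y"
  proof (rule ccontr)
    assume "x \<noteq> y"
    then obtain V W where "openin X V" "openin X W" "x \<in> V" "y \<in> W" "disjnt V W"
      using X * unfolding Obj_CH Hausdorff_space_def by metis
    then show False
      using * ultrafilters_Int[OF uf_of_in[OF p]] ultrafilters_not_empty[OF uf_of_in[OF p]]
      unfolding disjnt_def by metis
  qed
qed

lemma
  assumes X: "X \<in> Obj CH" and p: "p \<in> tb (topspace X)"
  shows uf_limit_in: "uf_limit X p \<in> topspace X"
    and uf_limit_openin: "openin X V \<Longrightarrow> uf_limit X p \<in> V \<Longrightarrow> p \<in> hat (topspace X) V"
  using theI'[OF uf_limit_exists[OF X p]] p by (auto simp: uf_limit_def mem_hat)

lemma uf_limit_unique:
  assumes X: "X \<in> Obj CH" and p: "p \<in> tb (topspace X)"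
    and "x \<in> topspace X" "\<And>V. openin X V \<Longrightarrow> x \<in> V \<Longrightarrow> p \<in> hat (topspace X) V"
  shows "uf_limit X p = x"
  using the1_equality[OF uf_limit_exists[OF X p], of x] p assms by (simp add: uf_limit_def mem_hat)

lemma uf_limit_closedin:
  assumes X: "X \<in> Obj CH" and C: "closedin X C" "p \<in> hat (topspace X) C"
  shows "uf_limit X p \<in> C"
proof (rule ccontr)
  have p: "p \<in> tb (topspace X)" by (rule hat_subset[OF C(2)])
  assume "uf_limit X p \<notin> C"
  then have "p \<in> hat (topspace X) (topspace X - C)"
    using uf_limit_in[OF X p] uf_limit_openin[OF X p openin_diff[OF openin_topspace C(1)]] by simp
  then show False using C hat_Diff[OF closedin_subset[OF C(1)]] by simp
qed

text \<open>Continuity rests on regularity. A closed neighbourhood \<open>C\<close> of the limit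
  inside \<open>V\<close> gives a clopen set of ultrafilters, those containing \<open>C\<close>, and
  their limits stay in \<open>C\<close>.\<close>

lemma uf_limit_Arr:
  assumes X: "X \<in> Obj CH" shows "uf_limit X \<in> Arr CH (beta (topspace X)) X"
proof -
  have "openin (beta (topspace X)) {p \<in> tb (topspace X). uf_limit X p \<in> V}" (is "openin _ ?W")
    if V: "openin X V" for V
  proof (subst openin_subopen, intro ballI)
    fix p assume "p \<in> ?W"
    then have p: "p \<in> tb (topspace X)" "uf_limit X p \<in> V" by auto
    have "neighbourhood_base_of (closedin X) X"
      using X by (simp add: neighbourhood_base_of_closedin compact_Hausdorff_imp_regular_space Obj_CH)
    then obtain O' C where C: "openin X O'" "closedin X C" "uf_limit X p \<in> O'" "O' \<subseteq> C" "C \<subseteq> V"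
      using V p(2) unfolding neighbourhood_base_of by meson
    have "p \<in> hat (topspace X) C"
      using uf_limit_openin[OF X p(1) C(1,3)] hat_mono[OF C(4)] closedin_subset[OF C(2)] by blast
    moreover have "hat (topspace X) C \<subseteq> ?W"
      using uf_limit_closedin[OF X C(2)] subsetD[OF C(5)] by (auto intro: hat_subset)
    moreover have "openin (beta (topspace X)) (hat (topspace X) C)"
      using openin_hat X closedin_subset[OF C(2)] by (simp add: Obj_CH)
    ultimately show "\<exists>T. openin (beta (topspace X)) T \<and> p \<in> T \<and> T \<subseteq> ?W" by blast
  qed
  then show ?thesis
    using uf_limit_in[OF X] unfolding Arr_CH continuous_map_def by (auto simp: uf_limit_def)
qed

lemma uf_limit_pt:
  assumes X: "X \<in> Obj CH" "x \<in> topspace X" shows "uf_limit X (pt (topspace X) x) = x"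
proof (rule uf_limit_unique)
  fix V assume V: "openin X V" "x \<in> V"
  then show "pt (topspace X) x \<in> hat (topspace X) V"
    using pt_hat[OF _ X(2) openin_subset[OF V(1)]] X(1) by (simp add: Obj_CH)
qed (use assms pt_in in auto)

lemma uf_limit_surj: "X \<in> Obj CH \<Longrightarrow> uf_limit X ` tb (topspace X) = topspace X"
proof (intro equalityI subsetI)
  fix x assume "X \<in> Obj CH" "x \<in> topspace X"
  then show "x \<in> uf_limit X ` tb (topspace X)"
    using uf_limit_pt by (intro image_eqI[of _ _ "pt (topspace X) x"] pt_in) simp_all
qed (auto simp: uf_limit_in)

lemma is_epi_uf_limit: "X \<in> Obj CH \<Longrightarrow> is_epi CH (beta (topspace X)) X (uf_limit X)"
  by (intro is_epi_if_surj uf_limit_Arr uf_limit_surj beta_in_CHaus) (auto simp: Obj_CH)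

lemma uf_limit_natural:
  assumes X: "X \<in> Obj CH" and Y: "Y \<in> Obj CH" and f: "f \<in> Arr CH X Y"
  shows "compose (tb (topspace X)) (uf_limit Y) (beta_map (topspace X) (topspace Y) f)
    = compose (tb (topspace X)) f (uf_limit X)" (is "?l = ?r")
proof -
  have S: "topspace X \<in> \<S>" "topspace Y \<in> \<S>" using X Y by (auto simp: Obj_CH)
  have f': "f \<in> topspace X \<rightarrow> topspace Y" using f by (auto intro: Arr_CH_in)
  note b = beta_map_Arr[OF S f']
  show ?thesis
  proof (rule beta_Arr_eqI[OF S(1)])
    show "Hausdorff_space Y" using Y by (simp add: Obj_CH)
    show "?l \<in> Arr CH (beta (topspace X)) Y" "?r \<in> Arr CH (beta (topspace X)) Y"
      using b f X Y uf_limit_Arr by blast+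
    fix x assume x: "x \<in> topspace X"
    then have "f x \<in> topspace Y" using f' by auto
    then show "?l (pt (topspace X) x) = ?r (pt (topspace X) x)"
      using x X Y S f' by (simp add: compose_eq pt_in beta_map_pt uf_limit_pt)
  qed
qed

text \<open>Projectivity of \<beta>R along \<xi> made explicit: \<open>f\<close> after
  \<open>pt R\<close> is a map of sets from \<open>R\<close> to |X|, and \<beta> of it lifts
  \<open>f\<close> because \<xi> sends principal ultrafilters back to their points.\<close>

definition lift :: "'u set \<Rightarrow> 'u topology \<Rightarrow> ('u \<Rightarrow> 'u) \<Rightarrow> 'u \<Rightarrow> 'u" where
  "lift R X f = beta_map R (topspace X) (\<lambda>x. f (pt R x))"

lemma
  assumes R: "R \<in> \<S>" and X: "X \<in> Obj CH" and f: "f \<in> Arr CH (beta R) X"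
  shows lift_Arr: "lift R X f \<in> bhom R (topspace X)"
    and uf_limit_lift: "compose (tb R) (uf_limit X) (lift R X f) = f"
proof -
  have S: "topspace X \<in> \<S>" using X by (simp add: Obj_CH)
  have f': "(\<lambda>x. f (pt R x)) \<in> R \<rightarrow> topspace X" using f by (auto intro: Arr_CH_in pt_in)
  show l: "lift R X f \<in> bhom R (topspace X)"
    unfolding lift_def by (rule beta_map_Arr[OF R S f'])
  show "compose (tb R) (uf_limit X) (lift R X f) = f"
  proof (rule beta_Arr_eqI[OF R _ _ f])
    show "Hausdorff_space X" using X by (simp add: Obj_CH)
    show "compose (tb R) (uf_limit X) (lift R X f) \<in> Arr CH (beta R) X"
      using l uf_limit_Arr[OF X] by blast
    fix x assume x: "x \<in> R"
    then have "f (pt R x) \<in> topspace X" using f' by auto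
    then show "compose (tb R) (uf_limit X) (lift R X f) (pt R x) = f (pt R x)"
      using x by (simp add: compose_eq pt_in lift_def beta_map_pt[OF R S f'] uf_limit_pt[OF X])
  qed
qed


subsection \<open>Fibre products\<close>

text \<open>Hausdorffness of \<open>Z\<close> makes the fibre product closed in the product, hence
  compact. Its points are pairs, so the projections and the universal map pass through
  \<open>dec\<close> and \<open>enc\<close>, which smallness makes inverse to each other.\<close>

lemma
  assumes X: "X \<in> Obj CH" and Y: "Y \<in> Obj CH" and Z: "Z \<in> Obj CH"
    and f: "f \<in> Arr CH X Z" and g: "g \<in> Arr CH Y Z"
  shows fibprod_Obj: "fibprod X Y f g \<in> Obj CH"
    and fibprod_pr1_Arr: "fibprod_pr1 X Y f g \<in> Arr CH (fibprod X Y f g) X"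
    and fibprod_pr2_Arr: "fibprod_pr2 X Y f g \<in> Arr CH (fibprod X Y f g) Y"
    and fibprod_commute: "compose (topspace (fibprod X Y f g)) f (fibprod_pr1 X Y f g)
      = compose (topspace (fibprod X Y f g)) g (fibprod_pr2 X Y f g)"
    and fibprod_universal: "\<And>W a b. a \<in> Arr CH W X \<Longrightarrow> b \<in> Arr CH W Y \<Longrightarrow>
      compose (topspace W) f a = compose (topspace W) g b \<Longrightarrow>
      \<exists>h\<in>Arr CH W (fibprod X Y f g). compose (topspace W) (fibprod_pr1 X Y f g) h = a \<and>
        compose (topspace W) (fibprod_pr2 X Y f g) h = b"
proof -
  let ?P = "prod_topology X Y" and ?F = "fibprod_space X Y f g" and ?Q = "fibprod X Y f g"
  let ?d = "dec (topspace ?F) :: 'u \<Rightarrow> 'u \<times> 'u"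
  let ?e = "enc (topspace ?F) :: 'u \<times> 'u \<Rightarrow> 'u"
  have tF: "topspace ?F = {z \<in> topspace ?P. f (fst z) = g (snd z)}"
    by (auto simp: fibprod_space_def)
  have Ha: "Hausdorff_space ?P" using X Y by (simp add: Obj_CH Hausdorff_space_prod_topology)
  have co: "compact_space ?P" using X Y by (simp add: Obj_CH compact_space_prod_topology)
  have "continuous_map ?P Z (f \<circ> fst)" "continuous_map ?P Z (g \<circ> snd)"
    using f g by (auto simp: Arr_CH intro!: continuous_map_compose[OF continuous_map_fst] continuous_map_compose[OF continuous_map_snd])
  then have "closedin ?P {z \<in> topspace ?P. (f \<circ> fst) z = (g \<circ> snd) z}"
    by (rule closedin_continuous_maps_eq[rotated]) (use Z in \<open>simp add: Obj_CH\<close>)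
  then have "compactin ?P (topspace ?F)" using closedin_compact_space co by (auto simp: tF)
  moreover have F_eq: "?F = subtopology ?P (topspace ?F)"
    unfolding fibprod_space_def by (metis subtopology_restrict topspace_subtopology)
  ultimately have cF: "compact_space ?F"
    using compact_space_subtopology by metis
  have hF: "Hausdorff_space ?F" using Ha by (simp add: fibprod_space_def Hausdorff_space_subtopology)
  have "small \<S> (topspace X \<times> topspace Y)" using X Y by (intro small_Times small_in) (auto simp: Obj_CH)
  then have sF: "small \<S> (topspace ?F)" by (rule small_subset) (auto simp: tF)
  show "?Q \<in> Obj CH" unfolding fibprod_def by (rule enc_top_in_CHaus[OF cF hF sF])
  have tQ: "topspace ?Q = ?e ` topspace ?F" by (simp add: fibprod_def topspace_enc_top)
  have dQ: "?d p \<in> topspace ?F" if "p \<in> topspace ?Q" for p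
    using that by (simp add: tQ dec_in)
  have cd: "continuous_map ?Q ?P ?d"
    using continuous_map_dec[OF sF] F_eq continuous_map_in_subtopology
    by (metis fibprod_def)
  have "continuous_map ?Q X (fst \<circ> ?d)" "continuous_map ?Q Y (snd \<circ> ?d)"
    using continuous_map_compose[OF cd continuous_map_fst]
      continuous_map_compose[OF cd continuous_map_snd] .
  from this[THEN restrict_Arr_CH]
  show pr1: "fibprod_pr1 X Y f g \<in> Arr CH ?Q X" and pr2: "fibprod_pr2 X Y f g \<in> Arr CH ?Q Y"
    by (simp_all add: fibprod_pr1_def fibprod_pr2_def comp_def)
  show "compose (topspace ?Q) f (fibprod_pr1 X Y f g) = compose (topspace ?Q) g (fibprod_pr2 X Y f g)"
    using dQ by (auto simp: compose_def fibprod_pr1_def fibprod_pr2_def tF intro!: restrict_ext)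
  fix W a b
  assume a: "a \<in> Arr CH W X" and b: "b \<in> Arr CH W Y"
    and ab: "compose (topspace W) f a = compose (topspace W) g b"
  have im: "(a w, b w) \<in> topspace ?F" if "w \<in> topspace W" for w
    using that Arr_CH_in[OF a that] Arr_CH_in[OF b that] ab
    by (auto simp: tF) (metis compose_eq)
  have "continuous_map W ?P (\<lambda>w. (a w, b w))"
    using a b by (auto simp: Arr_CH intro!: continuous_map_pairedI)
  then have "continuous_map W (subtopology ?P (topspace ?F)) (\<lambda>w. (a w, b w))"
    using im by (simp add: continuous_map_in_subtopology image_subset_iff Pi_iff)
  then have "continuous_map W ?F (\<lambda>w. (a w, b w))" unfolding F_eq[symmetric] .
  then have "continuous_map W ?Q (?e \<circ> (\<lambda>w. (a w, b w)))"
    unfolding fibprod_def using continuous_map_enc[OF sF] by (rule continuous_map_compose)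
  then have h: "restrict (?e \<circ> (\<lambda>w. (a w, b w))) (topspace W) \<in> Arr CH W ?Q" (is "?h \<in> _")
    by (rule restrict_Arr_CH)
  show "\<exists>h\<in>Arr CH W ?Q. compose (topspace W) (fibprod_pr1 X Y f g) h = a \<and>
        compose (topspace W) (fibprod_pr2 X Y f g) h = b"
  proof (intro bexI[OF _ h] conjI)
    have hw: "?h w \<in> topspace ?Q" "?d (?h w) = (a w, b w)" if "w \<in> topspace W" for w
      using that Arr_CH_in[OF h that] im sF by auto
    show "compose (topspace W) (fibprod_pr1 X Y f g) ?h = a"
      by (rule Arr_CH_eqI[OF compose_Arr_CH[OF h pr1] a])
         (use hw in \<open>simp add: compose_eq fibprod_pr1_def\<close>)
    show "compose (topspace W) (fibprod_pr2 X Y f g) ?h = b"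
      by (rule Arr_CH_eqI[OF compose_Arr_CH[OF h pr2] b])
         (use hw in \<open>simp add: compose_eq fibprod_pr2_def\<close>)
  qed
qed

end


subsection \<open>Presheaf categories\<close>

text \<open>The record \<open>cat\<close> carries no axioms; these are the laws on which
  \<open>PSh_functorI\<close> and \<open>left_adjoint_unique\<close> rely.\<close>

definition is_cat :: "('o, 'm) cat \<Rightarrow> bool" where
  "is_cat C \<longleftrightarrow>
     (\<forall>X \<in> Obj C. Idt C X \<in> Arr C X X) \<and>
     (\<forall>X \<in> Obj C. \<forall>Y \<in> Obj C. \<forall>f \<in> Arr C X Y.
        Cmp C X X Y f (Idt C X) = f \<and> Cmp C X Y Y (Idt C Y) f = f) \<and>
     (\<forall>X \<in> Obj C. \<forall>Y \<in> Obj C. \<forall>Z \<in> Obj C. \<forall>f \<in> Arr C X Y. \<forall>g \<in> Arr C Y Z.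
        Cmp C X Y Z g f \<in> Arr C X Z) \<and>
     (\<forall>X \<in> Obj C. \<forall>Y \<in> Obj C. \<forall>Z \<in> Obj C. \<forall>W \<in> Obj C.
        \<forall>f \<in> Arr C X Y. \<forall>g \<in> Arr C Y Z. \<forall>h \<in> Arr C Z W.
        Cmp C X Y W (Cmp C Y Z W h g) f = Cmp C X Z W h (Cmp C X Y Z g f))"

lemma PSh_Obj: "F \<in> Obj (PSh \<S> C) \<longleftrightarrow> is_functor (opcat C) (Sets \<S>) F"
  by (simp add: PSh_def)

lemma PSh_ObjI:
  assumes "\<And>X. X \<in> Obj C \<Longrightarrow> FOb F X \<in> \<S>"
    and "\<And>X Y f. X \<in> Obj C \<Longrightarrow> Y \<in> Obj C \<Longrightarrow> f \<in> Arr C X Y \<Longrightarrow> FAr F Y X f \<in> FOb F Y \<rightarrow>\<^sub>E FOb F X"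
    and "\<And>X. X \<in> Obj C \<Longrightarrow> Idt C X \<in> Arr C X X"
    and "\<And>X s. X \<in> Obj C \<Longrightarrow> s \<in> FOb F X \<Longrightarrow> FAr F X X (Idt C X) s = s"
    and "\<And>X Y Z f g. X \<in> Obj C \<Longrightarrow> Y \<in> Obj C \<Longrightarrow> Z \<in> Obj C \<Longrightarrow>
      f \<in> Arr C X Y \<Longrightarrow> g \<in> Arr C Y Z \<Longrightarrow> Cmp C X Y Z g f \<in> Arr C X Z"
    and "\<And>X Y Z f g s. X \<in> Obj C \<Longrightarrow> Y \<in> Obj C \<Longrightarrow> Z \<in> Obj C \<Longrightarrow>
      f \<in> Arr C X Y \<Longrightarrow> g \<in> Arr C Y Z \<Longrightarrow> s \<in> FOb F Z \<Longrightarrow>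
      FAr F Z X (Cmp C X Y Z g f) s = FAr F Y X f (FAr F Z Y g s)"
  shows "F \<in> Obj (PSh \<S> C)"
  unfolding PSh_Obj is_functor_def opcat_def Sets_def
proof (simp, intro conjI ballI)
  fix X assume X: "X \<in> Obj C"
  show "FOb F X \<in> \<S>" by (rule assms(1)[OF X])
  show "FAr F X X (Idt C X) = (\<lambda>x\<in>FOb F X. x)"
    by (rule extensionalityI[of _ "FOb F X"])
      (use assms(2)[OF X X assms(3)[OF X]] assms(4)[OF X] in \<open>auto simp: PiE_def\<close>)
next
  fix X Y f assume "X \<in> Obj C" "Y \<in> Obj C" "f \<in> Arr C Y X"
  then show "FAr F X Y f \<in> FOb F X \<rightarrow>\<^sub>E FOb F Y" using assms(2) by blast
next
  fix Z Y X f g assume *: "Z \<in> Obj C" "Y \<in> Obj C" "X \<in> Obj C" "g \<in> Arr C Y Z" "f \<in> Arr C X Y"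
  show "FAr F Z X (Cmp C X Y Z g f) = compose (FOb F Z) (FAr F Y X f) (FAr F Z Y g)"
    by (rule extensionalityI[of _ "FOb F Z"])
      (use assms(2)[OF *(3,1) assms(5)[OF *(3,2,1,5,4)]] assms(6)[OF *(3,2,1,5,4)] in
        \<open>auto simp: PiE_def compose_eq\<close>)
qed

lemma
  assumes F: "F \<in> Obj (PSh \<S> C)"
  shows psh_ob: "X \<in> Obj C \<Longrightarrow> FOb F X \<in> \<S>"
    and psh_ar: "X \<in> Obj C \<Longrightarrow> Y \<in> Obj C \<Longrightarrow> f \<in> Arr C X Y \<Longrightarrow> FAr F Y X f \<in> FOb F Y \<rightarrow>\<^sub>E FOb F X"
    and psh_id: "X \<in> Obj C \<Longrightarrow> s \<in> FOb F X \<Longrightarrow> FAr F X X (Idt C X) s = s"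
    and psh_comp: "X \<in> Obj C \<Longrightarrow> Y \<in> Obj C \<Longrightarrow> Z \<in> Obj C \<Longrightarrow>
      f \<in> Arr C X Y \<Longrightarrow> g \<in> Arr C Y Z \<Longrightarrow> s \<in> FOb F Z \<Longrightarrow>
      FAr F Z X (Cmp C X Y Z g f) s = FAr F Y X f (FAr F Z Y g s)"
  using F unfolding PSh_Obj is_functor_def opcat_def Sets_def by (simp_all add: compose_eq)

lemma psh_in:
  assumes "F \<in> Obj (PSh \<S> C)" "X \<in> Obj C" "Y \<in> Obj C" "f \<in> Arr C X Y" "s \<in> FOb F Y"
  shows "FAr F Y X f s \<in> FOb F X"
  using psh_ar[OF assms(1-4)] assms(5) by (rule PiE_mem)

lemma PSh_ArrI:
  assumes F: "F \<in> Obj (PSh \<S> C)" and G: "G \<in> Obj (PSh \<S> C)"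
    and "\<alpha> \<in> extensional (Obj C)"
    and "\<And>X. X \<in> Obj C \<Longrightarrow> \<alpha> X \<in> FOb F X \<rightarrow>\<^sub>E FOb G X"
    and "\<And>X Y f s. X \<in> Obj C \<Longrightarrow> Y \<in> Obj C \<Longrightarrow> f \<in> Arr C X Y \<Longrightarrow> s \<in> FOb F Y \<Longrightarrow>
      \<alpha> X (FAr F Y X f s) = FAr G Y X f (\<alpha> Y s)"
  shows "\<alpha> \<in> Arr (PSh \<S> C) F G"
  using assms(3-) by (auto simp: PSh_def nat_trans_def opcat_def Sets_def compose_def intro!: restrict_ext)

lemma
  assumes \<alpha>: "\<alpha> \<in> Arr (PSh \<S> C) F G"
  shows psh_arr_extensional: "\<alpha> \<in> extensional (Obj C)"
    and psh_arr_PiE: "X \<in> Obj C \<Longrightarrow> \<alpha> X \<in> FOb F X \<rightarrow>\<^sub>E FOb G X"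
    and psh_nat: "X \<in> Obj C \<Longrightarrow> Y \<in> Obj C \<Longrightarrow> f \<in> Arr C X Y \<Longrightarrow> s \<in> FOb F Y \<Longrightarrow>
      \<alpha> X (FAr F Y X f s) = FAr G Y X f (\<alpha> Y s)"
proof -
  have *: "\<alpha> \<in> extensional (Obj C)" "\<And>X. X \<in> Obj C \<Longrightarrow> \<alpha> X \<in> FOb F X \<rightarrow>\<^sub>E FOb G X"
    "\<And>X Y f. X \<in> Obj C \<Longrightarrow> Y \<in> Obj C \<Longrightarrow> f \<in> Arr C X Y \<Longrightarrow>
      compose (FOb F Y) (\<alpha> X) (FAr F Y X f) = compose (FOb F Y) (FAr G Y X f) (\<alpha> Y)"
    using \<alpha> by (simp_all add: PSh_def nat_trans_def opcat_def Sets_def)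
  show "\<alpha> \<in> extensional (Obj C)" by (rule *(1))
  show "X \<in> Obj C \<Longrightarrow> \<alpha> X \<in> FOb F X \<rightarrow>\<^sub>E FOb G X" by (rule *(2))
  assume "X \<in> Obj C" "Y \<in> Obj C" "f \<in> Arr C X Y" "s \<in> FOb F Y"
  then show "\<alpha> X (FAr F Y X f s) = FAr G Y X f (\<alpha> Y s)"
    using fun_cong[OF *(3), of X Y f s] by (simp add: compose_eq)
qed

lemma psh_arr_in: "\<alpha> \<in> Arr (PSh \<S> C) F G \<Longrightarrow> X \<in> Obj C \<Longrightarrow> s \<in> FOb F X \<Longrightarrow> \<alpha> X s \<in> FOb G X"
  by (rule PiE_mem[OF psh_arr_PiE])

lemma PSh_Arr_eqI:
  assumes "\<alpha> \<in> Arr (PSh \<S> C) F G" "\<beta> \<in> Arr (PSh \<S> C) F G"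
    and "\<And>X s. X \<in> Obj C \<Longrightarrow> s \<in> FOb F X \<Longrightarrow> \<alpha> X s = \<beta> X s"
  shows "\<alpha> = \<beta>"
proof (rule extensionalityI[OF psh_arr_extensional[OF assms(1)] psh_arr_extensional[OF assms(2)]])
  fix X assume X: "X \<in> Obj C"
  show "\<alpha> X = \<beta> X"
    by (rule extensionalityI[of _ "FOb F X"])
      (use psh_arr_PiE[OF assms(1) X] psh_arr_PiE[OF assms(2) X] assms(3)[OF X] in \<open>auto simp: PiE_def\<close>)
qed

lemma PSh_Cmp_apply: "X \<in> Obj C \<Longrightarrow> s \<in> FOb F X \<Longrightarrow> Cmp (PSh \<S> C) F G H \<beta> \<alpha> X s = \<beta> X (\<alpha> X s)"
  by (simp add: PSh_def Sets_def compose_eq)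

lemma PSh_Idt_apply: "X \<in> Obj C \<Longrightarrow> s \<in> FOb F X \<Longrightarrow> Idt (PSh \<S> C) F X s = s"
  by (simp add: PSh_def Sets_def)

lemma PSh_Cmp_Arr:
  assumes "F \<in> Obj (PSh \<S> C)" "H \<in> Obj (PSh \<S> C)"
    and \<alpha>: "\<alpha> \<in> Arr (PSh \<S> C) F G" and \<beta>: "\<beta> \<in> Arr (PSh \<S> C) G H"
  shows "Cmp (PSh \<S> C) F G H \<beta> \<alpha> \<in> Arr (PSh \<S> C) F H"
proof (rule PSh_ArrI[OF assms(1,2)])
  show "Cmp (PSh \<S> C) F G H \<beta> \<alpha> \<in> extensional (Obj C)" by (simp add: PSh_def)
  fix X assume X: "X \<in> Obj C"
  have "\<And>x. x \<in> FOb F X \<Longrightarrow> \<beta> X (\<alpha> X x) \<in> FOb H X"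
    by (rule psh_arr_in[OF \<beta> X psh_arr_in[OF \<alpha> X]])
  then show "Cmp (PSh \<S> C) F G H \<beta> \<alpha> X \<in> FOb F X \<rightarrow>\<^sub>E FOb H X"
    using X by (simp add: PSh_def Sets_def compose_def)
next
  fix X Y f s assume *: "X \<in> Obj C" "Y \<in> Obj C" "f \<in> Arr C X Y" "s \<in> FOb F Y"
  then show "Cmp (PSh \<S> C) F G H \<beta> \<alpha> X (FAr F Y X f s) = FAr H Y X f (Cmp (PSh \<S> C) F G H \<beta> \<alpha> Y s)"
    by (simp add: PSh_Cmp_apply psh_in[OF assms(1)] psh_nat[OF \<alpha>] psh_nat[OF \<beta>] psh_arr_in[OF \<alpha>])
qed

lemma PSh_Idt_Arr:
  assumes "F \<in> Obj (PSh \<S> C)" shows "Idt (PSh \<S> C) F \<in> Arr (PSh \<S> C) F F"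
proof (rule PSh_ArrI[OF assms assms])
  fix X Y f s assume *: "X \<in> Obj C" "Y \<in> Obj C" "f \<in> Arr C X Y" "s \<in> FOb F Y"
  then show "Idt (PSh \<S> C) F X (FAr F Y X f s) = FAr F Y X f (Idt (PSh \<S> C) F Y s)"
    by (simp add: PSh_Idt_apply psh_in[OF assms])
qed (auto simp: PSh_def Sets_def)

lemma is_cat_PSh: "is_cat (PSh \<S> C)"
  unfolding is_cat_def
proof (intro conjI ballI)
  fix F G \<alpha> assume *: "F \<in> Obj (PSh \<S> C)" "G \<in> Obj (PSh \<S> C)" "\<alpha> \<in> Arr (PSh \<S> C) F G"
  note i = PSh_Idt_Arr[OF *(1)] PSh_Idt_Arr[OF *(2)]
  show "Cmp (PSh \<S> C) F F G \<alpha> (Idt (PSh \<S> C) F) = \<alpha>"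
    by (rule PSh_Arr_eqI[OF PSh_Cmp_Arr[OF *(1,2) i(1) *(3)] *(3)])
       (simp add: PSh_Cmp_apply PSh_Idt_apply)
  show "Cmp (PSh \<S> C) F G G (Idt (PSh \<S> C) G) \<alpha> = \<alpha>"
    by (rule PSh_Arr_eqI[OF PSh_Cmp_Arr[OF *(1,2,3) i(2)] *(3)])
       (simp add: PSh_Cmp_apply PSh_Idt_apply psh_arr_in[OF *(3)])
next
  fix F G H K \<alpha> \<beta> \<gamma>
  assume *: "F \<in> Obj (PSh \<S> C)" "G \<in> Obj (PSh \<S> C)" "H \<in> Obj (PSh \<S> C)" "K \<in> Obj (PSh \<S> C)"
    "\<alpha> \<in> Arr (PSh \<S> C) F G" "\<beta> \<in> Arr (PSh \<S> C) G H" "\<gamma> \<in> Arr (PSh \<S> C) H K"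
  show "Cmp (PSh \<S> C) F G K (Cmp (PSh \<S> C) G H K \<gamma> \<beta>) \<alpha> = Cmp (PSh \<S> C) F H K \<gamma> (Cmp (PSh \<S> C) F G H \<beta> \<alpha>)"
    by (rule PSh_Arr_eqI[OF PSh_Cmp_Arr[OF *(1,4,5) PSh_Cmp_Arr[OF *(2,4,6,7)]]
           PSh_Cmp_Arr[OF *(1,4) PSh_Cmp_Arr[OF *(1,3,5,6)] *(7)]])
       (simp add: PSh_Cmp_apply psh_arr_in[OF *(5)] psh_arr_in[OF *(6)])
qed (auto intro: PSh_Idt_Arr PSh_Cmp_Arr)

lemma Obj_full_subcat: "X \<in> Obj (full_subcat C P) \<longleftrightarrow> X \<in> Obj C \<and> P X"
  by (simp add: full_subcat_def)

lemma full_subcat_simps [simp]: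
  "Arr (full_subcat C P) = Arr C" "Idt (full_subcat C P) = Idt C" "Cmp (full_subcat C P) = Cmp C"
  by (simp_all add: full_subcat_def)

lemma is_cat_full_subcat: "is_cat C \<Longrightarrow> is_cat (full_subcat C P)"
  unfolding is_cat_def by (simp add: Obj_full_subcat)


subsection \<open>Epimorphisms and finite coproducts\<close>

text \<open>The closed set \<open>K\<close> is collapsed to the point at infinity of its complement.
  A neighbourhood of infinity pulls back to the complement of a compact set disjoint from
  \<open>K\<close>, and compact sets are closed because \<open>X\<close> is Hausdorff.\<close>

lemma continuous_map_collapse:
  assumes X: "Hausdorff_space X" and K: "closedin X K"
  shows "continuous_map X (Alexandroff_compactification (subtopology X (topspace X - K)))
    (\<lambda>x. if x \<in> K then None else Some x)" (is "continuous_map X ?A ?f")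
  unfolding continuous_map_def
proof (intro conjI allI impI)
  fix V assume "openin ?A V"
  then consider U where "openin (subtopology X (topspace X - K)) U" "V = Some ` U"
    | C where "compactin (subtopology X (topspace X - K)) C" "V = insert None (Some ` (topspace X - K - C))"
    unfolding openin_Alexandroff_compactification by auto
  then show "openin X {x \<in> topspace X. ?f x \<in> V}"
  proof cases
    case 1
    then have U: "openin X U" "U \<subseteq> topspace X - K"
      using openin_trans_full[OF 1(1)] openin_diff[OF openin_topspace K] openin_subset[OF 1(1)] by auto
    then have "{x \<in> topspace X. ?f x \<in> V} = U" using 1 by auto
    then show ?thesis using U by simp
  next
    case 2
    then have C: "compactin X C" "C \<subseteq> topspace X - K" by (simp_all add: compactin_subtopology)
    then have "{x \<in> topspace X. ?f x \<in> V} = topspace X - C" using 2 by auto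
    then show ?thesis using compactin_imp_closedin[OF X C(1)] by (simp add: openin_diff)
  qed
qed auto

context small_sets
begin

lemma CH_closed_image:
  assumes "X \<in> Obj CH" "Y \<in> Obj CH" "f \<in> Arr CH X Y"
  shows "closedin Y (f ` topspace X)"
  using continuous_imp_closed_map[of X Y f] assms closed_map_def by (fastforce simp: Obj_CH Arr_CH)

lemma enc_Arr_CH:
  assumes "small \<S> (topspace Z)" "continuous_map X Z f"
  shows "(\<lambda>x\<in>topspace X. enc (topspace Z) (f x)) \<in> Arr CH X (enc_top Z)"
  using restrict_Arr_CH[OF continuous_map_compose[OF assms(2) continuous_map_enc[OF assms(1)]]]
  by (simp add: comp_def)

text \<open>The quotient X/K is realised as the one-point compactification of X - K, which is
  Hausdorff because an open subspace is locally compact, and small because only one point is added.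
  The collapse and the constant map at infinity agree exactly on \<open>K\<close>.\<close>

lemma separate_closed:
  assumes X: "X \<in> Obj CH" and K: "closedin X K" "K \<noteq> topspace X"
  obtains Z g h where "Z \<in> Obj CH" "g \<in> Arr CH X Z" "h \<in> Arr CH X Z" "\<forall>x\<in>K. g x = h x" "g \<noteq> h"
proof -
  let ?Y = "subtopology X (topspace X - K)"
  let ?A = "Alexandroff_compactification ?Y"
  have H: "Hausdorff_space X" "compact_space X" using X by (auto simp: Obj_CH)
  have KX: "K \<subseteq> topspace X" using K closedin_subset by blast
  have "locally_compact_space ?Y"
    using H K by (intro locally_compact_space_open_subset compact_imp_locally_compact_space) auto
  then have HA: "Hausdorff_space ?A"
    using H Hausdorff_space_Alexandroff_compactification Hausdorff_space_subtopology by blast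
  have "small \<S> (insert None (Some ` topspace X))"
    using X by (intro small_option small_in) (simp add: Obj_CH)
  then have sA: "small \<S> (topspace ?A)" by (rule small_subset) auto
  let ?f = "\<lambda>x. if x \<in> K then None else Some x"
  let ?g = "\<lambda>x\<in>topspace X. enc (topspace ?A) (?f x) :: 'u"
  let ?h = "\<lambda>x\<in>topspace X. enc (topspace ?A) None :: 'u"
  show thesis
  proof
    show "enc_top ?A \<in> Obj CH" by (intro enc_top_in_CHaus HA sA) simp
    show "?g \<in> Arr CH X (enc_top ?A)"
      by (rule enc_Arr_CH[OF sA continuous_map_collapse[OF H(1) K(1)]])
    show "?h \<in> Arr CH X (enc_top ?A)"
      by (rule enc_Arr_CH[OF sA]) simp
    show "\<forall>x\<in>K. ?g x = ?h x" using KX by auto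
    obtain x where x: "x \<in> topspace X" "x \<notin> K" using K KX by blast
    then have "(enc (topspace ?A) (Some x) :: 'u) \<noteq> enc (topspace ?A) None"
      using inj_on_eq_iff[OF inj_on_enc[OF sA], of "Some x" None] by auto
    then have "?g x \<noteq> ?h x" using x by simp
    then show "?g \<noteq> ?h" by metis
  qed
qed

text \<open>The image is closed by compactness. Were it proper, two different maps agreeing on it
  would contradict right cancellation.\<close>

lemma epi_surj:
  assumes "is_epi CH X Y e" shows "e ` topspace X = topspace Y"
proof (rule ccontr)
  have *: "X \<in> Obj CH" "Y \<in> Obj CH" "e \<in> Arr CH X Y" using assms by (auto simp: is_epi_def)
  assume "e ` topspace X \<noteq> topspace Y"
  from separate_closed[OF *(2) CH_closed_image[OF *] this]
  obtain Z g h where Z: "Z \<in> Obj CH" "g \<in> Arr CH Y Z" "h \<in> Arr CH Y Z"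
    "\<forall>x\<in>e ` topspace X. g x = h x" "g \<noteq> h" .
  have "compose (topspace X) g e = compose (topspace X) h e"
    unfolding compose_def by (rule restrict_ext) (use Z(4) in blast)
  then show False using assms Z(1,2,3,5) unfolding is_epi_def Cmp_CH by blast
qed

text \<open>Each injection has a continuous inverse on its closed image, by compactness. The
  component maps, transported to these images, are pasted along a finite closed cover with disjoint
  members.\<close>

lemma CH_coproductI:
  assumes I: "finite I" and c: "c \<in> Obj CH" and X: "\<And>i. i \<in> I \<Longrightarrow> X i \<in> Obj CH"
    and \<iota>: "\<And>i. i \<in> I \<Longrightarrow> \<iota> i \<in> Arr CH (X i) c"
    and inj: "\<And>i. i \<in> I \<Longrightarrow> inj_on (\<iota> i) (topspace (X i))"
    and disj: "\<And>i j x y. i \<in> I \<Longrightarrow> j \<in> I \<Longrightarrow> x \<in> topspace (X i) \<Longrightarrow> y \<in> topspace (X j) \<Longrightarrow>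
      \<iota> i x = \<iota> j y \<Longrightarrow> i = j"
    and cover: "topspace c \<subseteq> (\<Union>i\<in>I. \<iota> i ` topspace (X i))"
  shows "is_coproduct CH I X c \<iota>"
  unfolding is_coproduct_def Cmp_CH
proof (intro conjI ballI allI impI c X \<iota>; (assumption)?)
  fix d g assume d: "d \<in> Obj CH" and g: "\<forall>i\<in>I. g i \<in> Arr CH (X i) d"
  define r where "r i = inv_into (topspace (X i)) (\<iota> i)" for i
  have r: "r i (\<iota> i x) = x" if "i \<in> I" "x \<in> topspace (X i)" for i x
    using that inj by (simp add: r_def)
  have cont: "continuous_map (subtopology c (\<iota> i ` topspace (X i))) d (g i \<circ> r i)" if i: "i \<in> I" for i
  proof (rule continuous_map_compose)
    show "continuous_map (subtopology c (\<iota> i ` topspace (X i))) (X i) (r i)"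
      by (rule continuous_inverse_map[of _ _ "\<iota> i"])
        (use X[OF i] c \<iota>[OF i] r[OF i] in \<open>auto simp: Obj_CH Arr_CH\<close>)
    show "continuous_map (X i) d (g i)" using g i by (simp add: Arr_CH)
  qed
  obtain h where h: "continuous_map c d h"
    "\<And>x i. i \<in> I \<Longrightarrow> x \<in> topspace c \<inter> \<iota> i ` topspace (X i) \<Longrightarrow> h x = (g i \<circ> r i) x"
  proof (rule pasting_lemma_exists_closed[OF I cover _ cont])
    show "closedin c (\<iota> i ` topspace (X i))" if "i \<in> I" for i
      by (rule CH_closed_image[OF X[OF that] c \<iota>[OF that]])
    show "(g i \<circ> r i) x = (g j \<circ> r j) x"
      if "i \<in> I" "j \<in> I" "x \<in> topspace c \<inter> \<iota> i ` topspace (X i) \<inter> \<iota> j ` topspace (X j)" for i j x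
      using that disj by blast
  qed (assumption | blast)+
  show "\<exists>!h. h \<in> Arr CH c d \<and> (\<forall>i\<in>I. compose (topspace (X i)) h (\<iota> i) = g i)"
  proof (rule ex1I[of _ "restrict h (topspace c)"], intro conjI ballI)
    show h': "restrict h (topspace c) \<in> Arr CH c d" by (rule restrict_Arr_CH[OF h(1)])
    show "compose (topspace (X i)) (restrict h (topspace c)) (\<iota> i) = g i" if i: "i \<in> I" for i
    proof (rule Arr_CH_eqI[OF compose_Arr_CH[OF \<iota>[OF i] h']])
      show "g i \<in> Arr CH (X i) d" using g i by blast
      fix x assume x: "x \<in> topspace (X i)"
      then have "\<iota> i x \<in> topspace c" by (rule Arr_CH_in[OF \<iota>[OF i]])
      then show "compose (topspace (X i)) (restrict h (topspace c)) (\<iota> i) x = g i x"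
        using x h(2)[OF i, of "\<iota> i x"] r[OF i x] by (simp add: compose_eq)
    qed
    fix h' assume h': "h' \<in> Arr CH c d \<and> (\<forall>i\<in>I. compose (topspace (X i)) h' (\<iota> i) = g i)"
    show "h' = restrict h (topspace c)"
    proof (rule Arr_CH_eqI)
      show "h' \<in> Arr CH c d" using h' by blast
      show "restrict h (topspace c) \<in> Arr CH c d" by (rule restrict_Arr_CH[OF h(1)])
      fix y assume y: "y \<in> topspace c"
      then obtain i x where ix: "i \<in> I" "x \<in> topspace (X i)" "y = \<iota> i x" using cover by blast
      then have "h' y = g i x" using h' compose_eq[OF ix(2), of h' "\<iota> i"] by auto
      then show "h' y = restrict h (topspace c) y"
        using h(2)[OF ix(1), of y] ix y r by simp
    qed
  qed
qed

lemma BS_coproductI: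
  assumes "is_coproduct CH I (\<lambda>i. beta (S i)) (beta c) \<iota>" "c \<in> \<S>" "\<And>i. i \<in> I \<Longrightarrow> S i \<in> \<S>"
  shows "is_coproduct BS I S c \<iota>"
  using assms beta_in_CHaus unfolding is_coproduct_def
  by (simp add: betaSets_def)

text \<open>Only the universal property is available, so it is tested against chosen objects.
  \<open>X i\<close> with an isolated point added receives \<open>X i\<close> identically and every
  other summand at the added point, which gives injectivity and disjointness. If the images failed
  to cover, \<open>separate_closed\<close> would contradict uniqueness.\<close>

lemma CH_coproductD:
  assumes I: "finite I" and cop: "is_coproduct CH I X c \<iota>"
  shows "i \<in> I \<Longrightarrow> inj_on (\<iota> i) (topspace (X i))" (is "_ \<Longrightarrow> ?inj")
    and "i \<in> I \<Longrightarrow> j \<in> I \<Longrightarrow> x \<in> topspace (X i) \<Longrightarrow> y \<in> topspace (X j) \<Longrightarrow> \<iota> i x = \<iota> j y \<Longrightarrow> i = j"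
    and "topspace c = (\<Union>i\<in>I. \<iota> i ` topspace (X i))"
proof -
  have c: "c \<in> Obj CH" and X: "\<And>i. i \<in> I \<Longrightarrow> X i \<in> Obj CH"
    and \<iota>: "\<And>i. i \<in> I \<Longrightarrow> \<iota> i \<in> Arr CH (X i) c"
    and univ: "\<And>d g. d \<in> Obj CH \<Longrightarrow> (\<And>i. i \<in> I \<Longrightarrow> g i \<in> Arr CH (X i) d) \<Longrightarrow>
      \<exists>!h. h \<in> Arr CH c d \<and> (\<forall>i\<in>I. compose (topspace (X i)) h (\<iota> i) = g i)"
    using cop unfolding is_coproduct_def Cmp_CH by auto
  have *: "inj_on (\<iota> i) (topspace (X i)) \<and>
      (\<forall>j\<in>I. j \<noteq> i \<longrightarrow> (\<forall>x\<in>topspace (X i). \<forall>y\<in>topspace (X j). \<iota> i x \<noteq> \<iota> j y))" if i: "i \<in> I" for i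
  proof -
    let ?A = "Alexandroff_compactification (X i)"
    let ?e = "enc (topspace ?A) :: _ \<Rightarrow> 'u"
    have Xi: "compact_space (X i)" "Hausdorff_space (X i)" "topspace (X i) \<in> \<S>"
      using X[OF i] by (auto simp: Obj_CH)
    have "locally_compact_space (X i)" by (rule compact_imp_locally_compact_space[OF Xi(1)])
    then have HA: "Hausdorff_space ?A"
      using Xi Hausdorff_space_Alexandroff_compactification by blast
    have sA: "small \<S> (topspace ?A)" using small_option[OF small_in[OF Xi(3)]] by simp
    define g where "g j = (\<lambda>x\<in>topspace (X j). ?e (if j = i then Some x else None))" for j
    have "g j \<in> Arr CH (X j) (enc_top ?A)" if "j \<in> I" for j
    proof (cases "j = i")
      case True
      have "(\<lambda>x\<in>topspace (X i). ?e (Some x)) \<in> Arr CH (X i) (enc_top ?A)"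
        by (rule enc_Arr_CH[OF sA continuous_map_Some])
      then show ?thesis using True by (simp add: g_def)
    next
      case False
      have "(\<lambda>x\<in>topspace (X j). ?e None) \<in> Arr CH (X j) (enc_top ?A)"
        by (rule enc_Arr_CH[OF sA]) simp
      then show ?thesis using False by (simp add: g_def)
    qed
    with enc_top_in_CHaus[OF compact_space_Alexandroff_compactification HA sA]
    have "\<exists>!h. h \<in> Arr CH c (enc_top ?A) \<and> (\<forall>j\<in>I. compose (topspace (X j)) h (\<iota> j) = g j)" by (rule univ)
    then obtain h where "\<forall>j\<in>I. compose (topspace (X j)) h (\<iota> j) = g j" by (elim ex1E conjE)
    then have h: "compose (topspace (X j)) h (\<iota> j) = g j" if "j \<in> I" for j using that by (rule bspec)
    have hx: "h (\<iota> j x) = ?e (if j = i then Some x else None)" if "j \<in> I" "x \<in> topspace (X j)" for j x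
      using fun_cong[OF h[OF that(1)], of x] that by (simp add: compose_eq g_def)
    have ee: "?e u = ?e v \<longleftrightarrow> u = v" if "u \<in> topspace ?A" "v \<in> topspace ?A" for u v
      by (rule inj_on_eq_iff[OF inj_on_enc[OF sA] that])
    show ?thesis
    proof (intro conjI ballI impI inj_onI notI)
      fix x y assume "x \<in> topspace (X i)" "y \<in> topspace (X i)" "\<iota> i x = \<iota> i y"
      then show "x = y" using hx[OF i, of x] hx[OF i, of y] ee[of "Some x" "Some y"] by simp
    next
      fix j x y assume "j \<in> I" "j \<noteq> i" "x \<in> topspace (X i)" "y \<in> topspace (X j)" "\<iota> i x = \<iota> j y"
      then show False using hx[OF i, of x] hx[of j y] ee[of "Some x" None] by simp
    qed
  qed
  show "i \<in> I \<Longrightarrow> ?inj" using *[THEN conjunct1] .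
  show "i \<in> I \<Longrightarrow> j \<in> I \<Longrightarrow> x \<in> topspace (X i) \<Longrightarrow> y \<in> topspace (X j) \<Longrightarrow> \<iota> i x = \<iota> j y \<Longrightarrow> i = j"
    using *[THEN conjunct2, rule_format, of i j x y] by metis
  let ?K = "\<Union>i\<in>I. \<iota> i ` topspace (X i)"
  have K: "closedin c ?K"
    using I CH_closed_image[OF X c \<iota>] by (intro closedin_Union) auto
  show "topspace c = ?K"
  proof (rule ccontr)
    assume "topspace c \<noteq> ?K"
    then have "?K \<noteq> topspace c" by simp
    from separate_closed[OF c K this]
    obtain Z g h where Z: "Z \<in> Obj CH" "g \<in> Arr CH c Z" "h \<in> Arr CH c Z" "\<forall>x\<in>?K. g x = h x" "g \<noteq> h" .
    have "compose (topspace (X i)) g (\<iota> i) = compose (topspace (X i)) h (\<iota> i)" if "i \<in> I" for i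
      unfolding compose_def by (rule restrict_ext) (use Z(4) that in blast)
    moreover have "\<And>i. i \<in> I \<Longrightarrow> compose (topspace (X i)) h (\<iota> i) \<in> Arr CH (X i) Z"
      using \<iota> Z(3) by (rule compose_Arr_CH)
    ultimately show False
      using univ[OF Z(1), of "\<lambda>i. compose (topspace (X i)) h (\<iota> i)"] Z(2,3,5) by blast
  qed
qed

text \<open>For injective \<open>f\<close> every \<open>A\<close> is the preimage of its image, so
  the pushed-forward ultrafilter determines the original one.\<close>

lemma beta_map_inj:
  assumes S: "S \<in> \<S>" and T: "T \<in> \<S>" and f: "f \<in> S \<rightarrow> T" and inj: "inj_on f S"
  shows "inj_on (beta_map S T f) (tb S)"
proof (rule inj_onI)
  fix p q assume p: "p \<in> tb S" and q: "q \<in> tb S"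
    and eq: "beta_map S T f p = beta_map S T f q"
  show "p = q"
  proof (rule beta_eqI[OF p q])
    fix A assume A: "A \<subseteq> S" "p \<in> hat S A"
    then have *: "{x \<in> S. f x \<in> f ` A} = A" "f ` A \<subseteq> T"
      using inj_on_image_mem_iff[OF inj _ A(1)] f by auto
    show "q \<in> hat S A"
      using beta_map_hat[OF T f p *(2)] beta_map_hat[OF T f q *(2)] eq A(2) by (simp add: *)
  qed
qed

lemma beta_map_image:
  assumes S: "S \<in> \<S>" and T: "T \<in> \<S>" and f: "f \<in> S \<rightarrow> T" and inj: "inj_on f S"
  shows "beta_map S T f ` tb S = hat T (f ` S)"
proof
  have fS: "f ` S \<subseteq> T" using f by auto
  have "{x \<in> S. f x \<in> f ` S} = S" by auto
  then show "beta_map S T f ` tb S \<subseteq> hat T (f ` S)"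
    using beta_map_hat[OF T f _ fS] hat_top[of S] by auto
  show "hat T (f ` S) \<subseteq> beta_map S T f ` tb S"
  proof
    fix q assume q: "q \<in> hat T (f ` S)"
    then have "S \<noteq> {}" by auto
    then obtain a where a: "a \<in> S" by blast
    \<comment> \<open>A left inverse of \<open>f\<close>, extended by the constant \<open>a\<close>
      off the image. Pushing \<open>q\<close> forward along it gives the required preimage:
      \<open>q\<close> contains the image of \<open>f\<close>, so the default value has no
      influence.\<close>
    define r where "r = (\<lambda>y. if y \<in> f ` S then inv_into S f y else a)"
    have r: "r \<in> T \<rightarrow> S" using a by (auto simp: r_def inv_into_into)
    have fr: "f (r y) = y" if "y \<in> f ` S" for y using that by (simp add: r_def f_inv_into_f)
    have qT: "q \<in> tb T" by (rule hat_subset[OF q])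
    let ?p = "beta_map T S r q"
    have p: "?p \<in> tb S" by (rule uf_of_beta_map(1)[OF S r qT])
    have "beta_map S T f ?p = q"
    proof (rule beta_eqI[OF uf_of_beta_map(1)[OF T f p] qT])
      fix A assume A: "A \<subseteq> T" "beta_map S T f ?p \<in> hat T A"
      let ?D = "{y \<in> T. r y \<in> {x \<in> S. f x \<in> A}}"
      have "q \<in> hat T ?D"
        using A beta_map_hat[OF T f p A(1)] beta_map_hat[OF S r qT, of "{x \<in> S. f x \<in> A}"] by auto
      then have "q \<in> hat T (?D \<inter> f ` S)" using q hat_Int[of ?D T "f ` S"] fS by auto
      moreover have "?D \<inter> f ` S \<subseteq> A" using fr by auto
      ultimately show "q \<in> hat T A" using hat_mono[OF _ A(1)] by blast
    qed
    then show "q \<in> beta_map S T f ` tb S" using p by (metis imageI)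
  qed
qed

text \<open>The test objects must now be of the form \<beta>T. For injectivity and disjointness
  \<open>T\<close> is the set \<open>S i\<close> with one point added, and \<beta> of maps of sets
  replaces the one-point compactification used in \<open>CHaus\<close>.\<close>

lemma BS_coproductD:
  assumes I: "finite I" and cop: "is_coproduct BS I S c \<iota>"
  shows "i \<in> I \<Longrightarrow> inj_on (\<iota> i) (tb (S i))" (is "_ \<Longrightarrow> ?inj")
    and "i \<in> I \<Longrightarrow> j \<in> I \<Longrightarrow> x \<in> tb (S i) \<Longrightarrow> y \<in> tb (S j) \<Longrightarrow> \<iota> i x = \<iota> j y \<Longrightarrow> i = j"
    and "tb c = (\<Union>i\<in>I. \<iota> i ` tb (S i))"
proof -
  have c: "c \<in> \<S>" and S: "\<And>i. i \<in> I \<Longrightarrow> S i \<in> \<S>"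
    and \<iota>: "\<And>i. i \<in> I \<Longrightarrow> \<iota> i \<in> bhom (S i) c"
    and univ: "\<And>d g. d \<in> \<S> \<Longrightarrow> (\<And>i. i \<in> I \<Longrightarrow> g i \<in> bhom (S i) d) \<Longrightarrow>
      \<exists>!h. h \<in> bhom c d \<and> (\<forall>i\<in>I. compose (tb (S i)) h (\<iota> i) = g i)"
    using cop unfolding is_coproduct_def Cmp_BS Arr_BS Obj_BS by auto
  have *: "inj_on (\<iota> i) (tb (S i)) \<and>
      (\<forall>j\<in>I. j \<noteq> i \<longrightarrow> (\<forall>x\<in>tb (S i). \<forall>y\<in>tb (S j). \<iota> i x \<noteq> \<iota> j y))" if i: "i \<in> I" for i
  proof -
    let ?O = "insert None (Some ` S i)"
    let ?e = "enc ?O :: _ \<Rightarrow> 'u"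
    have sO: "small \<S> ?O" by (rule small_option[OF small_in[OF S[OF i]]])
    define T where "T = ?e ` ?O"
    have T: "T \<in> \<S>" unfolding T_def by (rule enc_image_in[OF sO])
    have ee: "?e u = ?e v \<longleftrightarrow> u = v" if "u \<in> ?O" "v \<in> ?O" for u v
      by (rule inj_on_eq_iff[OF inj_on_enc[OF sO] that])
    define g where "g j = (if j = i then beta_map (S i) T (\<lambda>x. ?e (Some x)) else beta_map (S j) T (\<lambda>x. ?e None))" for j
    have fS: "(\<lambda>x. ?e (Some x)) \<in> S i \<rightarrow> T" "\<And>j. (\<lambda>x. ?e None) \<in> S j \<rightarrow> T" by (auto simp: T_def)
    have "g j \<in> bhom (S j) T" if "j \<in> I" for j
      using beta_map_Arr[OF S[OF i] T fS(1)] beta_map_Arr[OF S[OF that] T fS(2)] by (simp add: g_def)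
    with T have "\<exists>!h. h \<in> bhom c T \<and> (\<forall>j\<in>I. compose (tb (S j)) h (\<iota> j) = g j)"
      by (rule univ)
    then obtain h where "\<forall>j\<in>I. compose (tb (S j)) h (\<iota> j) = g j" by (elim ex1E conjE)
    then have h: "compose (tb (S j)) h (\<iota> j) = g j" if "j \<in> I" for j using that by (rule bspec)
    have hx: "h (\<iota> j x) = g j x" if "j \<in> I" "x \<in> tb (S j)" for j x
      using fun_cong[OF h[OF that(1)], of x] that by (simp add: compose_eq)
    have inj: "inj_on (g i) (tb (S i))"
      using beta_map_inj[OF S[OF i] T fS(1)] ee by (simp add: g_def inj_on_def)
    have ne: "g i x \<noteq> g j y" if "j \<in> I" "j \<noteq> i" "x \<in> tb (S i)" "y \<in> tb (S j)" for j x y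
    proof -
      have N: "{?e None} \<subseteq> T" by (auto simp: T_def)
      have 1: "{x \<in> S i. ?e (Some x) \<in> {?e None}} = {}" using ee by auto
      have 2: "{x \<in> S j. ?e None \<in> {?e None}} = S j" by simp
      have "g i x \<notin> hat T {?e None}"
        using beta_map_hat[OF T fS(1) that(3) N] unfolding 1 by (simp add: g_def)
      moreover have "g j y \<in> hat T {?e None}"
        using beta_map_hat[OF T fS(2) that(4) N] that(2,4) unfolding 2 by (simp add: g_def hat_top)
      ultimately show ?thesis by metis
    qed
    show ?thesis
    proof (intro conjI ballI impI inj_onI notI)
      fix x y assume *: "x \<in> tb (S i)" "y \<in> tb (S i)" "\<iota> i x = \<iota> i y"
      then show "x = y" using hx[OF i, of x] hx[OF i, of y] inj_onD[OF inj _ *(1,2)] by simp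
    next
      fix j x y assume *: "j \<in> I" "j \<noteq> i" "x \<in> tb (S i)" "y \<in> tb (S j)" "\<iota> i x = \<iota> j y"
      then show False using hx[OF i, of x] hx[of j y] ne[OF *(1-4)] by simp
    qed
  qed
  show "i \<in> I \<Longrightarrow> ?inj" using *[THEN conjunct1] .
  show "i \<in> I \<Longrightarrow> j \<in> I \<Longrightarrow> x \<in> tb (S i) \<Longrightarrow> y \<in> tb (S j) \<Longrightarrow> \<iota> i x = \<iota> j y \<Longrightarrow> i = j"
    using *[THEN conjunct2, rule_format, of i j x y] by metis
  let ?K = "\<Union>i\<in>I. \<iota> i ` tb (S i)"
  have "closedin (beta c) ?K"
    using I CH_closed_image[OF beta_in_CHaus[OF S] beta_in_CHaus[OF c] \<iota>] by (intro closedin_Union) auto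
  then have op: "openin (beta c) (tb c - ?K)" by auto
  show "tb c = ?K"
  proof (rule ccontr)
    assume ne: "tb c \<noteq> ?K"
    have "?K \<subseteq> tb c" using \<iota> by (auto intro: Arr_CH_in)
    then obtain p where p: "p \<in> tb c - ?K" using ne by blast
    obtain A where A: "A \<subseteq> c" "p \<in> hat c A" "hat c A \<subseteq> tb c - ?K"
      using beta_basic_nhds[OF c op p] .
    \<comment> \<open>The clopen set \<open>hat c A\<close> misses all images. The indicator of
      \<open>A\<close> and the constant \<open>False\<close>, extended to maps from \<beta>c to
      \<beta> of a two-element set, agree on all images and differ at \<open>p\<close>, against
      uniqueness.\<close>
    let ?e = "enc (UNIV :: bool set) :: bool \<Rightarrow> 'u"
    have sB: "small \<S> (UNIV :: bool set)"
      by (rule small_inj_on[OF small_option[OF small_singleton[of "()"]], of "\<lambda>b. if b then Some () else None"])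
         (auto simp: inj_on_def)
    define T where "T = range ?e"
    have T: "T \<in> \<S>" unfolding T_def by (rule enc_image_in[OF sB])
    have eB: "?e u = ?e v \<longleftrightarrow> u = v" for u v
      by (rule inj_on_eq_iff[OF inj_on_enc[OF sB]]) auto
    let ?g = "beta_map c T (\<lambda>x. ?e False)" and ?h = "beta_map c T (\<lambda>x. ?e (x \<in> A))"
    have f: "(\<lambda>x. ?e False) \<in> c \<rightarrow> T" "(\<lambda>x. ?e (x \<in> A)) \<in> c \<rightarrow> T" by (auto simp: T_def)
    have arr: "?g \<in> bhom c T" "?h \<in> bhom c T"
      using beta_map_Arr[OF c T] f by auto
    have eq: "?g q = ?h q" if q: "q \<in> ?K" for q
    proof -
      have qc: "q \<in> tb c" "q \<notin> hat c A" using \<open>?K \<subseteq> _\<close> A(3) q by auto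
      then have qA: "q \<in> hat c (c - A)" using hat_Diff[OF A(1)] by simp
      show ?thesis
      proof (rule beta_eqI[OF uf_of_beta_map(1)[OF T f(1) qc(1)] uf_of_beta_map(1)[OF T f(2) qc(1)]])
        fix B assume B: "B \<subseteq> T" "?g q \<in> hat T B"
        then have "q \<in> hat c {x \<in> c. ?e False \<in> B}" using beta_map_hat[OF T f(1) qc(1)] by simp
        then have "?e False \<in> B" by (cases "?e False \<in> B") auto
        then have "hat c (c - A) \<subseteq> hat c {x \<in> c. ?e (x \<in> A) \<in> B}" by (intro hat_mono) auto
        then show "?h q \<in> hat T B" using qA beta_map_hat[OF T f(2) qc(1) B(1)] by auto
      qed
    qed
    have "compose (tb (S i)) ?g (\<iota> i) = compose (tb (S i)) ?h (\<iota> i)" if "i \<in> I" for i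
      unfolding compose_def by (rule restrict_ext) (use eq that in blast)
    moreover have "\<And>i. i \<in> I \<Longrightarrow> compose (tb (S i)) ?h (\<iota> i) \<in> bhom (S i) T"
      using \<iota> arr(2) by (rule compose_Arr_CH)
    ultimately have gh: "?g = ?h"
      using univ[OF T, of "\<lambda>i. compose (tb (S i)) ?h (\<iota> i)"] arr by blast
    have N: "{?e True} \<subseteq> T" by (auto simp: T_def)
    have pc: "p \<in> tb c" using p by blast
    have AN: "{x \<in> c. ?e (x \<in> A) \<in> {?e True}} = A" "{x \<in> c. ?e False \<in> {?e True}} = {}"
      using A(1) by (auto simp: eB)
    have "?h p \<in> hat T {?e True}" "?g p \<notin> hat T {?e True}"
      using beta_map_hat[OF T f(1) pc N] beta_map_hat[OF T f(2) pc N] A(2) unfolding AN by simp_all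
    then show False using gh by simp
  qed
qed

end


subsection \<open>Functors into presheaf categories\<close>

text \<open>Morphisms of presheaves are extensional families of extensional functions, so the
  functor laws may be checked on single elements.\<close>

lemma PSh_functorI:
  assumes D: "is_cat D"
    and ob: "\<And>X. X \<in> Obj D \<Longrightarrow> FOb \<Phi> X \<in> Obj (PSh \<S> C)"
    and ar: "\<And>X Y f. X \<in> Obj D \<Longrightarrow> Y \<in> Obj D \<Longrightarrow> f \<in> Arr D X Y \<Longrightarrow>
      FAr \<Phi> X Y f \<in> Arr (PSh \<S> C) (FOb \<Phi> X) (FOb \<Phi> Y)"
    and idt: "\<And>X Z s. X \<in> Obj D \<Longrightarrow> Z \<in> Obj C \<Longrightarrow> s \<in> FOb (FOb \<Phi> X) Z \<Longrightarrow> FAr \<Phi> X X (Idt D X) Z s = s"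
    and cmp: "\<And>X Y W f g Z s. X \<in> Obj D \<Longrightarrow> Y \<in> Obj D \<Longrightarrow> W \<in> Obj D \<Longrightarrow>
      f \<in> Arr D X Y \<Longrightarrow> g \<in> Arr D Y W \<Longrightarrow> Z \<in> Obj C \<Longrightarrow> s \<in> FOb (FOb \<Phi> X) Z \<Longrightarrow>
      FAr \<Phi> X W (Cmp D X Y W g f) Z s = FAr \<Phi> Y W g Z (FAr \<Phi> X Y f Z s)"
  shows "is_functor D (PSh \<S> C) \<Phi>"
  unfolding is_functor_def
proof (intro conjI ballI ob ar)
  fix X assume X: "X \<in> Obj D"
  then have i: "Idt D X \<in> Arr D X X" using D by (simp add: is_cat_def)
  show "FAr \<Phi> X X (Idt D X) = Idt (PSh \<S> C) (FOb \<Phi> X)"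
    by (rule PSh_Arr_eqI[OF ar[OF X X i] PSh_Idt_Arr[OF ob[OF X]]]) (simp add: idt X PSh_Idt_apply)
next
  fix X Y W f g assume *: "X \<in> Obj D" "Y \<in> Obj D" "W \<in> Obj D" "f \<in> Arr D X Y" "g \<in> Arr D Y W"
  then have gf: "Cmp D X Y W g f \<in> Arr D X W" using D by (simp add: is_cat_def)
  show "FAr \<Phi> X W (Cmp D X Y W g f) = Cmp (PSh \<S> C) (FOb \<Phi> X) (FOb \<Phi> Y) (FOb \<Phi> W) (FAr \<Phi> Y W g) (FAr \<Phi> X Y f)"
    by (rule PSh_Arr_eqI[OF ar[OF *(1,3) gf] PSh_Cmp_Arr[OF ob[OF *(1)] ob[OF *(3)] ar[OF *(1,2,4)] ar[OF *(2,3,5)]]])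
       (simp add: cmp * PSh_Cmp_apply)
qed

lemma is_functor_into_full_subcat:
  "is_functor D C \<Phi> \<Longrightarrow> (\<And>X. X \<in> Obj D \<Longrightarrow> P (FOb \<Phi> X)) \<Longrightarrow> is_functor D (full_subcat C P) \<Phi>"
  unfolding is_functor_def by (simp add: Obj_full_subcat)

lemma is_functor_from_full_subcat: "is_functor D C \<Phi> \<Longrightarrow> is_functor (full_subcat D P) C \<Phi>"
  unfolding is_functor_def by (simp add: Obj_full_subcat)

lemma is_functor_ftor_comp:
  assumes "is_functor C D F" "is_functor D E G" shows "is_functor C E (ftor_comp G F)"
  using assms unfolding is_functor_def ftor_comp_def by simp

context small_sets
begin

abbreviation "PB \<equiv> PSh \<S> BS"
abbreviation "PC \<equiv> PSh \<S> CH"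

lemma CH_assoc:
  "f \<in> Arr CH X Y \<Longrightarrow> compose (topspace X) h (compose (topspace X) g f) = compose (topspace X) (compose (topspace Y) h g) f"
  unfolding compose_def by (rule restrict_ext) (simp add: Arr_CH_in)

lemma CH_id_right: "f \<in> Arr CH X Y \<Longrightarrow> compose (topspace X) f (\<lambda>x\<in>topspace X. x) = f"
  by (rule Arr_CH_eqI[of _ X Y _ Y]) (auto simp: compose_eq)

lemma CH_id_left: "f \<in> Arr CH X Y \<Longrightarrow> compose (topspace X) (\<lambda>x\<in>topspace Y. x) f = f"
  by (rule Arr_CH_eqI[of _ X Y _ Y]) (auto simp: compose_eq Arr_CH_in)

lemma bs_in: "F \<in> Obj PB \<Longrightarrow> R \<in> \<S> \<Longrightarrow> T \<in> \<S> \<Longrightarrow> f \<in> bhom R T \<Longrightarrow> s \<in> FOb F T \<Longrightarrow> FAr F T R f s \<in> FOb F R"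
  using psh_in[of F \<S> BS] by simp

lemma bs_comp:
  "F \<in> Obj PB \<Longrightarrow> R \<in> \<S> \<Longrightarrow> S \<in> \<S> \<Longrightarrow> T \<in> \<S> \<Longrightarrow> f \<in> bhom R S \<Longrightarrow> g \<in> bhom S T \<Longrightarrow>
    s \<in> FOb F T \<Longrightarrow> FAr F T R (compose (tb R) g f) s = FAr F S R f (FAr F T S g s)"
  using psh_comp[of F \<S> BS R S T f g s] by (simp add: Cmp_BS)

lemma bs_id: "F \<in> Obj PB \<Longrightarrow> S \<in> \<S> \<Longrightarrow> s \<in> FOb F S \<Longrightarrow> FAr F S S (\<lambda>p\<in>tb S. p) s = s"
  using psh_id[of F \<S> BS S s] by (simp add: Idt_BS)

lemma bs_nat:
  "\<alpha> \<in> Arr PB F G \<Longrightarrow> R \<in> \<S> \<Longrightarrow> T \<in> \<S> \<Longrightarrow> f \<in> bhom R T \<Longrightarrow> s \<in> FOb F T \<Longrightarrow>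
    \<alpha> R (FAr F T R f s) = FAr G T R f (\<alpha> T s)"
  using psh_nat[of \<alpha> \<S> BS F G R T f s] by simp

lemma bs_arr_in: "\<alpha> \<in> Arr PB F G \<Longrightarrow> S \<in> \<S> \<Longrightarrow> s \<in> FOb F S \<Longrightarrow> \<alpha> S s \<in> FOb G S"
  using psh_arr_in[of \<alpha> \<S> BS F G S s] by simp

lemma ch_comp:
  "F \<in> Obj PC \<Longrightarrow> X \<in> Obj CH \<Longrightarrow> Y \<in> Obj CH \<Longrightarrow> Z \<in> Obj CH \<Longrightarrow> f \<in> Arr CH X Y \<Longrightarrow> g \<in> Arr CH Y Z \<Longrightarrow>
    s \<in> FOb F Z \<Longrightarrow> FAr F Z X (compose (topspace X) g f) s = FAr F Y X f (FAr F Z Y g s)"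
  using psh_comp[of F \<S> CH X Y Z f g s] by (simp add: Cmp_CH)

lemma PB_ObjI:
  assumes "\<And>S. S \<in> \<S> \<Longrightarrow> FOb F S \<in> \<S>"
    and "\<And>R T f. R \<in> \<S> \<Longrightarrow> T \<in> \<S> \<Longrightarrow> f \<in> bhom R T \<Longrightarrow> FAr F T R f \<in> FOb F T \<rightarrow>\<^sub>E FOb F R"
    and "\<And>S s. S \<in> \<S> \<Longrightarrow> s \<in> FOb F S \<Longrightarrow> FAr F S S (\<lambda>p\<in>tb S. p) s = s"
    and "\<And>R S T f g s. R \<in> \<S> \<Longrightarrow> S \<in> \<S> \<Longrightarrow> T \<in> \<S> \<Longrightarrow> f \<in> bhom R S \<Longrightarrow>
      g \<in> bhom S T \<Longrightarrow> s \<in> FOb F T \<Longrightarrow>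
      FAr F T R (compose (tb R) g f) s = FAr F S R f (FAr F T S g s)"
  shows "F \<in> Obj PB"
  by (rule PSh_ObjI) (simp_all add: assms Idt_BS Cmp_BS id_Arr_CH compose_Arr_CH)

lemma PC_ObjI:
  assumes "\<And>X. X \<in> Obj CH \<Longrightarrow> FOb F X \<in> \<S>"
    and "\<And>X Y f. X \<in> Obj CH \<Longrightarrow> Y \<in> Obj CH \<Longrightarrow> f \<in> Arr CH X Y \<Longrightarrow> FAr F Y X f \<in> FOb F Y \<rightarrow>\<^sub>E FOb F X"
    and "\<And>X s. X \<in> Obj CH \<Longrightarrow> s \<in> FOb F X \<Longrightarrow> FAr F X X (\<lambda>p\<in>topspace X. p) s = s"
    and "\<And>X Y Z f g s. X \<in> Obj CH \<Longrightarrow> Y \<in> Obj CH \<Longrightarrow> Z \<in> Obj CH \<Longrightarrow> f \<in> Arr CH X Y \<Longrightarrow>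
      g \<in> Arr CH Y Z \<Longrightarrow> s \<in> FOb F Z \<Longrightarrow>
      FAr F Z X (compose (topspace X) g f) s = FAr F Y X f (FAr F Z Y g s)"
  shows "F \<in> Obj PC"
  by (rule PSh_ObjI) (simp_all add: assms Idt_CH Cmp_CH id_Arr_CH compose_Arr_CH)


subsection \<open>Restriction\<close>

lemma Res_ob_simps [simp]: "FOb (Res_ob F) S = FOb F (beta S)" "FAr (Res_ob F) S T = FAr F (beta S) (beta T)"
  by (simp_all add: Res_ob_def fun_eq_iff)

lemma Res_ob_PB:
  assumes F: "F \<in> Obj PC" shows "Res_ob F \<in> Obj PB"
proof (rule PB_ObjI)
  fix S s assume "S \<in> \<S>" "s \<in> FOb (Res_ob F) S"
  then show "FAr (Res_ob F) S S (\<lambda>p\<in>tb S. p) s = s"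
    using psh_id[OF F beta_in_CHaus, of S s] by (simp add: Idt_CH)
qed (use psh_ob[OF F] psh_ar[OF F] ch_comp[OF F] beta_in_CHaus in auto)

lemma Res_functor: "is_functor PC PB (Res \<S>)"
proof (rule PSh_functorI[OF is_cat_PSh])
  fix F G \<alpha> assume *: "F \<in> Obj PC" "G \<in> Obj PC" "\<alpha> \<in> Arr PC F G"
  show "FAr (Res \<S>) F G \<alpha> \<in> Arr PB (FOb (Res \<S>) F) (FOb (Res \<S>) G)"
    unfolding Res_def ftor.simps
    by (rule PSh_ArrI[OF Res_ob_PB[OF *(1)] Res_ob_PB[OF *(2)]])
       (use psh_arr_PiE[OF *(3)] psh_nat[OF *(3)] beta_in_CHaus in auto)
qed (simp_all add: Res_def Res_ob_PB beta_in_CHaus PSh_Idt_apply PSh_Cmp_apply)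


subsection \<open>The functor \<open>Ext\<close>\<close>

text \<open>\<beta> of |Btilde X| is a weak kernel pair of \<xi> for test objects \<beta>R: a pair
  of maps agreeing over \<open>X\<close> factors through \<open>Btilde X\<close>, and the
  factorisation lifts along \<xi> by projectivity. No uniqueness of the lift is claimed.\<close>

lemma
  assumes X: "X \<in> Obj CH"
  shows Btilde_in: "topspace (Btilde X) \<in> \<S>"
    and B_pi1_Arr: "B_pi1 X \<in> bhom (topspace (Btilde X)) (topspace X)"
    and B_pi2_Arr: "B_pi2 X \<in> bhom (topspace (Btilde X)) (topspace X)"
    and B_pi_commute: "compose (tb (topspace (Btilde X))) (uf_limit X) (B_pi1 X)
      = compose (tb (topspace (Btilde X))) (uf_limit X) (B_pi2 X)"
    and B_pi_universal: "\<And>R f g. R \<in> \<S> \<Longrightarrow> f \<in> bhom R (topspace X) \<Longrightarrow>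
      g \<in> bhom R (topspace X) \<Longrightarrow>
      compose (tb R) (uf_limit X) f = compose (tb R) (uf_limit X) g \<Longrightarrow>
      \<exists>l\<in>bhom R (topspace (Btilde X)).
        compose (tb R) (B_pi1 X) l = f \<and> compose (tb R) (B_pi2 X) l = g"
proof -
  have S: "topspace X \<in> \<S>" using X by (simp add: Obj_CH)
  note B = beta_in_CHaus[OF S] and \<xi> = uf_limit_Arr[OF X]
  note fp = fibprod_Obj[OF B B X \<xi> \<xi>, folded Btilde_def] fibprod_pr1_Arr[OF B B X \<xi> \<xi>, folded Btilde_def]
    fibprod_pr2_Arr[OF B B X \<xi> \<xi>, folded Btilde_def] fibprod_commute[OF B B X \<xi> \<xi>, folded Btilde_def]
    fibprod_universal[OF B B X \<xi> \<xi>, folded Btilde_def]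
  note \<xi>' = uf_limit_Arr[OF fp(1)]
  show "topspace (Btilde X) \<in> \<S>" using fp(1) by (simp add: Obj_CH)
  show pi1: "B_pi1 X \<in> bhom (topspace (Btilde X)) (topspace X)"
    unfolding B_pi1_def by (rule compose_Arr_CH[OF \<xi>' fp(2)])
  show pi2: "B_pi2 X \<in> bhom (topspace (Btilde X)) (topspace X)"
    unfolding B_pi2_def by (rule compose_Arr_CH[OF \<xi>' fp(3)])
  show "compose (tb (topspace (Btilde X))) (uf_limit X) (B_pi1 X)
      = compose (tb (topspace (Btilde X))) (uf_limit X) (B_pi2 X)"
    unfolding B_pi1_def B_pi2_def CH_assoc[OF \<xi>'] fp(4) ..
  fix R f g assume R: "R \<in> \<S>" and f: "f \<in> bhom R (topspace X)"
    and g: "g \<in> bhom R (topspace X)"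
    and eq: "compose (tb R) (uf_limit X) f = compose (tb R) (uf_limit X) g"
  obtain h where h: "h \<in> Arr CH (beta R) (Btilde X)"
    "compose (tb R) (fibprod_pr1 (beta (topspace X)) (beta (topspace X)) (uf_limit X) (uf_limit X)) h = f"
    "compose (tb R) (fibprod_pr2 (beta (topspace X)) (beta (topspace X)) (uf_limit X) (uf_limit X)) h = g"
    using fp(5)[OF f g eq] by blast
  note l = lift_Arr[OF R fp(1) h(1)] uf_limit_lift[OF R fp(1) h(1)]
  show "\<exists>l\<in>bhom R (topspace (Btilde X)).
        compose (tb R) (B_pi1 X) l = f \<and> compose (tb R) (B_pi2 X) l = g"
    by (rule bexI[OF _ l(1)]) (simp add: B_pi1_def B_pi2_def CH_assoc[OF l(1), symmetric] l(2) h(2,3))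
qed

text \<open>The pair \<open>B_pi1\<close>, \<open>B_pi2\<close> is the generic instance: it agrees
  over \<open>X\<close> by \<open>B_pi_commute\<close>, and every other such pair factors through it
  by \<open>B_pi_universal\<close>.\<close>

lemma Ext_set_iff:
  assumes F: "F \<in> Obj PB" and X: "X \<in> Obj CH"
  shows "s \<in> Ext_set F X \<longleftrightarrow> s \<in> FOb F (topspace X) \<and>
    (\<forall>R\<in>\<S>. \<forall>f\<in>bhom R (topspace X). \<forall>g\<in>bhom R (topspace X).
      compose (tb R) (uf_limit X) f = compose (tb R) (uf_limit X) g \<longrightarrow>
      FAr F (topspace X) R f s = FAr F (topspace X) R g s)" (is "_ \<longleftrightarrow> _ \<and> ?R")
proof -
  have S: "topspace X \<in> \<S>" using X by (simp add: Obj_CH)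
  note Q = Btilde_in[OF X] and p1 = B_pi1_Arr[OF X] and p2 = B_pi2_Arr[OF X]
  have "?R" if s: "s \<in> Ext_set F X"
  proof (intro ballI impI)
    fix R f g assume R: "R \<in> \<S>" and f: "f \<in> bhom R (topspace X)"
      and g: "g \<in> bhom R (topspace X)"
      and eq: "compose (tb R) (uf_limit X) f = compose (tb R) (uf_limit X) g"
    obtain l where l: "l \<in> bhom R (topspace (Btilde X))"
      "compose (tb R) (B_pi1 X) l = f" "compose (tb R) (B_pi2 X) l = g"
      using B_pi_universal[OF X R f g eq] by blast
    have s': "s \<in> FOb F (topspace X)" using s by (simp add: Ext_set_def)
    have "FAr F (topspace X) R f s = FAr F (topspace (Btilde X)) R l (FAr F (topspace X) (topspace (Btilde X)) (B_pi1 X) s)"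
      using bs_comp[OF F R Q S l(1) p1 s'] l(2) by simp
    also have "\<dots> = FAr F (topspace (Btilde X)) R l (FAr F (topspace X) (topspace (Btilde X)) (B_pi2 X) s)"
      using s by (simp add: Ext_set_def)
    also have "\<dots> = FAr F (topspace X) R g s"
      using bs_comp[OF F R Q S l(1) p2 s'] l(3) by simp
    finally show "FAr F (topspace X) R f s = FAr F (topspace X) R g s" .
  qed
  moreover have "s \<in> Ext_set F X" if "s \<in> FOb F (topspace X)" and r: "?R"
    unfolding Ext_set_def using that(1) r[rule_format, OF Q p1 p2 B_pi_commute[OF X]] by simp
  moreover have "s \<in> FOb F (topspace X)" if "s \<in> Ext_set F X" using that by (simp add: Ext_set_def)
  ultimately show ?thesis by (intro iffI conjI; (elim conjE)?)
qed

lemma Ext_setI: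
  assumes "F \<in> Obj PB" "X \<in> Obj CH" "s \<in> FOb F (topspace X)"
    and "\<And>R f g. R \<in> \<S> \<Longrightarrow> f \<in> bhom R (topspace X) \<Longrightarrow> g \<in> bhom R (topspace X) \<Longrightarrow>
      compose (tb R) (uf_limit X) f = compose (tb R) (uf_limit X) g \<Longrightarrow>
      FAr F (topspace X) R f s = FAr F (topspace X) R g s"
  shows "s \<in> Ext_set F X"
  unfolding Ext_set_iff[OF assms(1,2)] by (intro conjI ballI impI assms(3,4))

lemma Ext_setD:
  assumes "F \<in> Obj PB" "X \<in> Obj CH" "s \<in> Ext_set F X"
    "R \<in> \<S>" "f \<in> bhom R (topspace X)" "g \<in> bhom R (topspace X)"
    "compose (tb R) (uf_limit X) f = compose (tb R) (uf_limit X) g"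
  shows "FAr F (topspace X) R f s = FAr F (topspace X) R g s"
  using assms Ext_set_iff[OF assms(1,2)] by blast

lemma Ext_set_subset: "s \<in> Ext_set F X \<Longrightarrow> s \<in> FOb F (topspace X)"
  by (simp add: Ext_set_def)

lemma beta_map_CH:
  assumes "X \<in> Obj CH" "Y \<in> Obj CH" "f \<in> Arr CH X Y"
  shows "beta_map (topspace X) (topspace Y) f \<in> bhom (topspace X) (topspace Y)"
  using assms by (intro beta_map_Arr) (auto simp: Obj_CH intro: Arr_CH_in)

lemma uf_limit_beta_map_compose:
  assumes "X \<in> Obj CH" "Y \<in> Obj CH" "f \<in> Arr CH X Y" "g \<in> Arr CH W (beta (topspace X))"
  shows "compose (topspace W) (uf_limit Y) (compose (topspace W) (beta_map (topspace X) (topspace Y) f) g)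
    = compose (topspace W) f (compose (topspace W) (uf_limit X) g)"
  unfolding CH_assoc[OF assms(4)] uf_limit_natural[OF assms(1-3)] ..

text \<open>By naturality of \<xi>, two maps that agree over \<open>X\<close> agree over
  \<open>Y\<close> after composition with \<beta>f, so the condition on \<open>s\<close> applies to
  them.\<close>

lemma Ext_ob_in:
  assumes F: "F \<in> Obj PB" and X: "X \<in> Obj CH" and Y: "Y \<in> Obj CH" and f: "f \<in> Arr CH X Y"
    and s: "s \<in> Ext_set F Y"
  shows "FAr F (topspace Y) (topspace X) (beta_map (topspace X) (topspace Y) f) s \<in> Ext_set F X"
proof -
  have S: "topspace X \<in> \<S>" "topspace Y \<in> \<S>" using X Y by (auto simp: Obj_CH)
  note b = beta_map_CH[OF X Y f] and s' = Ext_set_subset[OF s]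
  show ?thesis
  proof (rule Ext_setI[OF F X])
    show "FAr F (topspace Y) (topspace X) (beta_map (topspace X) (topspace Y) f) s \<in> FOb F (topspace X)"
      by (rule bs_in[OF F S b s'])
    fix R g h assume R: "R \<in> \<S>" and g: "g \<in> bhom R (topspace X)"
      and h: "h \<in> bhom R (topspace X)"
      and eq: "compose (tb R) (uf_limit X) g = compose (tb R) (uf_limit X) h"
    have "FAr F (topspace Y) R (compose (tb R) (beta_map (topspace X) (topspace Y) f) g) s
       = FAr F (topspace Y) R (compose (tb R) (beta_map (topspace X) (topspace Y) f) h) s"
      by (rule Ext_setD[OF F Y s R compose_Arr_CH[OF g b] compose_Arr_CH[OF h b]])
         (simp add: uf_limit_beta_map_compose[OF X Y f] g h eq)
    then show "FAr F (topspace X) R g (FAr F (topspace Y) (topspace X) (beta_map (topspace X) (topspace Y) f) s) =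
       FAr F (topspace X) R h (FAr F (topspace Y) (topspace X) (beta_map (topspace X) (topspace Y) f) s)"
      using bs_comp[OF F R S g b s'] bs_comp[OF F R S h b s'] by simp
  qed
qed

lemma FOb_Ext_ob [simp]: "FOb (Ext_ob F) = Ext_set F"
  by (simp add: Ext_ob_def)

lemma FAr_Ext_ob: "FAr (Ext_ob F) Y X f =
    (\<lambda>s\<in>Ext_set F Y. FAr F (topspace Y) (topspace X) (beta_map (topspace X) (topspace Y) f) s)"
  by (simp add: Ext_ob_def)

lemma Ext_ob_PC:
  assumes F: "F \<in> Obj PB" shows "Ext_ob F \<in> Obj PC"
proof (rule PC_ObjI)
  fix X assume "X \<in> Obj CH"
  then have "FOb F (topspace X) \<in> \<S>" using psh_ob[OF F] by (simp add: Obj_CH)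
  then show "FOb (Ext_ob F) X \<in> \<S>" by (rule subset_in) (auto simp: Ext_set_def)
next
  fix X Y f assume "X \<in> Obj CH" "Y \<in> Obj CH" "f \<in> Arr CH X Y"
  then show "FAr (Ext_ob F) Y X f \<in> FOb (Ext_ob F) Y \<rightarrow>\<^sub>E FOb (Ext_ob F) X"
    using Ext_ob_in[OF F] by (simp add: FAr_Ext_ob)
next
  fix X s assume X: "X \<in> Obj CH" and s: "s \<in> FOb (Ext_ob F) X"
  then have S: "topspace X \<in> \<S>" by (simp add: Obj_CH)
  have "beta_map (topspace X) (topspace X) (\<lambda>p\<in>topspace X. p) = (\<lambda>p\<in>tb (topspace X). p)"
    by (rule beta_map_id[OF S]) simp
  then show "FAr (Ext_ob F) X X (\<lambda>p\<in>topspace X. p) s = s"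
    using s bs_id[OF F S Ext_set_subset] by (simp add: FAr_Ext_ob)
next
  fix X Y Z f g s
  assume X: "X \<in> Obj CH" and Y: "Y \<in> Obj CH" and Z: "Z \<in> Obj CH" and f: "f \<in> Arr CH X Y"
    and g: "g \<in> Arr CH Y Z" and s: "s \<in> FOb (Ext_ob F) Z"
  have S: "topspace X \<in> \<S>" "topspace Y \<in> \<S>" "topspace Z \<in> \<S>" using X Y Z by (auto simp: Obj_CH)
  have fg: "f \<in> topspace X \<rightarrow> topspace Y" "g \<in> topspace Y \<rightarrow> topspace Z"
    using Arr_CH_in[OF f] Arr_CH_in[OF g] by auto
  have "beta_map (topspace X) (topspace Z) (compose (topspace X) g f) = beta_map (topspace X) (topspace Z) (\<lambda>x. g (f x))"
    by (rule beta_map_cong) (simp add: compose_eq)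
  also have "\<dots> = compose (tb (topspace X)) (beta_map (topspace Y) (topspace Z) g) (beta_map (topspace X) (topspace Y) f)"
    by (rule beta_map_compose[OF S fg, symmetric])
  finally show "FAr (Ext_ob F) Z X (compose (topspace X) g f) s = FAr (Ext_ob F) Y X f (FAr (Ext_ob F) Z Y g s)"
    using s bs_comp[OF F S beta_map_CH[OF X Y f] beta_map_CH[OF Y Z g] Ext_set_subset] Ext_ob_in[OF F Y Z g]
    by (simp add: FAr_Ext_ob)
qed

lemma Ext_functor: "is_functor PB PC (Ext \<S>)"
proof (rule PSh_functorI[OF is_cat_PSh])
  fix F G \<alpha> assume F: "F \<in> Obj PB" and G: "G \<in> Obj PB" and \<alpha>: "\<alpha> \<in> Arr PB F G"
  have in': "\<alpha> (topspace X) s \<in> Ext_set G X" if X: "X \<in> Obj CH" and s: "s \<in> Ext_set F X" for X s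
  proof -
    have S: "topspace X \<in> \<S>" using X by (simp add: Obj_CH)
    note s' = Ext_set_subset[OF s]
    show ?thesis
    proof (rule Ext_setI[OF G X bs_arr_in[OF \<alpha> S s']])
      fix R f g assume *: "R \<in> \<S>" "f \<in> bhom R (topspace X)" "g \<in> bhom R (topspace X)"
        "compose (tb R) (uf_limit X) f = compose (tb R) (uf_limit X) g"
      show "FAr G (topspace X) R f (\<alpha> (topspace X) s) = FAr G (topspace X) R g (\<alpha> (topspace X) s)"
        using Ext_setD[OF F X s *] bs_nat[OF \<alpha> *(1) S *(2) s'] bs_nat[OF \<alpha> *(1) S *(3) s'] by simp
    qed
  qed
  show "FAr (Ext \<S>) F G \<alpha> \<in> Arr PC (FOb (Ext \<S>) F) (FOb (Ext \<S>) G)"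
    unfolding Ext_def ftor.simps
  proof (rule PSh_ArrI[OF Ext_ob_PC[OF F] Ext_ob_PC[OF G]])
    fix X Y f s assume X: "X \<in> Obj CH" and Y: "Y \<in> Obj CH" and f: "f \<in> Arr CH X Y" and s: "s \<in> FOb (Ext_ob F) Y"
    have S: "topspace X \<in> \<S>" "topspace Y \<in> \<S>" using X Y by (auto simp: Obj_CH)
    show "(\<lambda>X\<in>Obj CH. \<lambda>s\<in>Ext_set F X. \<alpha> (topspace X) s) X (FAr (Ext_ob F) Y X f s)
       = FAr (Ext_ob G) Y X f ((\<lambda>X\<in>Obj CH. \<lambda>s\<in>Ext_set F X. \<alpha> (topspace X) s) Y s)"
      using X Y s in'[OF Y] Ext_ob_in[OF F X Y f] bs_nat[OF \<alpha> S beta_map_CH[OF X Y f] Ext_set_subset]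
      by (simp add: FAr_Ext_ob)
  qed (use in' in auto)
next
  fix F X s assume "F \<in> Obj PB" "X \<in> Obj CH" "s \<in> FOb (FOb (Ext \<S>) F) X"
  then show "FAr (Ext \<S>) F F (Idt PB F) X s = s"
    by (simp add: Ext_def PSh_Idt_apply Obj_CH Ext_set_subset)
next
  fix F G H \<alpha> \<beta> X s
  assume F: "F \<in> Obj PB" and G: "G \<in> Obj PB" and H: "H \<in> Obj PB"
    and \<alpha>: "\<alpha> \<in> Arr PB F G" and \<beta>: "\<beta> \<in> Arr PB G H" and X: "X \<in> Obj CH" and s: "s \<in> FOb (FOb (Ext \<S>) F) X"
  have S: "topspace X \<in> \<S>" using X by (simp add: Obj_CH)
  have s: "s \<in> Ext_set F X" using s by (simp add: Ext_def)
  note s' = Ext_set_subset[OF s]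
  have "\<alpha> (topspace X) s \<in> Ext_set G X"
  proof (rule Ext_setI[OF G X bs_arr_in[OF \<alpha> S s']])
    fix R f g assume *: "R \<in> \<S>" "f \<in> bhom R (topspace X)" "g \<in> bhom R (topspace X)"
      "compose (tb R) (uf_limit X) f = compose (tb R) (uf_limit X) g"
    show "FAr G (topspace X) R f (\<alpha> (topspace X) s) = FAr G (topspace X) R g (\<alpha> (topspace X) s)"
      using Ext_setD[OF F X s *] bs_nat[OF \<alpha> *(1) S *(2) s'] bs_nat[OF \<alpha> *(1) S *(3) s'] by simp
  qed
  then show "FAr (Ext \<S>) F H (Cmp PB F G H \<beta> \<alpha>) X s = FAr (Ext \<S>) G H \<beta> X (FAr (Ext \<S>) F G \<alpha> X s)"
    using s s' S X by (simp add: Ext_def PSh_Cmp_apply)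
qed (simp add: Ext_def Ext_ob_PC)


subsection \<open>\<open>Ext\<close> produces sheaves\<close>

text \<open>
  Descent along \<open>e : Y \<rightarrow> X\<close> holds for any presheaf: a section of the underlying map of sets
  splits the map from \<open>\<beta>|Y|\<close> to \<open>\<beta>|X|\<close>.
\<close>

lemma Ext_ob_descent:
  assumes F: "F \<in> Obj PB" shows "epi_descent \<S> (Ext_ob F)"
  unfolding epi_descent_def
proof (intro allI impI)
  fix Y X e assume epi: "is_epi CH Y X e"
  then have Y: "Y \<in> Obj CH" and X: "X \<in> Obj CH" and e: "e \<in> Arr CH Y X" by (auto simp: is_epi_def)
  note surj = epi_surj[OF epi]
  have S: "topspace Y \<in> \<S>" "topspace X \<in> \<S>" using X Y by (auto simp: Obj_CH)
  let ?W = "fibprod Y Y e e" and ?p1 = "fibprod_pr1 Y Y e e" and ?p2 = "fibprod_pr2 Y Y e e"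
  note W = fibprod_Obj[OF Y Y X e e] and p1 = fibprod_pr1_Arr[OF Y Y X e e] and p2 = fibprod_pr2_Arr[OF Y Y X e e]
  have SW: "topspace ?W \<in> \<S>" using W by (simp add: Obj_CH)
  let ?be = "beta_map (topspace Y) (topspace X) e"
  note be = beta_map_CH[OF Y X e]
  \<comment> \<open>A section of the underlying map of sets, with no continuity. Since \<beta>
    accepts any map of sets, it still yields a continuous splitting of \<beta>e.\<close>
  define \<sigma> where "\<sigma> = inv_into (topspace Y) e"
  have \<sigma>: "\<sigma> \<in> topspace X \<rightarrow> topspace Y" "\<And>x. x \<in> topspace X \<Longrightarrow> e (\<sigma> x) = x"
    unfolding \<sigma>_def using surj by (auto intro: inv_into_into f_inv_into_f)
  have e': "e \<in> topspace Y \<rightarrow> topspace X" using Arr_CH_in[OF e] by blast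
  let ?bs = "beta_map (topspace X) (topspace Y) \<sigma>"
  note bs = beta_map_Arr[OF S(2,1) \<sigma>(1)]
  have split: "compose (tb (topspace X)) ?be ?bs = (\<lambda>p\<in>tb (topspace X). p)"
    unfolding beta_map_compose[OF S(2,1,2) \<sigma>(1) e'] by (rule beta_map_id[OF S(2) \<sigma>(2)])
  let ?res = "FAr (Ext_ob F) X Y e"
  let ?D = "{s \<in> FOb (Ext_ob F) Y. FAr (Ext_ob F) Y ?W ?p1 s = FAr (Ext_ob F) Y ?W ?p2 s}"
  have res: "?res t = FAr F (topspace X) (topspace Y) ?be t" if "t \<in> Ext_set F X" for t
    using that by (simp add: FAr_Ext_ob)
  have split': "FAr F (topspace Y) (topspace X) ?bs (FAr F (topspace X) (topspace Y) ?be t) = t"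
    if "t \<in> FOb F (topspace X)" for t
    using bs_comp[OF F S(2,1,2) bs be that] bs_id[OF F S(2) that] split by simp
  have inj: "inj_on ?res (Ext_set F X)"
  proof (rule inj_onI)
    fix t t' assume *: "t \<in> Ext_set F X" "t' \<in> Ext_set F X" "?res t = ?res t'"
    then show "t = t'" using split'[OF Ext_set_subset] res by metis
  qed
  \<comment> \<open>Compatibility of \<open>s\<close> strengthens its \<open>Ext\<close> condition
    from pairs agreeing over \<open>Y\<close> to pairs agreeing over \<open>X\<close>: such a pair
    defines a map to the fibre product of \<open>Y\<close> with itself, which lifts to \<beta> of
    that space.\<close>
  have key: "FAr F (topspace Y) R f s = FAr F (topspace Y) R g s"
    if s: "s \<in> ?D" and R: "R \<in> \<S>" and f: "f \<in> bhom R (topspace Y)"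
      and g: "g \<in> bhom R (topspace Y)"
      and eq: "compose (tb R) e (compose (tb R) (uf_limit Y) f)
        = compose (tb R) e (compose (tb R) (uf_limit Y) g)" for s R f g
  proof -
    have sE: "s \<in> Ext_set F Y" using s by simp
    note s' = Ext_set_subset[OF sE]
    note ff = compose_Arr_CH[OF f uf_limit_Arr[OF Y]] and gg = compose_Arr_CH[OF g uf_limit_Arr[OF Y]]
    obtain h where h: "h \<in> Arr CH (beta R) ?W"
      "compose (tb R) ?p1 h = compose (tb R) (uf_limit Y) f"
      "compose (tb R) ?p2 h = compose (tb R) (uf_limit Y) g"
      using fibprod_universal[OF Y Y X e e ff gg eq] by blast
    note l = lift_Arr[OF R W h(1)] uf_limit_lift[OF R W h(1)]
    let ?l = "lift R ?W h"
    let ?b1 = "beta_map (topspace ?W) (topspace Y) ?p1" and ?b2 = "beta_map (topspace ?W) (topspace Y) ?p2"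
    note b1 = beta_map_CH[OF W Y p1] and b2 = beta_map_CH[OF W Y p2]
    have "FAr F (topspace Y) R f s = FAr F (topspace Y) R (compose (tb R) ?b1 ?l) s"
      by (rule Ext_setD[OF F Y sE R f compose_Arr_CH[OF l(1) b1]])
         (simp add: uf_limit_beta_map_compose[OF W Y p1 l(1)] l(2) h(2))
    also have "\<dots> = FAr F (topspace ?W) R ?l (FAr F (topspace Y) (topspace ?W) ?b1 s)"
      by (rule bs_comp[OF F R SW S(1) l(1) b1 s'])
    also have "FAr F (topspace Y) (topspace ?W) ?b1 s = FAr F (topspace Y) (topspace ?W) ?b2 s"
      using s sE by (simp add: FAr_Ext_ob)
    also have "FAr F (topspace ?W) R ?l (FAr F (topspace Y) (topspace ?W) ?b2 s) = FAr F (topspace Y) R (compose (tb R) ?b2 ?l) s"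
      by (rule bs_comp[OF F R SW S(1) l(1) b2 s', symmetric])
    also have "\<dots> = FAr F (topspace Y) R g s"
      by (rule Ext_setD[OF F Y sE R compose_Arr_CH[OF l(1) b2] g])
         (simp add: uf_limit_beta_map_compose[OF W Y p2 l(1)] l(2) h(3))
    finally show ?thesis .
  qed
  \<comment> \<open>Over \<open>X\<close> the splitting disappears: naturality of \<xi> turns
    \<open>e\<close> into \<beta>e, which cancels \<beta>\<sigma>.\<close>
  have e_bs: "compose (tb R) e (compose (tb R) (uf_limit Y) (compose (tb R) ?bs f))
      = compose (tb R) (uf_limit X) f" if f: "f \<in> bhom R (topspace X)" for R f
  proof -
    have "compose (tb R) e (compose (tb R) (uf_limit Y) (compose (tb R) ?bs f))
      = compose (tb R) (uf_limit X) (compose (tb R) ?be (compose (tb R) ?bs f))"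
      using uf_limit_beta_map_compose[OF Y X e compose_Arr_CH[OF f bs]] by simp
    also have "compose (tb R) ?be (compose (tb R) ?bs f) = f"
      unfolding CH_assoc[OF f] split by (rule CH_id_left[OF f])
    finally show ?thesis .
  qed
  show "bij_betw ?res (FOb (Ext_ob F) X) ?D"
    unfolding bij_betw_def
  proof (intro conjI equalityI subsetI)
    show "inj_on ?res (FOb (Ext_ob F) X)" using inj by simp
    fix s assume "s \<in> ?res ` FOb (Ext_ob F) X"
    then obtain t where t: "t \<in> FOb (Ext_ob F) X" "s = ?res t" by blast
    show "s \<in> ?D"
      using psh_in[OF Ext_ob_PC[OF F] Y X e t(1)] t(2)
        ch_comp[OF Ext_ob_PC[OF F] W Y X p1 e t(1)] ch_comp[OF Ext_ob_PC[OF F] W Y X p2 e t(1)]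
        fibprod_commute[OF Y Y X e e] by simp
  next
    fix s assume s: "s \<in> ?D"
    then have sE: "s \<in> Ext_set F Y" by simp
    note s' = Ext_set_subset[OF sE]
    let ?t = "FAr F (topspace Y) (topspace X) ?bs s"
    have t: "?t \<in> Ext_set F X"
    proof (rule Ext_setI[OF F X bs_in[OF F S(2,1) bs s']])
      fix R f g assume R: "R \<in> \<S>" and f: "f \<in> bhom R (topspace X)"
        and g: "g \<in> bhom R (topspace X)"
        and eq: "compose (tb R) (uf_limit X) f = compose (tb R) (uf_limit X) g"
      have "FAr F (topspace Y) R (compose (tb R) ?bs f) s = FAr F (topspace Y) R (compose (tb R) ?bs g) s"
        by (rule key[OF s R compose_Arr_CH[OF f bs] compose_Arr_CH[OF g bs]])
           (simp add: e_bs f g eq)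
      then show "FAr F (topspace X) R f ?t = FAr F (topspace X) R g ?t"
        using bs_comp[OF F R S(2,1) f bs s'] bs_comp[OF F R S(2,1) g bs s'] by simp
    qed
    have "?res ?t = FAr F (topspace Y) (topspace Y) (compose (tb (topspace Y)) ?bs ?be) s"
      using res[OF t] bs_comp[OF F S(1,2,1) be bs s'] by simp
    \<comment> \<open>The composite of \<beta>e followed by \<beta>\<sigma> need not be the
      identity, but the two agree over \<open>X\<close>, and \<open>key\<close> does not distinguish
      such maps.\<close>
    also have "\<dots> = FAr F (topspace Y) (topspace Y) (\<lambda>p\<in>tb (topspace Y). p) s"
    proof (rule key[OF s S(1) compose_Arr_CH[OF be bs] id_Arr_CH])
      show "compose (tb (topspace Y)) e (compose (tb (topspace Y)) (uf_limit Y)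
          (compose (tb (topspace Y)) ?bs ?be))
        = compose (tb (topspace Y)) e (compose (tb (topspace Y)) (uf_limit Y)
          (\<lambda>p\<in>tb (topspace Y). p))"
        unfolding e_bs[OF be] CH_id_right[OF uf_limit_Arr[OF Y]] by (rule uf_limit_natural[OF Y X e])
    qed
    also have "\<dots> = s" by (rule bs_id[OF F S(1) s'])
    finally show "s \<in> ?res ` FOb (Ext_ob F) X" using t by (metis FOb_Ext_ob imageI)
  qed
qed

text \<open>An injective map between compact Hausdorff spaces has a continuous inverse on its image,
  which may be composed with \<open>f\<close>.\<close>

lemma CH_factor:
  assumes X: "X \<in> Obj CH" and Y: "Y \<in> Obj CH" and m: "m \<in> Arr CH X Y" "inj_on m (topspace X)"
    and f: "f \<in> Arr CH W Y" "f ` topspace W \<subseteq> m ` topspace X"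
  shows "\<exists>k\<in>Arr CH W X. compose (topspace W) m k = f"
proof -
  let ?r = "inv_into (topspace X) m"
  have r: "continuous_map (subtopology Y (m ` topspace X)) X ?r"
    by (rule continuous_inverse_map[of _ _ m]) (use X Y m in \<open>auto simp: Obj_CH Arr_CH\<close>)
  have "continuous_map W (subtopology Y (m ` topspace X)) f"
    using f by (auto simp: Arr_CH continuous_map_in_subtopology)
  then have k: "restrict (?r \<circ> f) (topspace W) \<in> Arr CH W X"
    by (intro restrict_Arr_CH continuous_map_compose[OF _ r])
  show ?thesis
  proof (rule bexI[OF _ k], rule Arr_CH_eqI[OF compose_Arr_CH[OF k m(1)] f(1)])
    fix w assume "w \<in> topspace W"
    moreover from this have "f w \<in> m ` topspace X" using f(2) by blast
    ultimately show "compose (topspace W) m (restrict (?r \<circ> f) (topspace W)) w = f w"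
      by (simp add: compose_eq f_inv_into_f)
  qed
qed

text \<open>\<open>hat\<close> commutes with finite unions and intersections, and \<beta> of an
  injection has as image the \<open>hat\<close> of the image. A finite disjoint decomposition of
  \<open>T\<close> thus becomes one of \<beta>T.\<close>

lemma beta_coproduct:
  assumes I: "finite I" and T: "T \<in> \<S>" and S: "\<And>i. i \<in> I \<Longrightarrow> S i \<in> \<S>"
    and f: "\<And>i. i \<in> I \<Longrightarrow> f i \<in> S i \<rightarrow> T" and inj: "\<And>i. i \<in> I \<Longrightarrow> inj_on (f i) (S i)"
    and disj: "\<And>i j. i \<in> I \<Longrightarrow> j \<in> I \<Longrightarrow> i \<noteq> j \<Longrightarrow> f i ` S i \<inter> f j ` S j = {}"
    and cover: "T \<subseteq> (\<Union>i\<in>I. f i ` S i)"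
  shows "is_coproduct CH I (\<lambda>i. beta (S i)) (beta T) (\<lambda>i. beta_map (S i) T (f i))"
proof (rule CH_coproductI[OF I beta_in_CHaus[OF T] beta_in_CHaus[OF S]])
  note im = beta_map_image[OF S T f inj]
  have sub: "f i ` S i \<subseteq> T" if "i \<in> I" for i using f[OF that] by auto
  fix i j x y assume *: "i \<in> I" "j \<in> I" "x \<in> tb (S i)" "y \<in> tb (S j)"
    "beta_map (S i) T (f i) x = beta_map (S j) T (f j) y"
  show "i = j"
  proof (rule ccontr)
    assume "i \<noteq> j"
    then have "hat T (f i ` S i) \<inter> hat T (f j ` S j) = {}"
      using disj[OF *(1,2)] hat_Int[OF sub[OF *(1)] sub[OF *(2)]] by simp
    moreover have "beta_map (S i) T (f i) x \<in> hat T (f i ` S i)" "beta_map (S j) T (f j) y \<in> hat T (f j ` S j)"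
      unfolding im[OF *(1) *(1) *(1), symmetric] im[OF *(2) *(2) *(2), symmetric] using *(3,4) by simp_all
    ultimately show False using *(5) by (metis IntI empty_iff)
  qed
next
  note im = beta_map_image[OF S T f inj]
  have sub: "f i ` S i \<subseteq> T" if "i \<in> I" for i using f[OF that] by auto
  have "T = \<Union>((\<lambda>i. f i ` S i) ` I)" using cover sub by blast
  then have "tb T = hat T (\<Union>((\<lambda>i. f i ` S i) ` I))" using hat_top by metis
  also have "\<dots> = (\<Union>i\<in>I. hat T (f i ` S i))"
    using hat_Union[of "(\<lambda>i. f i ` S i) ` I" T] I sub by auto
  also have "\<dots> = (\<Union>i\<in>I. beta_map (S i) T (f i) ` tb (S i))"
    using im by simp
  finally show "tb T \<subseteq> (\<Union>i\<in>I. beta_map (S i) T (f i) ` tb (S i))" by simp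
qed (use beta_map_Arr[OF S T f] beta_map_inj[OF S T f inj] in auto)

lemma openin_closed_piece:
  assumes I: "finite I" and clo: "\<And>j. j \<in> I \<Longrightarrow> closedin c (A j)"
    and disj: "\<And>j. j \<in> I \<Longrightarrow> j \<noteq> i \<Longrightarrow> A i \<inter> A j = {}" and cover: "topspace c = (\<Union>j\<in>I. A j)" and i: "i \<in> I"
  shows "openin c (A i)"
proof -
  have "closedin c (\<Union>j\<in>I - {i}. A j)"
    using I clo by (intro closedin_Union) auto
  moreover have "A i = topspace c - (\<Union>j\<in>I - {i}. A j)"
    unfolding cover using i disj by auto
  ultimately show ?thesis by (metis openin_diff openin_topspace)
qed

lemma coproduct_image_open:
  assumes I: "finite I" and cop: "is_coproduct CH I X c \<iota>" and i: "i \<in> I"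
  shows "openin c (\<iota> i ` topspace (X i))"
proof (rule openin_closed_piece[OF I _ _ CH_coproductD(3)[OF I cop] i])
  have c: "c \<in> Obj CH" and X: "\<And>i. i \<in> I \<Longrightarrow> X i \<in> Obj CH" and \<iota>: "\<And>i. i \<in> I \<Longrightarrow> \<iota> i \<in> Arr CH (X i) c"
    using cop unfolding is_coproduct_def by auto
  show "closedin c (\<iota> j ` topspace (X j))" if "j \<in> I" for j
    by (rule CH_closed_image[OF X[OF that] c \<iota>[OF that]])
  show "\<iota> i ` topspace (X i) \<inter> \<iota> j ` topspace (X j) = {}" if "j \<in> I" "j \<noteq> i" for j
    using CH_coproductD(2)[OF I cop i that(1)] that(2) by blast
qed

text \<open>The work is to show that a section over \<beta>|c| whose pieces all satisfy the
  \<open>Ext\<close> condition satisfies it itself. Two maps into \<beta>|c| that agree over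
  \<open>c\<close> induce one map from \<beta>R to \<open>c\<close>. Pulling back the clopen
  summands cuts \<open>R\<close> into finitely many pieces; on each the condition for one
  \<open>X i\<close> applies, and product preservation on \<open>R\<close> reassembles the
  result.\<close>

lemma Ext_ob_products:
  assumes F: "F \<in> Obj PB" and prod: "coproducts_to_products BS F"
  shows "coproducts_to_products CH (Ext_ob F)"
  unfolding coproducts_to_products_def
proof (intro allI impI)
  fix I :: "nat set" and X c \<iota> assume I: "finite I" and cop: "is_coproduct CH I X c \<iota>"
  have c: "c \<in> Obj CH" and X: "\<And>i. i \<in> I \<Longrightarrow> X i \<in> Obj CH" and \<iota>: "\<And>i. i \<in> I \<Longrightarrow> \<iota> i \<in> Arr CH (X i) c"
    using cop unfolding is_coproduct_def by auto
  note copD = CH_coproductD[OF I cop]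
  have Sc: "topspace c \<in> \<S>" and SX: "\<And>i. i \<in> I \<Longrightarrow> topspace (X i) \<in> \<S>" using c X by (auto simp: Obj_CH)
  define b where "b i = beta_map (topspace (X i)) (topspace c) (\<iota> i)" for i
  have b: "b i \<in> bhom (topspace (X i)) (topspace c)" if "i \<in> I" for i
    unfolding b_def by (rule beta_map_CH[OF X[OF that] c \<iota>[OF that]])
  have \<iota>': "\<iota> i \<in> topspace (X i) \<rightarrow> topspace c" if "i \<in> I" for i using Arr_CH_in[OF \<iota>[OF that]] by blast
  have b_inj: "inj_on (b i) (tb (topspace (X i)))"
    and b_im: "b i ` tb (topspace (X i)) = hat (topspace c) (\<iota> i ` topspace (X i))" if "i \<in> I" for i
    unfolding b_def
    by (rule beta_map_inj[OF SX[OF that] Sc \<iota>'[OF that] copD(1)[OF that]],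
        rule beta_map_image[OF SX[OF that] Sc \<iota>'[OF that] copD(1)[OF that]])
  have "is_coproduct BS I (\<lambda>i. topspace (X i)) (topspace c) b"
    unfolding b_def
    by (intro BS_coproductI beta_coproduct I Sc SX \<iota>' copD(1)) (use copD(2,3) in auto)
  then have bij: "bij_betw (\<lambda>s. \<lambda>i\<in>I. FAr F (topspace c) (topspace (X i)) (b i) s) (FOb F (topspace c))
      (\<Pi>\<^sub>E i\<in>I. FOb F (topspace (X i)))"
    using prod I unfolding coproducts_to_products_def by blast
  let ?h = "\<lambda>s. \<lambda>i\<in>I. FAr (Ext_ob F) c (X i) (\<iota> i) s"
  have h: "?h s = (\<lambda>i\<in>I. FAr F (topspace c) (topspace (X i)) (b i) s)" if "s \<in> Ext_set F c" for s
    using that by (simp add: FAr_Ext_ob b_def)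
  have in_Ext: "s \<in> Ext_set F c"
    if s: "s \<in> FOb F (topspace c)" and sb: "\<And>i. i \<in> I \<Longrightarrow> FAr F (topspace c) (topspace (X i)) (b i) s \<in> Ext_set F (X i)" for s
  proof (rule Ext_setI[OF F c s])
    fix R f g assume R: "R \<in> \<S>" and f: "f \<in> bhom R (topspace c)"
      and g: "g \<in> bhom R (topspace c)"
      and eq: "compose (tb R) (uf_limit c) f = compose (tb R) (uf_limit c) g"
    define k where "k = compose (tb R) (uf_limit c) f"
    have k: "k \<in> Arr CH (beta R) c" unfolding k_def by (rule compose_Arr_CH[OF f uf_limit_Arr[OF c]])
    define K where "K i = {p \<in> tb R. k p \<in> \<iota> i ` topspace (X i)}" for i
    define Q where "Q i = {x \<in> R. pt R x \<in> K i}" for i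
    have KQ: "K i = hat R (Q i)" if i: "i \<in> I" for i
      unfolding Q_def
    proof (rule clopen_is_hat[OF R])
      show "openin (beta R) (K i)" unfolding K_def
        by (rule openin_continuous_map_preimage[OF _ coproduct_image_open[OF I cop i]])
           (use k in \<open>simp add: Arr_CH\<close>)
      show "closedin (beta R) (K i)" unfolding K_def
        by (rule closedin_continuous_map_preimage[OF _ CH_closed_image[OF X[OF i] c \<iota>[OF i]]])
           (use k in \<open>simp add: Arr_CH\<close>)
    qed
    have QR: "Q i \<subseteq> R" for i by (auto simp: Q_def)
    have QS: "Q i \<in> \<S>" for i by (rule subset_in[OF R QR])
    define j where "j i = beta_map (Q i) R (\<lambda>x. x)" for i
    have id': "(\<lambda>x. x) \<in> Q i \<rightarrow> R" for i using QR by auto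
    have j: "j i \<in> bhom (Q i) R" for i
      unfolding j_def by (rule beta_map_Arr[OF QS R id'])
    have j_im: "j i ` tb (Q i) = K i" if "i \<in> I" for i
      unfolding j_def KQ[OF that] using beta_map_image[OF QS R id'] by simp
    have "is_coproduct BS I Q R j"
      unfolding j_def
    proof (intro BS_coproductI beta_coproduct I R QS id' inj_on_id2)
      show "(\<lambda>x. x) ` Q i \<inter> (\<lambda>x. x) ` Q i' = {}" if "i \<in> I" "i' \<in> I" "i \<noteq> i'" for i i'
      proof (rule ccontr)
        assume "\<not> ?thesis"
        then obtain x where "x \<in> Q i" "x \<in> Q i'" by blast
        then obtain y z where "y \<in> topspace (X i)" "z \<in> topspace (X i')" "k (pt R x) = \<iota> i y" "k (pt R x) = \<iota> i' z"
          unfolding Q_def K_def by blast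
        then show False using copD(2)[OF that(1,2), of y z] that(3) by simp
      qed
      show "R \<subseteq> (\<Union>i\<in>I. (\<lambda>x. x) ` Q i)"
      proof
        fix x assume "x \<in> R"
        then have "pt R x \<in> tb R" by (rule pt_in)
        then have "k (pt R x) \<in> (\<Union>i\<in>I. \<iota> i ` topspace (X i))" using Arr_CH_in[OF k] copD(3) by simp
        then show "x \<in> (\<Union>i\<in>I. (\<lambda>x. x) ` Q i)"
          using \<open>x \<in> R\<close> \<open>pt R x \<in> _\<close> by (auto simp: Q_def K_def)
      qed
    qed
    then have bijR: "bij_betw (\<lambda>s. \<lambda>i\<in>I. FAr F R (Q i) (j i) s) (FOb F R) (\<Pi>\<^sub>E i\<in>I. FOb F (Q i))"
      using prod I unfolding coproducts_to_products_def by blast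
    have part: "FAr F R (Q i) (j i) (FAr F (topspace c) R f s) = FAr F R (Q i) (j i) (FAr F (topspace c) R g s)"
      if i: "i \<in> I" for i
    proof -
      \<comment> \<open>On the piece \<open>Q i\<close> the limits lie in the open image of
        \<open>X i\<close>, so the ultrafilters themselves contain that image. Hence the map lands
        in the clopen copy of \<beta>|X i| and factors through \<open>b i\<close>.\<close>
      have fac: "\<exists>f'\<in>bhom (Q i) (topspace (X i)).
          compose (tb (Q i)) (b i) f' = compose (tb (Q i)) f (j i)"
        if f: "f \<in> bhom R (topspace c)" and kf: "k = compose (tb R) (uf_limit c) f" for f
      proof (rule CH_factor[OF beta_in_CHaus[OF SX[OF i]] beta_in_CHaus[OF Sc] b[OF i] b_inj[OF i] compose_Arr_CH[OF j f]])
        show "compose (tb (Q i)) f (j i) ` tb (Q i) \<subseteq> b i ` tb (topspace (X i))"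
          unfolding b_im[OF i]
        proof
          fix z assume "z \<in> compose (tb (Q i)) f (j i) ` tb (Q i)"
          then obtain q where q: "q \<in> tb (Q i)" "z = f (j i q)" by (auto simp: compose_eq)
          then have "j i q \<in> K i" using j_im[OF i] by blast
          then have jq: "j i q \<in> tb R" "uf_limit c (f (j i q)) \<in> \<iota> i ` topspace (X i)"
            using kf by (auto simp: K_def compose_eq)
          show "z \<in> hat (topspace c) (\<iota> i ` topspace (X i))" unfolding q(2)
            by (rule uf_limit_openin[OF c Arr_CH_in[OF f jq(1)] coproduct_image_open[OF I cop i] jq(2)])
        qed
      qed
      obtain f' where f': "f' \<in> bhom (Q i) (topspace (X i))"
        "compose (tb (Q i)) (b i) f' = compose (tb (Q i)) f (j i)"
        using fac[OF f k_def] by blast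
      obtain g' where g': "g' \<in> bhom (Q i) (topspace (X i))"
        "compose (tb (Q i)) (b i) g' = compose (tb (Q i)) g (j i)"
        using fac[OF g] eq k_def by auto
      have \<iota>f: "compose (tb (Q i)) (\<iota> i) (compose (tb (Q i)) (uf_limit (X i)) f')
          = compose (tb (Q i)) k (j i)"
        using uf_limit_beta_map_compose[OF X[OF i] c \<iota>[OF i] f'(1), folded b_def] f'(2) CH_assoc[OF j, of i "uf_limit c" f]
        by (simp add: k_def)
      have \<iota>g: "compose (tb (Q i)) (\<iota> i) (compose (tb (Q i)) (uf_limit (X i)) g')
          = compose (tb (Q i)) k (j i)"
        using uf_limit_beta_map_compose[OF X[OF i] c \<iota>[OF i] g'(1), folded b_def] g'(2) CH_assoc[OF j, of i "uf_limit c" g]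
        by (simp add: k_def eq)
      note \<xi>f = compose_Arr_CH[OF f'(1) uf_limit_Arr[OF X[OF i]]] and \<xi>g = compose_Arr_CH[OF g'(1) uf_limit_Arr[OF X[OF i]]]
      \<comment> \<open>After the injective map \<open>\<iota> i\<close> both sides become the
        restriction of \<open>k\<close> to this piece.\<close>
      have eq': "compose (tb (Q i)) (uf_limit (X i)) f' = compose (tb (Q i)) (uf_limit (X i)) g'"
      proof (rule Arr_CH_eqI[OF \<xi>f \<xi>g])
        fix q assume q: "q \<in> tb (Q i)"
        have "\<iota> i (compose (tb (Q i)) (uf_limit (X i)) f' q) = \<iota> i (compose (tb (Q i)) (uf_limit (X i)) g' q)"
          using fun_cong[OF \<iota>f, of q] fun_cong[OF \<iota>g, of q] q by (simp add: compose_eq)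
        then show "compose (tb (Q i)) (uf_limit (X i)) f' q = compose (tb (Q i)) (uf_limit (X i)) g' q"
          using inj_onD[OF copD(1)[OF i]] Arr_CH_in[OF \<xi>f q] Arr_CH_in[OF \<xi>g q] by blast
      qed
      have "FAr F R (Q i) (j i) (FAr F (topspace c) R f s) = FAr F (topspace (X i)) (Q i) f' (FAr F (topspace c) (topspace (X i)) (b i) s)"
        using bs_comp[OF F QS R Sc j f s] bs_comp[OF F QS SX[OF i] Sc f'(1) b[OF i] s] f'(2) by simp
      also have "\<dots> = FAr F (topspace (X i)) (Q i) g' (FAr F (topspace c) (topspace (X i)) (b i) s)"
        by (rule Ext_setD[OF F X[OF i] sb[OF i] QS f'(1) g'(1) eq'])
      also have "\<dots> = FAr F R (Q i) (j i) (FAr F (topspace c) R g s)"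
        using bs_comp[OF F QS R Sc j g s] bs_comp[OF F QS SX[OF i] Sc g'(1) b[OF i] s] g'(2) by simp
      finally show ?thesis .
    qed
    show "FAr F (topspace c) R f s = FAr F (topspace c) R g s"
      by (rule inj_onD[OF bij_betw_imp_inj_on[OF bijR] _ bs_in[OF F R Sc f s] bs_in[OF F R Sc g s]])
         (rule restrict_ext, rule part)
  qed
  show "bij_betw ?h (FOb (Ext_ob F) c) (\<Pi>\<^sub>E i\<in>I. FOb (Ext_ob F) (X i))"
    unfolding bij_betw_def
  proof (intro conjI equalityI subsetI)
    show "inj_on ?h (FOb (Ext_ob F) c)"
    proof (rule inj_onI)
      fix s t assume *: "s \<in> FOb (Ext_ob F) c" "t \<in> FOb (Ext_ob F) c" "?h s = ?h t"
      then show "s = t"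
        using h[of s] h[of t] inj_onD[OF bij_betw_imp_inj_on[OF bij], of s t]
          Ext_set_subset[of s F c] Ext_set_subset[of t F c] by simp
    qed
    fix t assume "t \<in> ?h ` FOb (Ext_ob F) c"
    then show "t \<in> (\<Pi>\<^sub>E i\<in>I. FOb (Ext_ob F) (X i))"
      using psh_in[OF Ext_ob_PC[OF F] X c \<iota>] by auto
  next
    fix t assume t: "t \<in> (\<Pi>\<^sub>E i\<in>I. FOb (Ext_ob F) (X i))"
    then have tE: "\<And>i. i \<in> I \<Longrightarrow> t i \<in> Ext_set F (X i)" by auto
    have "t \<in> (\<Pi>\<^sub>E i\<in>I. FOb F (topspace (X i)))"
      using t by (auto simp: PiE_iff intro: Ext_set_subset)
    then have "t \<in> (\<lambda>s. \<lambda>i\<in>I. FAr F (topspace c) (topspace (X i)) (b i) s) ` FOb F (topspace c)"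
      unfolding bij_betw_imp_surj_on[OF bij] .
    then obtain s where s: "s \<in> FOb F (topspace c)" "t = (\<lambda>i\<in>I. FAr F (topspace c) (topspace (X i)) (b i) s)"
      by (rule imageE)
    have sE: "s \<in> Ext_set F c" by (rule in_Ext[OF s(1)]) (use tE s(2) in auto)
    then show "t \<in> ?h ` FOb (Ext_ob F) c" using h[OF sE] s(2) by (intro image_eqI[of _ _ s]) simp_all
  qed
qed

lemma Ext_functor_CSets: "is_functor (PShx \<S>) (CSets \<S>) (Ext \<S>)"
  unfolding CSets_def
proof (rule is_functor_into_full_subcat)
  show "is_functor (PShx \<S>) PC (Ext \<S>)"
    unfolding PShx_def by (rule is_functor_from_full_subcat[OF Ext_functor])
  fix F assume "F \<in> Obj (PShx \<S>)"
  then have "F \<in> Obj PB" "coproducts_to_products BS F" by (simp_all add: PShx_def Obj_full_subcat)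
  then show "coproducts_to_products CH (FOb (Ext \<S>) F) \<and> epi_descent \<S> (FOb (Ext \<S>) F)"
    using Ext_ob_products Ext_ob_descent by (simp add: Ext_def)
qed

end


subsection \<open>Restriction of continuous maps to clopen subsets\<close>

lemma partition_on_unique: "partition_on S W \<Longrightarrow> u \<in> W \<Longrightarrow> v \<in> W \<Longrightarrow> x \<in> u \<Longrightarrow> x \<in> v \<Longrightarrow> u = v"
  unfolding partition_on_def disjoint_def by blast

lemma partition_on_subset: "partition_on S W \<Longrightarrow> w \<in> W \<Longrightarrow> w \<subseteq> S"
  unfolding partition_on_def by blast

lemma partition_on_nonempty: "partition_on S W \<Longrightarrow> w \<in> W \<Longrightarrow> w \<noteq> {}"
  unfolding partition_on_def by blast

lemma partition_on_meet:
  assumes P: "partition_on S P" and Q: "partition_on S Q"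
  shows "partition_on S ((\<lambda>(p, q). p \<inter> q) ` (P \<times> Q) - {{}})"
proof (rule partition_onI)
  show "\<Union>((\<lambda>(p, q). p \<inter> q) ` (P \<times> Q) - {{}}) = S"
  proof (intro equalityI subsetI)
    fix x assume "x \<in> S"
    then obtain p q where "p \<in> P" "q \<in> Q" "x \<in> p" "x \<in> q"
      using P Q unfolding partition_on_def by blast
    then show "x \<in> \<Union>((\<lambda>(p, q). p \<inter> q) ` (P \<times> Q) - {{}})"
      by (intro UnionI[of "p \<inter> q"]) auto
  qed (use partition_on_subset[OF P] in auto)
  fix a b assume ab: "a \<in> (\<lambda>(p, q). p \<inter> q) ` (P \<times> Q) - {{}}" "b \<in> (\<lambda>(p, q). p \<inter> q) ` (P \<times> Q) - {{}}" "a \<noteq> b"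
  show "disjnt a b"
    unfolding disjnt_iff
  proof (intro allI notI, elim conjE)
    fix x assume x: "x \<in> a" "x \<in> b"
    obtain p q p' q' where "p \<in> P" "q \<in> Q" "a = p \<inter> q" "p' \<in> P" "q' \<in> Q" "b = p' \<inter> q'"
      using ab by auto
    then have "p = p'" "q = q'"
      using x partition_on_unique[OF P, of p p' x] partition_on_unique[OF Q, of q q' x] by auto
    then show False using \<open>a = _\<close> \<open>b = _\<close> ab(3) by simp
  qed
qed simp

context small_sets
begin

abbreviation "incl v S \<equiv> beta_map v S (\<lambda>x. x)"
abbreviation "ident S \<equiv> (\<lambda>p\<in>tb S. p)"

lemma incl_Arr: "S \<in> \<S> \<Longrightarrow> v \<subseteq> S \<Longrightarrow> incl v S \<in> bhom v S"
  by (rule beta_map_Arr[OF subset_in]) auto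

lemma incl_inj: "S \<in> \<S> \<Longrightarrow> v \<subseteq> S \<Longrightarrow> inj_on (incl v S) (tb v)"
  by (rule beta_map_inj[OF subset_in]) auto

lemma incl_image: "S \<in> \<S> \<Longrightarrow> v \<subseteq> S \<Longrightarrow> incl v S ` tb v = hat S v"
  using beta_map_image[of v S "\<lambda>x. x"] subset_in[of S v] by auto

lemma incl_refl: "S \<in> \<S> \<Longrightarrow> incl S S = ident S"
  by (rule beta_map_id) auto

lemma incl_compose:
  "S \<in> \<S> \<Longrightarrow> w \<subseteq> v \<Longrightarrow> v \<subseteq> S \<Longrightarrow> compose (tb w) (incl v S) (incl w v) = incl w S"
  by (rule beta_map_compose) (auto intro: subset_in)

lemma ident_compose:
  "f \<in> bhom S T \<Longrightarrow> compose (tb S) f (ident S) = f"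
  "f \<in> bhom S T \<Longrightarrow> compose (tb S) (ident T) f = f"
  by (rule CH_id_right, assumption) (rule CH_id_left)

text \<open>This says that \<open>f\<close> restricts to a map \<beta>v -> \<beta>u, phrased inside
  \<beta>S and \<beta>T where the clopen copies live. It is the condition under which the definite
  description in \<open>restricted_map\<close> is meaningful.\<close>

definition carries :: "'u set \<Rightarrow> 'u set \<Rightarrow> ('u \<Rightarrow> 'u) \<Rightarrow> 'u set \<Rightarrow> 'u set \<Rightarrow> bool" where
  "carries S T f v u \<longleftrightarrow> v \<subseteq> S \<and> u \<subseteq> T \<and> f ` hat S v \<subseteq> hat T u"

context
  fixes S T f v u
  assumes S: "S \<in> \<S>" and T: "T \<in> \<S>" and f: "f \<in> bhom S T" and c: "carries S T f v u"
begin

text \<open>\<open>incl u T\<close> is injective, so the commuting square determines the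
  restriction. Identities between restrictions are proved by checking this square.\<close>

lemma restricted_map_unique:
  assumes k: "k \<in> bhom v u"
    and eq: "compose (tb v) (incl u T) k = compose (tb v) f (incl v S)"
  shows "restricted_map S T f v u = k"
proof (rule extensionalityI[of _ "tb v"])
  fix p assume p: "p \<in> tb v"
  have u: "u \<subseteq> T" using c by (simp add: carries_def)
  have kp: "k p \<in> tb u" "incl u T (k p) = f (incl v S p)"
    using Arr_CH_in[OF k p] fun_cong[OF eq, of p] p by (simp_all add: compose_eq)
  have "(THE q. q \<in> tb u \<and> incl u T q = f (incl v S p)) = k p"
  proof (rule the_equality)
    fix q assume "q \<in> tb u \<and> incl u T q = f (incl v S p)"
    then show "q = k p" using inj_onD[OF incl_inj[OF T u], of q "k p"] kp by simp
  qed (use kp in simp)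
  then show "restricted_map S T f v u p = k p" using p by (simp add: restricted_map_def)
qed (use k in \<open>auto simp: restricted_map_def Arr_CH\<close>)

lemma restricted_map_exists:
  "\<exists>k\<in>bhom v u. compose (tb v) (incl u T) k = compose (tb v) f (incl v S)"
proof -
  have vu: "v \<subseteq> S" "u \<subseteq> T" "f ` hat S v \<subseteq> hat T u" using c by (auto simp: carries_def)
  note i = incl_Arr[OF S vu(1)]
  show ?thesis
  proof (rule CH_factor[OF beta_in_CHaus beta_in_CHaus[OF T] incl_Arr[OF T vu(2)] incl_inj[OF T vu(2)] compose_Arr_CH[OF i f]])
    show "u \<in> \<S>" by (rule subset_in[OF T vu(2)])
    show "compose (tb v) f (incl v S) ` tb v \<subseteq> incl u T ` tb u"
      unfolding incl_image[OF T vu(2)] using vu(3) unfolding incl_image[OF S vu(1), symmetric]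
      by (auto simp: compose_eq)
  qed
qed

lemma restricted_map_Arr: "restricted_map S T f v u \<in> bhom v u"
  and restricted_map_eq: "compose (tb v) (incl u T) (restricted_map S T f v u)
    = compose (tb v) f (incl v S)"
proof -
  obtain k where k: "k \<in> bhom v u"
    "compose (tb v) (incl u T) k = compose (tb v) f (incl v S)"
    using restricted_map_exists by (rule bexE)
  show "restricted_map S T f v u \<in> bhom v u"
    "compose (tb v) (incl u T) (restricted_map S T f v u)
    = compose (tb v) f (incl v S)"
    unfolding restricted_map_unique[OF k] by (fact k)+
qed

end

lemma carries_compose:
  assumes g: "g \<in> bhom R S" and "carries S T f v u" "carries R S g w v"
  shows "carries R T (compose (tb R) f g) w u"
  unfolding carries_def
proof (intro conjI subsetI)
  fix z assume "z \<in> compose (tb R) f g ` hat R w"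
  then obtain p where p: "p \<in> hat R w" "z = compose (tb R) f g p" by (rule imageE)
  then have "z = f (g p)" using hat_subset[OF p(1)] by (simp add: compose_eq)
  then show "z \<in> hat T u" using assms(2,3) p(1) unfolding carries_def by blast
qed (use assms in \<open>auto simp: carries_def\<close>)

lemma restricted_map_compose:
  assumes R: "R \<in> \<S>" and S: "S \<in> \<S>" and T: "T \<in> \<S>"
    and f: "f \<in> bhom S T" and g: "g \<in> bhom R S"
    and c: "carries S T f v u" and d: "carries R S g w v"
  shows "restricted_map R T (compose (tb R) f g) w u
    = compose (tb w) (restricted_map S T f v u) (restricted_map R S g w v)"
proof (rule restricted_map_unique[OF R T compose_Arr_CH[OF g f] carries_compose[OF g c d]
      compose_Arr_CH[OF restricted_map_Arr[OF R S g d] restricted_map_Arr[OF S T f c]]])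
  note r = restricted_map_Arr[OF R S g d] and r' = restricted_map_Arr[OF S T f c]
  have wR: "w \<subseteq> R" using d by (simp add: carries_def)
  have "compose (tb w) (incl u T) (compose (tb w) (restricted_map S T f v u) (restricted_map R S g w v))
    = compose (tb w) (compose (tb v) f (incl v S)) (restricted_map R S g w v)"
    unfolding CH_assoc[OF r] restricted_map_eq[OF S T f c] ..
  also have "\<dots> = compose (tb w) f (compose (tb w) g (incl w R))"
    unfolding CH_assoc[OF r, symmetric] restricted_map_eq[OF R S g d] ..
  also have "\<dots> = compose (tb w) (compose (tb R) f g) (incl w R)"
    by (rule CH_assoc[OF incl_Arr[OF R wR]])
  finally show "compose (tb w) (incl u T) (compose (tb w) (restricted_map S T f v u) (restricted_map R S g w v))
    = compose (tb w) (compose (tb R) f g) (incl w R)" .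
qed

lemma carries_ident: "S \<in> \<S> \<Longrightarrow> carries S S (ident S) v u \<longleftrightarrow> v \<subseteq> u \<and> u \<subseteq> S"
proof
  assume S: "S \<in> \<S>" and c: "carries S S (ident S) v u"
  have "ident S ` hat S v = hat S v" using hat_subset[of _ S v] by force
  then show "v \<subseteq> u \<and> u \<subseteq> S" using c hat_subsetD[OF S] by (simp add: carries_def)
next
  assume S: "S \<in> \<S>" and vu: "v \<subseteq> u \<and> u \<subseteq> S"
  have "ident S ` hat S v = hat S v" using hat_subset[of _ S v] by force
  then show "carries S S (ident S) v u" using vu hat_mono[of v u S] by (auto simp: carries_def)
qed

text \<open>Treating inclusions as restrictions of the identity makes shrinking the source and
  enlarging the target instances of \<open>restricted_map_compose\<close>.\<close>

lemma restricted_map_ident: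
  assumes S: "S \<in> \<S>" and vu: "v \<subseteq> u" "u \<subseteq> S"
  shows "restricted_map S S (ident S) v u = incl v u"
proof (rule restricted_map_unique[OF S S id_Arr_CH])
  show "carries S S (ident S) v u" using carries_ident S vu by simp
  show "incl v u \<in> bhom v u" by (rule incl_Arr[OF subset_in[OF S vu(2)] vu(1)])
  show "compose (tb v) (incl u S) (incl v u) = compose (tb v) (ident S) (incl v S)"
    unfolding incl_compose[OF S vu] using ident_compose(2)[OF incl_Arr[OF S]] vu by (metis subset_trans)
qed

lemma restricted_map_shrink:
  assumes S: "S \<in> \<S>" and T: "T \<in> \<S>" and f: "f \<in> bhom S T"
    and c: "carries S T f v u" and w: "w \<subseteq> v"
  shows "carries S T f w u"
    and "restricted_map S T f w u = compose (tb w) (restricted_map S T f v u) (incl w v)"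
proof -
  have vS: "v \<subseteq> S" using c by (simp add: carries_def)
  have d: "carries S S (ident S) w v" using carries_ident[OF S] w vS by simp
  show "carries S T f w u"
    using carries_compose[OF id_Arr_CH c d] unfolding ident_compose(1)[OF f] .
  show "restricted_map S T f w u = compose (tb w) (restricted_map S T f v u) (incl w v)"
    using restricted_map_compose[OF S S T f id_Arr_CH c d]
    unfolding ident_compose(1)[OF f] restricted_map_ident[OF S w vS] .
qed

lemma restricted_map_enlarge:
  assumes S: "S \<in> \<S>" and T: "T \<in> \<S>" and f: "f \<in> bhom S T"
    and c: "carries S T f v u" and u: "u \<subseteq> u'" "u' \<subseteq> T"
  shows "carries S T f v u'"
    and "restricted_map S T f v u' = compose (tb v) (incl u u') (restricted_map S T f v u)"
proof -
  have d: "carries T T (ident T) u u'" using carries_ident[OF T] u by simp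
  show "carries S T f v u'"
    using carries_compose[OF f d c] unfolding ident_compose(2)[OF f] .
  show "restricted_map S T f v u' = compose (tb v) (incl u u') (restricted_map S T f v u)"
    using restricted_map_compose[OF S T T id_Arr_CH f d c]
    unfolding ident_compose(2)[OF f] restricted_map_ident[OF T u] .
qed

lemma carries_top:
  assumes "f \<in> bhom S T" shows "carries S T f S T"
  using Arr_CH_in[OF assms] by (auto simp: carries_def hat_top)

lemma restricted_map_top:
  assumes S: "S \<in> \<S>" and T: "T \<in> \<S>" and f: "f \<in> bhom S T"
  shows "restricted_map S T f S T = f"
  by (rule restricted_map_unique[OF S T f carries_top[OF f] f])
     (simp add: incl_refl S T ident_compose[OF f])

text \<open>The definite description is justified: the preimage of a clopen set is clopen, hence a
  \<open>hat\<close> by \<open>clopen_is_hat\<close>, and \<open>hat\<close> is injective on subsets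
  of \<open>S\<close> by \<open>hat_eqD\<close>.\<close>

lemma clopen_preimage:
  assumes S: "S \<in> \<S>" and T: "T \<in> \<S>" and f: "f \<in> bhom S T" and u: "u \<subseteq> T"
  shows "clopen_preimage S T f u \<subseteq> S"
    and "hat S (clopen_preimage S T f u) = {p \<in> tb S. f p \<in> hat T u}"
proof -
  let ?K = "{p \<in> tb S. f p \<in> hat T u}"
  have cf: "continuous_map (beta S) (beta T) f" using f by (simp add: Arr_CH)
  have K: "?K = hat S {x \<in> S. pt S x \<in> ?K}"
    by (rule clopen_is_hat[OF S openin_continuous_map_preimage[OF cf openin_hat[OF T u]]
          closedin_continuous_map_preimage[OF cf closedin_hat[OF T u]]])
  have "\<exists>v. v \<subseteq> S \<and> ?K = hat S v" by (rule exI, rule conjI[OF _ K]) (rule Collect_restrict)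
  moreover have "v = v'" if "v \<subseteq> S \<and> ?K = hat S v" "v' \<subseteq> S \<and> ?K = hat S v'" for v v'
    using hat_eqD[OF S, of v v'] that by simp
  ultimately have "\<exists>!v. v \<subseteq> S \<and> ?K = hat S v" by (rule ex_ex1I)
  from theI'[OF this] show "clopen_preimage S T f u \<subseteq> S" "hat S (clopen_preimage S T f u) = ?K"
    unfolding clopen_preimage_def by simp_all
qed

lemma carries_iff:
  assumes S: "S \<in> \<S>" and T: "T \<in> \<S>" and f: "f \<in> bhom S T" and u: "u \<subseteq> T" and v: "v \<subseteq> S"
  shows "carries S T f v u \<longleftrightarrow> v \<subseteq> clopen_preimage S T f u"
proof -
  note cp = clopen_preimage[OF S T f u]
  have "carries S T f v u \<longleftrightarrow> hat S v \<subseteq> hat S (clopen_preimage S T f u)"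
    unfolding cp(2) carries_def using u v hat_subset[of _ S v] by auto
  also have "\<dots> \<longleftrightarrow> v \<subseteq> clopen_preimage S T f u"
    using hat_subsetD[OF S v cp(1)] hat_mono[OF _ cp(1)] by blast
  finally show ?thesis .
qed

text \<open>The principal ultrafilter at a common point lands in both targets. Together with
  \<open>Cov_unique\<close> this identifies blocks: overlapping pieces are carried to the same block
  of a covering.\<close>

lemma carries_disjoint:
  assumes S: "S \<in> \<S>" and c: "carries S T f v u" "carries S T f v' u'" and x: "x \<in> v" "x \<in> v'"
  shows "u \<inter> u' \<noteq> {}"
proof
  assume e: "u \<inter> u' = {}"
  have v: "v \<subseteq> S" "v' \<subseteq> S" and u: "u \<subseteq> T" "u' \<subseteq> T" using c by (auto simp: carries_def)
  then have xS: "x \<in> S" using x by blast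
  have "pt S x \<in> hat S v" "pt S x \<in> hat S v'" using pt_hat[OF S xS] v x by simp_all
  then have "f (pt S x) \<in> hat T u \<inter> hat T u'" using c unfolding carries_def by blast
  then show False unfolding hat_Int[OF u, symmetric] e by simp
qed

lemma partition_on_preimage:
  assumes S: "S \<in> \<S>" and T: "T \<in> \<S>" and f: "f \<in> bhom S T"
    and W: "partition_on T W" "finite W"
  shows "partition_on S (clopen_preimage S T f ` W - {{}})"
proof (rule partition_onI)
  have sub: "u \<subseteq> T" if "u \<in> W" for u by (rule partition_on_subset[OF W(1) that])
  note cp = clopen_preimage[OF S T f sub]
  show "\<Union>(clopen_preimage S T f ` W - {{}}) = S"
  proof (intro equalityI subsetI)
    fix x assume x: "x \<in> S"
    then have "f (pt S x) \<in> tb T" by (intro Arr_CH_in[OF f] pt_in)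
    moreover have "tb T = (\<Union>u\<in>W. hat T u)"
      using hat_Union[OF W(2) sub] W(1) hat_top[of T] by (simp add: partition_on_def)
    ultimately obtain u where u: "u \<in> W" "f (pt S x) \<in> hat T u" by auto
    then have "pt S x \<in> hat S (clopen_preimage S T f u)" using cp(2) pt_in[OF x] by simp
    then have "x \<in> clopen_preimage S T f u" using pt_hat[OF S x cp(1)] u(1) by simp
    then show "x \<in> \<Union>(clopen_preimage S T f ` W - {{}})" using u(1) by blast
  qed (use cp(1) in blast)
  fix a b assume ab: "a \<in> clopen_preimage S T f ` W - {{}}" "b \<in> clopen_preimage S T f ` W - {{}}" "a \<noteq> b"
  then obtain u v where uv: "u \<in> W" "v \<in> W" "a = clopen_preimage S T f u" "b = clopen_preimage S T f v" by blast
  have "carries S T f a u" "carries S T f b v"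
    unfolding uv(3,4) using carries_iff[OF S T f sub cp(1)] uv(1,2) by simp_all
  then have "x \<in> a \<Longrightarrow> x \<in> b \<Longrightarrow> u \<inter> v \<noteq> {}" for x using carries_disjoint[OF S] by metis
  moreover have "u \<inter> v \<noteq> {} \<Longrightarrow> u = v" using partition_on_unique[OF W(1) uv(1,2)] by blast
  ultimately show "disjnt a b" using uv(3,4) ab(3) unfolding disjnt_iff by blast
qed simp


subsection \<open>Representatives of points of \<open>Plus\<close>\<close>

definition pts :: "('u set, 'u \<Rightarrow> 'u, 'u) presheaf \<Rightarrow> 'u set \<Rightarrow> ('u set set \<times> ('u set \<Rightarrow> 'u)) set" where
  "pts F S = colim_pts (opcat (Cov S)) (prod_on_cov F)"

lemma Obj_Cov: "U \<in> Obj (Cov S) \<longleftrightarrow> finite U \<and> partition_on S U \<or> S = {} \<and> U = {{}}"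
  by (auto simp: Cov_def)

lemma mem_pts: "a \<in> pts F S \<longleftrightarrow> fst a \<in> Obj (Cov S) \<and> snd a \<in> (\<Pi>\<^sub>E u\<in>fst a. FOb F u)"
  by (cases a) (simp add: pts_def colim_pts_def opcat_def prod_on_cov_def)

text \<open>The exceptional covering \<open>{{}}\<close> of the empty set is not a partition in the
  sense of \<open>partition_on\<close>. These facts hold for both kinds of covering and spare the
  case distinction later.\<close>

lemma
  assumes "U \<in> Obj (Cov S)"
  shows Cov_finite: "finite U" and Cov_subset: "u \<in> U \<Longrightarrow> u \<subseteq> S"
    and Cov_unique: "u \<in> U \<Longrightarrow> u' \<in> U \<Longrightarrow> u \<inter> u' \<noteq> {} \<Longrightarrow> u = u'"
proof -
  consider "finite U" "partition_on S U" | "S = {}" "U = {{}}" using assms by (auto simp: Obj_Cov)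
  note cs = this
  show "finite U" using cs by cases auto
  show "u \<in> U \<Longrightarrow> u \<subseteq> S" using cs by cases (auto dest: partition_on_subset)
  show "u \<in> U \<Longrightarrow> u' \<in> U \<Longrightarrow> u \<inter> u' \<noteq> {} \<Longrightarrow> u = u'"
    using cs by cases (auto dest: partition_on_unique)
qed

text \<open>Removing the empty set affects only the exceptional covering \<open>{{}}\<close>, which
  becomes the empty covering. Every covering thus yields a finite partition fit for
  \<open>prel\<close>.\<close>

lemma Cov_partition:
  assumes "U \<in> Obj (Cov S)"
  shows "finite (U - {{}})" "partition_on S (U - {{}})"
  using assms by (auto simp: Obj_Cov partition_on_def disjoint_def)

lemma Cov_Arr_subset:
  assumes "m \<in> Arr (Cov S) V U" "v \<in> V" shows "m v \<in> U" "v \<subseteq> m v"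
proof -
  have m: "m \<in> V \<rightarrow>\<^sub>E U" "\<forall>u\<in>U. u = \<Union>{v \<in> V. m v = u}" using assms(1) by (simp_all add: Cov_def)
  show mU: "m v \<in> U" using m(1) assms(2) by auto
  then have "m v = \<Union>{v' \<in> V. m v' = m v}" by (rule bspec[OF m(2)])
  moreover have "v \<subseteq> \<Union>{v' \<in> V. m v' = m v}" using assms(2) by (intro Union_upper) simp
  ultimately show "v \<subseteq> m v" by simp
qed

text \<open>
  \<open>prel F S T f a b\<close>: the point represented by \<open>b\<close> is the pullback along \<open>f\<close> of the point
  represented by \<open>a\<close>, witnessed on a partition of \<open>S\<close> into nonempty blocks (no block at all if \<open>S\<close> is
  empty). With \<open>f\<close> the identity this is the equivalence relation defining the colimit.
\<close>

definition prel :: "('u set, 'u \<Rightarrow> 'u, 'u) presheaf \<Rightarrow> 'u set \<Rightarrow> 'u set \<Rightarrow> ('u \<Rightarrow> 'u) \<Rightarrow>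
    'u set set \<times> ('u set \<Rightarrow> 'u) \<Rightarrow> 'u set set \<times> ('u set \<Rightarrow> 'u) \<Rightarrow> bool" where
  "prel F S T f a b \<longleftrightarrow> (\<exists>W. finite W \<and> partition_on S W \<and>
     (\<forall>w\<in>W. \<exists>u\<in>fst a. \<exists>v\<in>fst b. carries S T f w u \<and> w \<subseteq> v \<and>
        FAr F u w (restricted_map S T f w u) (snd a u) = FAr F v w (incl w v) (snd b v)))"

lemma prelI:
  assumes "finite W" "partition_on S W"
    "\<And>w. w \<in> W \<Longrightarrow> \<exists>u\<in>fst a. \<exists>v\<in>fst b. carries S T f w u \<and> w \<subseteq> v \<and>
        FAr F u w (restricted_map S T f w u) (snd a u) = FAr F v w (incl w v) (snd b v)"
  shows "prel F S T f a b"
  using assms unfolding prel_def by blast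

context
  fixes F assumes F: "F \<in> Obj PB"
begin

lemma FAr_restricted_compose:
  assumes R: "R \<in> \<S>" and S: "S \<in> \<S>" and T: "T \<in> \<S>"
    and f: "f \<in> bhom S T" and g: "g \<in> bhom R S"
    and c: "carries S T f v u" and d: "carries R S g w v" and s: "s \<in> FOb F u"
  shows "FAr F u w (restricted_map R T (compose (tb R) f g) w u) s
    = FAr F v w (restricted_map R S g w v) (FAr F u v (restricted_map S T f v u) s)"
  unfolding restricted_map_compose[OF R S T f g c d]
  by (rule bs_comp[OF F _ _ _ restricted_map_Arr[OF R S g d] restricted_map_Arr[OF S T f c] s])
     (use c d subset_in[OF R] subset_in[OF S] subset_in[OF T] in \<open>auto simp: carries_def\<close>)

lemma FAr_restricted_shrink:
  assumes S: "S \<in> \<S>" and T: "T \<in> \<S>" and f: "f \<in> bhom S T"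
    and c: "carries S T f v u" and w: "w \<subseteq> v" and s: "s \<in> FOb F u"
  shows "FAr F u w (restricted_map S T f w u) s = FAr F v w (incl w v) (FAr F u v (restricted_map S T f v u) s)"
  unfolding restricted_map_shrink(2)[OF S T f c w]
proof (rule bs_comp[OF F _ _ _ incl_Arr[OF _ w] restricted_map_Arr[OF S T f c] s])
  have vu: "v \<subseteq> S" "u \<subseteq> T" using c by (auto simp: carries_def)
  show v: "v \<in> \<S>" by (rule subset_in[OF S vu(1)])
  show "v \<in> \<S>" by (rule v)
  show "u \<in> \<S>" by (rule subset_in[OF T vu(2)])
  show "w \<in> \<S>" by (rule subset_in[OF v w])
qed

lemma FAr_restricted_enlarge:
  assumes S: "S \<in> \<S>" and T: "T \<in> \<S>" and f: "f \<in> bhom S T"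
    and c: "carries S T f v u" and u: "u \<subseteq> u'" "u' \<subseteq> T" and s: "s \<in> FOb F u'"
  shows "FAr F u' v (restricted_map S T f v u') s = FAr F u v (restricted_map S T f v u) (FAr F u' u (incl u u') s)"
  unfolding restricted_map_enlarge(2)[OF S T f c u]
proof (rule bs_comp[OF F _ _ _ restricted_map_Arr[OF S T f c] incl_Arr[OF _ u(1)] s])
  have vu: "v \<subseteq> S" using c by (auto simp: carries_def)
  show "v \<in> \<S>" by (rule subset_in[OF S vu])
  show u': "u' \<in> \<S>" by (rule subset_in[OF T u(2)])
  show "u' \<in> \<S>" by (rule u')
  show "u \<in> \<S>" by (rule subset_in[OF u' u(1)])
qed

lemma FAr_incl_compose:
  assumes "w \<subseteq> v" "v \<subseteq> u" "u \<in> \<S>" "s \<in> FOb F u"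
  shows "FAr F v w (incl w v) (FAr F u v (incl v u) s) = FAr F u w (incl w u) s"
proof -
  have S: "v \<in> \<S>" "w \<in> \<S>" using assms subset_in[of u v] subset_in[of v w] by auto
  show ?thesis
    using bs_comp[OF F S(2,1) assms(3) incl_Arr[OF S(1) assms(1)] incl_Arr[OF assms(3,2)] assms(4)]
    unfolding incl_compose[OF assms(3,1,2)] by simp
qed

lemma FAr_incl_refl: "v \<in> \<S> \<Longrightarrow> s \<in> FOb F v \<Longrightarrow> FAr F v v (incl v v) s = s"
  unfolding incl_refl by (rule bs_id[OF F])

lemma pts_in: "a \<in> pts F S \<Longrightarrow> u \<in> fst a \<Longrightarrow> snd a u \<in> FOb F u"
  by (auto simp: mem_pts)

text \<open>
  Both conditions apply on the common refinement of the second partition with the preimage of the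
  first.
\<close>

lemma prel_compose:
  assumes R: "R \<in> \<S>" and S: "S \<in> \<S>" and T: "T \<in> \<S>"
    and f: "f \<in> bhom S T" and g: "g \<in> bhom R S"
    and a: "a \<in> pts F T" and b: "b \<in> pts F S" and d: "d \<in> pts F R"
    and ab: "prel F S T f a b" and bd: "prel F R S g b d"
  shows "prel F R T (compose (tb R) f g) a d"
proof -
  obtain P where P: "finite P" "partition_on S P" and Pp: "\<And>p. p \<in> P \<Longrightarrow> \<exists>u\<in>fst a. \<exists>v\<in>fst b. carries S T f p u \<and> p \<subseteq> v \<and>
      FAr F u p (restricted_map S T f p u) (snd a u) = FAr F v p (incl p v) (snd b v)"
    using ab unfolding prel_def by metis
  obtain Q where Q: "finite Q" "partition_on R Q" and Qq: "\<And>q. q \<in> Q \<Longrightarrow> \<exists>v\<in>fst b. \<exists>z\<in>fst d. carries R S g q v \<and> q \<subseteq> z \<and>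
      FAr F v q (restricted_map R S g q v) (snd b v) = FAr F z q (incl q z) (snd d z)"
    using bd unfolding prel_def by metis
  let ?P = "clopen_preimage R S g ` P - {{}}"
  let ?W = "(\<lambda>(p, q). p \<inter> q) ` (?P \<times> Q) - {{}}"
  have pP: "partition_on R ?P" by (rule partition_on_preimage[OF R S g P(2,1)])
  show ?thesis
  proof (rule prelI)
    show "finite ?W" using P(1) Q(1) by simp
    show "partition_on R ?W" by (rule partition_on_meet[OF pP Q(2)])
    fix w assume "w \<in> ?W"
    then obtain p q where p: "p \<in> P" and q: "q \<in> Q" and w: "w = clopen_preimage R S g p \<inter> q" "w \<noteq> {}" by auto
    obtain u v where uv: "u \<in> fst a" "v \<in> fst b" "carries S T f p u" "p \<subseteq> v"
      "FAr F u p (restricted_map S T f p u) (snd a u) = FAr F v p (incl p v) (snd b v)"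
      using Pp[OF p] by blast
    obtain v' z where vz: "v' \<in> fst b" "z \<in> fst d" "carries R S g q v'" "q \<subseteq> z"
      "FAr F v' q (restricted_map R S g q v') (snd b v') = FAr F z q (incl q z) (snd d z)"
      using Qq[OF q] by blast
    have Cb: "fst b \<in> Obj (Cov S)" and Cd: "fst d \<in> Obj (Cov R)" using b d by (auto simp: mem_pts)
    have vS: "v \<subseteq> S" by (rule Cov_subset[OF Cb uv(2)])
    have zR: "z \<subseteq> R" by (rule Cov_subset[OF Cd vz(2)])
    have wq: "w \<subseteq> q" using w by blast
    have pS: "p \<subseteq> S" using uv(3) by (simp add: carries_def)
    have "w \<subseteq> R" using wq vz(3) by (auto simp: carries_def)
    then have cw: "carries R S g w p" using carries_iff[OF R S g pS] w by blast
    note cwv = restricted_map_enlarge(1)[OF R S g cw uv(4) vS]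
    \<comment> \<open>Here nonemptiness of \<open>w\<close> matters: the block \<open>v\<close>
      reached through \<open>p\<close> meets the block \<open>v'\<close> reached through
      \<open>q\<close>, and blocks of one covering that meet coincide.\<close>
    obtain x where "x \<in> w" using w(2) by blast
    then have "v \<inter> v' \<noteq> {}" using carries_disjoint[OF R cwv vz(3)] wq by blast
    then have v': "v' = v" using Cov_unique[OF Cb uv(2) vz(1)] by simp
    note av = pts_in[OF a uv(1)] and bv = pts_in[OF b uv(2)] and dz = pts_in[OF d vz(2)]
    have "FAr F u w (restricted_map R T (compose (tb R) f g) w u) (snd a u)
      = FAr F p w (restricted_map R S g w p) (FAr F v p (incl p v) (snd b v))"
      unfolding FAr_restricted_compose[OF R S T f g uv(3) cw av] uv(5) ..
    also have "\<dots> = FAr F v w (restricted_map R S g w v) (snd b v)"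
      by (rule FAr_restricted_enlarge[OF R S g cw uv(4) vS bv, symmetric])
    also have "\<dots> = FAr F q w (incl w q) (FAr F z q (incl q z) (snd d z))"
      unfolding FAr_restricted_shrink[OF R S g vz(3)[unfolded v'] wq bv] vz(5)[unfolded v'] ..
    also have "\<dots> = FAr F z w (incl w z) (snd d z)"
      by (rule FAr_incl_compose[OF wq vz(4) subset_in[OF R zR] dz])
    finally show "\<exists>u\<in>fst a. \<exists>z\<in>fst d. carries R T (compose (tb R) f g) w u \<and> w \<subseteq> z \<and>
        FAr F u w (restricted_map R T (compose (tb R) f g) w u) (snd a u) = FAr F z w (incl w z) (snd d z)"
      using uv(1) vz(2) carries_compose[OF g uv(3) cw] wq vz(4) by blast
  qed
qed

lemma prel_ident_iff:
  assumes S: "S \<in> \<S>" and a: "a \<in> pts F S"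
  shows "prel F S S (ident S) a b \<longleftrightarrow> (\<exists>W. finite W \<and> partition_on S W \<and>
     (\<forall>w\<in>W. \<exists>u\<in>fst a. \<exists>v\<in>fst b. w \<subseteq> u \<and> w \<subseteq> v \<and>
        FAr F u w (incl w u) (snd a u) = FAr F v w (incl w v) (snd b v)))"
proof -
  have "u \<subseteq> S" if "u \<in> fst a" for u using Cov_subset that a by (auto simp: mem_pts)
  then have "(carries S S (ident S) w u \<and> w \<subseteq> v \<and>
        FAr F u w (restricted_map S S (ident S) w u) (snd a u) = FAr F v w (incl w v) (snd b v)) \<longleftrightarrow>
      (w \<subseteq> u \<and> w \<subseteq> v \<and> FAr F u w (incl w u) (snd a u) = FAr F v w (incl w v) (snd b v))"
    if "u \<in> fst a" for u v w
    using that carries_ident[OF S] restricted_map_ident[OF S] by auto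
  then show ?thesis unfolding prel_def by (simp cong: bex_cong)
qed

lemma prel_sym:
  assumes S: "S \<in> \<S>" and a: "a \<in> pts F S" and b: "b \<in> pts F S" and ab: "prel F S S (ident S) a b"
  shows "prel F S S (ident S) b a"
proof -
  obtain W where W: "finite W" "partition_on S W" "\<And>w. w \<in> W \<Longrightarrow> \<exists>u\<in>fst a. \<exists>v\<in>fst b. w \<subseteq> u \<and> w \<subseteq> v \<and>
        FAr F u w (incl w u) (snd a u) = FAr F v w (incl w v) (snd b v)"
    using ab unfolding prel_ident_iff[OF S a] by metis
  have "\<exists>v\<in>fst b. \<exists>u\<in>fst a. w \<subseteq> v \<and> w \<subseteq> u \<and> FAr F v w (incl w v) (snd b v) = FAr F u w (incl w u) (snd a u)"
    if "w \<in> W" for w using W(3)[OF that] by metis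
  then show ?thesis unfolding prel_ident_iff[OF S b] using W(1,2) by blast
qed

lemma prel_refl:
  assumes S: "S \<in> \<S>" and a: "a \<in> pts F S" shows "prel F S S (ident S) a a"
  unfolding prel_ident_iff[OF S a]
proof (intro exI conjI ballI)
  have U: "fst a \<in> Obj (Cov S)" using a by (simp add: mem_pts)
  show "finite (fst a - {{}})" "partition_on S (fst a - {{}})" by (rule Cov_partition[OF U])+
  fix w assume "w \<in> fst a - {{}}"
  then show "\<exists>u\<in>fst a. \<exists>v\<in>fst a. w \<subseteq> u \<and> w \<subseteq> v \<and> FAr F u w (incl w u) (snd a u) = FAr F v w (incl w v) (snd a v)"
    by blast
qed

lemma prel_trans:
  assumes S: "S \<in> \<S>" and a: "a \<in> pts F S" and b: "b \<in> pts F S" and d: "d \<in> pts F S"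
    and ab: "prel F S S (ident S) a b" and bd: "prel F S S (ident S) b d"
  shows "prel F S S (ident S) a d"
  using prel_compose[OF S S S id_Arr_CH id_Arr_CH a b d ab bd] unfolding ident_compose(1)[OF id_Arr_CH] .

text \<open>On a common refinement both restrictions equal that of the block of \<open>d\<close>
  which they share. This turns equality of pullbacks into agreement of representatives, as needed
  for injectivity in \<open>plus_products\<close>.\<close>

lemma prel_equalizer:
  assumes S: "S \<in> \<S>" and T: "T \<in> \<S>" and f: "f \<in> bhom S T"
    and a: "a \<in> pts F T" and b: "b \<in> pts F T" and d: "d \<in> pts F S"
    and ad: "prel F S T f a d" and bd: "prel F S T f b d"
  shows "\<exists>W. finite W \<and> partition_on S W \<and> (\<forall>w\<in>W. \<exists>u\<in>fst a. \<exists>v\<in>fst b. carries S T f w u \<and> carries S T f w v \<and>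
      FAr F u w (restricted_map S T f w u) (snd a u) = FAr F v w (restricted_map S T f w v) (snd b v))"
proof -
  obtain P where P: "finite P" "partition_on S P" and Pp: "\<And>p. p \<in> P \<Longrightarrow> \<exists>u\<in>fst a. \<exists>z\<in>fst d. carries S T f p u \<and> p \<subseteq> z \<and>
      FAr F u p (restricted_map S T f p u) (snd a u) = FAr F z p (incl p z) (snd d z)"
    using ad unfolding prel_def by metis
  obtain Q where Q: "finite Q" "partition_on S Q" and Qq: "\<And>q. q \<in> Q \<Longrightarrow> \<exists>v\<in>fst b. \<exists>z\<in>fst d. carries S T f q v \<and> q \<subseteq> z \<and>
      FAr F v q (restricted_map S T f q v) (snd b v) = FAr F z q (incl q z) (snd d z)"
    using bd unfolding prel_def by metis
  let ?W = "(\<lambda>(p, q). p \<inter> q) ` (P \<times> Q) - {{}}"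
  show ?thesis
  proof (intro exI[of _ ?W] conjI ballI)
    show "finite ?W" using P(1) Q(1) by simp
    show "partition_on S ?W" by (rule partition_on_meet[OF P(2) Q(2)])
    fix w assume "w \<in> ?W"
    then obtain p q where p: "p \<in> P" and q: "q \<in> Q" and w: "w = p \<inter> q" "w \<noteq> {}" by auto
    obtain u z where uz: "u \<in> fst a" "z \<in> fst d" "carries S T f p u" "p \<subseteq> z"
      "FAr F u p (restricted_map S T f p u) (snd a u) = FAr F z p (incl p z) (snd d z)"
      using Pp[OF p] by blast
    obtain v z' where vz: "v \<in> fst b" "z' \<in> fst d" "carries S T f q v" "q \<subseteq> z'"
      "FAr F v q (restricted_map S T f q v) (snd b v) = FAr F z' q (incl q z') (snd d z')"
      using Qq[OF q] by blast
    have Cd: "fst d \<in> Obj (Cov S)" using d by (simp add: mem_pts)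
    have "z \<inter> z' \<noteq> {}" using uz(4) vz(4) w by blast
    then have z': "z' = z" using Cov_unique[OF Cd uz(2) vz(2)] by simp
    have zS: "z \<in> \<S>" by (rule subset_in[OF S Cov_subset[OF Cd uz(2)]])
    have wp: "w \<subseteq> p" "w \<subseteq> q" using w by auto
    have "FAr F u w (restricted_map S T f w u) (snd a u) = FAr F z w (incl w z) (snd d z)"
      unfolding FAr_restricted_shrink[OF S T f uz(3) wp(1) pts_in[OF a uz(1)]] uz(5)
      by (rule FAr_incl_compose[OF wp(1) uz(4) zS pts_in[OF d uz(2)]])
    also have "\<dots> = FAr F v w (restricted_map S T f w v) (snd b v)"
      unfolding FAr_restricted_shrink[OF S T f vz(3) wp(2) pts_in[OF b vz(1)]] vz(5) z'
      by (rule FAr_incl_compose[OF wp(2) vz(4)[unfolded z'] zS pts_in[OF d uz(2)], symmetric])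
    finally show "\<exists>u\<in>fst a. \<exists>v\<in>fst b. carries S T f w u \<and> carries S T f w v \<and>
      FAr F u w (restricted_map S T f w u) (snd a u) = FAr F v w (restricted_map S T f w v) (snd b v)"
      using uz(1) vz(1) restricted_map_shrink(1)[OF S T f uz(3) wp(1)] restricted_map_shrink(1)[OF S T f vz(3) wp(2)]
      by blast
  qed
qed

text \<open>Overlapping pieces land in one block of \<open>a\<close>, so on a common refinement
  \<open>b\<close> and \<open>d\<close> both restrict to the pullback of the same section. Pullbacks
  are thus unique up to equivalence, which makes the action on classes well defined.\<close>

lemma prel_unique:
  assumes S: "S \<in> \<S>" and T: "T \<in> \<S>" and f: "f \<in> bhom S T"
    and a: "a \<in> pts F T" and b: "b \<in> pts F S" and d: "d \<in> pts F S"
    and ab: "prel F S T f a b" and ad: "prel F S T f a d"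
  shows "prel F S S (ident S) b d"
proof -
  obtain P where P: "finite P" "partition_on S P" and Pp: "\<And>p. p \<in> P \<Longrightarrow> \<exists>u\<in>fst a. \<exists>z\<in>fst b. carries S T f p u \<and> p \<subseteq> z \<and>
      FAr F u p (restricted_map S T f p u) (snd a u) = FAr F z p (incl p z) (snd b z)"
    using ab unfolding prel_def by metis
  obtain Q where Q: "finite Q" "partition_on S Q" and Qq: "\<And>q. q \<in> Q \<Longrightarrow> \<exists>u\<in>fst a. \<exists>z\<in>fst d. carries S T f q u \<and> q \<subseteq> z \<and>
      FAr F u q (restricted_map S T f q u) (snd a u) = FAr F z q (incl q z) (snd d z)"
    using ad unfolding prel_def by metis
  let ?W = "(\<lambda>(p, q). p \<inter> q) ` (P \<times> Q) - {{}}"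
  show ?thesis
    unfolding prel_ident_iff[OF S b]
  proof (intro exI[of _ ?W] conjI ballI)
    show "finite ?W" using P(1) Q(1) by simp
    show "partition_on S ?W" by (rule partition_on_meet[OF P(2) Q(2)])
    fix w assume "w \<in> ?W"
    then obtain p q where p: "p \<in> P" and q: "q \<in> Q" and w: "w = p \<inter> q" "w \<noteq> {}" by auto
    obtain u z where uz: "u \<in> fst a" "z \<in> fst b" "carries S T f p u" "p \<subseteq> z"
      "FAr F u p (restricted_map S T f p u) (snd a u) = FAr F z p (incl p z) (snd b z)"
      using Pp[OF p] by blast
    obtain u' y where uy: "u' \<in> fst a" "y \<in> fst d" "carries S T f q u'" "q \<subseteq> y"
      "FAr F u' q (restricted_map S T f q u') (snd a u') = FAr F y q (incl q y) (snd d y)"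
      using Qq[OF q] by blast
    have Ca: "fst a \<in> Obj (Cov T)" and Cb: "fst b \<in> Obj (Cov S)" and Cd: "fst d \<in> Obj (Cov S)"
      using a b d by (simp_all add: mem_pts)
    obtain x where "x \<in> p" "x \<in> q" using w by blast
    then have u': "u' = u" using Cov_unique[OF Ca uz(1) uy(1)] carries_disjoint[OF S uz(3) uy(3)] by simp
    have zS: "z \<in> \<S>" "y \<in> \<S>" using subset_in[OF S] Cov_subset[OF Cb uz(2)] Cov_subset[OF Cd uy(2)] by auto
    have wp: "w \<subseteq> p" "w \<subseteq> q" using w by auto
    note au = pts_in[OF a uz(1)]
    have "FAr F z w (incl w z) (snd b z) = FAr F u w (restricted_map S T f w u) (snd a u)"
      unfolding FAr_restricted_shrink[OF S T f uz(3) wp(1) au] uz(5)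
      by (rule FAr_incl_compose[OF wp(1) uz(4) zS(1) pts_in[OF b uz(2)], symmetric])
    also have "\<dots> = FAr F y w (incl w y) (snd d y)"
      unfolding FAr_restricted_shrink[OF S T f uy(3)[unfolded u'] wp(2) au] uy(5)[unfolded u']
      by (rule FAr_incl_compose[OF wp(2) uy(4) zS(2) pts_in[OF d uy(2)]])
    finally show "\<exists>z\<in>fst b. \<exists>y\<in>fst d. w \<subseteq> z \<and> w \<subseteq> y \<and> FAr F z w (incl w z) (snd b z) = FAr F y w (incl w y) (snd d y)"
      using subset_trans[OF wp(1) uz(4)] subset_trans[OF wp(2) uy(4)]
      by (intro bexI[OF _ uz(2)] bexI[OF _ uy(2)] conjI)
  qed
qed

section \<open>The colimit relation as agreement on a finite partition\<close>

abbreviation "crel S \<equiv> colim_rel (opcat (Cov S)) (prod_on_cov F)"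

definition cstep :: "'u set \<Rightarrow> ('u set set \<times> ('u set \<Rightarrow> 'u)) rel" where
  "cstep S = {(a, b). fst a \<in> Obj (Cov S) \<and> fst b \<in> Obj (Cov S) \<and> snd a \<in> FOb (prod_on_cov F) (fst a) \<and>
     (\<exists>m \<in> Arr (Cov S) (fst b) (fst a). snd b = FAr (prod_on_cov F) (fst a) (fst b) m (snd a))}"

lemma crel_def: "crel S = (cstep S \<union> (cstep S)\<inverse>)\<^sup>*"
proof -
  have "{((j, x), (k, y)). j \<in> Obj (opcat (Cov S)) \<and> k \<in> Obj (opcat (Cov S)) \<and> x \<in> FOb (prod_on_cov F) j \<and>
      (\<exists>m \<in> Arr (opcat (Cov S)) j k. y = FAr (prod_on_cov F) j k m x)} = cstep S"
    by (auto simp: cstep_def opcat_def)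
  then show ?thesis unfolding colim_rel_def Let_def by simp
qed

lemma cstep_prel:
  assumes S: "S \<in> \<S>" and ab: "(a, b) \<in> cstep S"
  shows "a \<in> pts F S \<and> b \<in> pts F S \<and> prel F S S (ident S) a b"
proof -
  obtain m where m: "m \<in> Arr (Cov S) (fst b) (fst a)" "snd b = FAr (prod_on_cov F) (fst a) (fst b) m (snd a)"
    and C: "fst a \<in> Obj (Cov S)" "fst b \<in> Obj (Cov S)" and sa: "snd a \<in> (\<Pi>\<^sub>E u\<in>fst a. FOb F u)"
    using ab unfolding cstep_def by (auto simp: prod_on_cov_def)
  have sb: "snd b = (\<lambda>v\<in>fst b. FAr F (m v) v (incl v (m v)) (snd a (m v)))"
    using m(2) sa by (simp add: prod_on_cov_def)
  note mv = Cov_Arr_subset[OF m(1)]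
  have mS: "m v \<in> \<S>" "v \<in> \<S>" if "v \<in> fst b" for v
    using subset_in[OF S Cov_subset[OF C(1) mv(1)[OF that]]] subset_in[OF S Cov_subset[OF C(2) that]] .
  have sam: "snd a (m v) \<in> FOb F (m v)" if "v \<in> fst b" for v using sa mv(1)[OF that] by auto
  have b_in: "FAr F (m v) v (incl v (m v)) (snd a (m v)) \<in> FOb F v" if v: "v \<in> fst b" for v
    by (rule bs_in[OF F mS(2)[OF v] mS(1)[OF v] incl_Arr[OF mS(1)[OF v] mv(2)[OF v]] sam[OF v]])
  have a: "a \<in> pts F S" using C sa by (simp add: mem_pts)
  have b: "b \<in> pts F S" using C b_in by (simp add: mem_pts sb)
  have "prel F S S (ident S) a b"
    unfolding prel_ident_iff[OF S a]
  proof (intro exI conjI ballI)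
    show "finite (fst b - {{}})" "partition_on S (fst b - {{}})" by (rule Cov_partition[OF C(2)])+
    fix w assume w: "w \<in> fst b - {{}}"
    then have "FAr F (m w) w (incl w (m w)) (snd a (m w)) = FAr F w w (incl w w) (snd b w)"
      using FAr_incl_refl[OF mS(2) b_in] by (simp add: sb)
    then show "\<exists>u\<in>fst a. \<exists>v\<in>fst b. w \<subseteq> u \<and> w \<subseteq> v \<and> FAr F u w (incl w u) (snd a u) = FAr F v w (incl w v) (snd b v)"
      using mv w by blast
  qed
  then show ?thesis using a b by blast
qed

lemma crel_prel:
  assumes S: "S \<in> \<S>" and a: "a \<in> pts F S" and ab: "(a, b) \<in> crel S"
  shows "b \<in> pts F S \<and> prel F S S (ident S) a b"
  using ab unfolding crel_def
proof (induction rule: rtrancl_induct)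
  case base
  show ?case using a prel_refl[OF S a] by blast
next
  case (step y z)
  then have "(y, z) \<in> cstep S \<or> (z, y) \<in> cstep S" by blast
  then have yz: "z \<in> pts F S" "prel F S S (ident S) y z"
    using cstep_prel[OF S, of y z] cstep_prel[OF S, of z y] prel_sym[OF S, of z y] by auto
  then show ?case using prel_trans[OF S a _ yz(1) _ yz(2)] step.IH by blast
qed

text \<open>Sending each \<open>w\<close> to a block containing it is automatically a morphism of
  coverings: a \<open>w\<close> that meets a block \<open>u\<close> can only be sent to
  \<open>u\<close>, so the pieces over \<open>u\<close> exhaust it.\<close>

lemma cstep_refine:
  assumes S: "S \<in> \<S>" and a: "a \<in> pts F S" and W: "finite W" "partition_on S W"
    and t: "\<And>w. w \<in> W \<Longrightarrow> \<exists>u\<in>fst a. w \<subseteq> u \<and> t w = FAr F u w (incl w u) (snd a u)"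
  shows "(a, (W, restrict t W)) \<in> cstep S"
proof -
  have C: "fst a \<in> Obj (Cov S)" "W \<in> Obj (Cov S)" and sa: "snd a \<in> (\<Pi>\<^sub>E u\<in>fst a. FOb F u)"
    using a W by (auto simp: mem_pts Obj_Cov)
  obtain m where m: "\<And>w. w \<in> W \<Longrightarrow> m w \<in> fst a \<and> w \<subseteq> m w \<and> t w = FAr F (m w) w (incl w (m w)) (snd a (m w))"
    using t by metis
  have "restrict m W \<in> Arr (Cov S) W (fst a)"
  proof -
    have "u = \<Union>{v \<in> W. restrict m W v = u}" if u: "u \<in> fst a" for u
    proof (intro equalityI subsetI)
      fix x assume x: "x \<in> u"
      then have "x \<in> S" using Cov_subset[OF C(1) u] by blast
      then obtain w where w: "w \<in> W" "x \<in> w" using W(2) unfolding partition_on_def by blast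
      then have "m w \<inter> u \<noteq> {}" using m x by blast
      then have "m w = u" using Cov_unique[OF C(1)] m[OF w(1)] u by blast
      then show "x \<in> \<Union>{v \<in> W. restrict m W v = u}" using w by auto
    next
      fix x assume "x \<in> \<Union>{v \<in> W. restrict m W v = u}"
      then obtain w where "w \<in> W" "m w = u" "x \<in> w" by auto
      then show "x \<in> u" using m by blast
    qed
    then show ?thesis using m by (simp add: Cov_def)
  qed
  moreover have "restrict t W = FAr (prod_on_cov F) (fst a) W (restrict m W) (snd a)"
    using sa m by (auto simp: prod_on_cov_def)
  moreover have "snd a \<in> FOb (prod_on_cov F) (fst a)" using sa by (simp add: prod_on_cov_def)
  ultimately show ?thesis unfolding cstep_def using C by auto
qed

text \<open>Agreement on a partition yields one representative, made of the common values, which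
  \<open>a\<close> and \<open>b\<close> both reach in a single step. Zigzags of length two thus
  suffice; this is where filteredness of the coverings enters.\<close>

lemma crel_iff:
  assumes S: "S \<in> \<S>" and a: "a \<in> pts F S" and b: "b \<in> pts F S"
  shows "(a, b) \<in> crel S \<longleftrightarrow> prel F S S (ident S) a b"
proof
  assume "prel F S S (ident S) a b"
  then obtain W where W: "finite W" "partition_on S W" "\<And>w. w \<in> W \<Longrightarrow> \<exists>u\<in>fst a. \<exists>v\<in>fst b. w \<subseteq> u \<and> w \<subseteq> v \<and>
        FAr F u w (incl w u) (snd a u) = FAr F v w (incl w v) (snd b v)"
    unfolding prel_ident_iff[OF S a] by metis
  then have "\<forall>w\<in>W. \<exists>x. (\<exists>u\<in>fst a. w \<subseteq> u \<and> x = FAr F u w (incl w u) (snd a u)) \<and>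
      (\<exists>v\<in>fst b. w \<subseteq> v \<and> x = FAr F v w (incl w v) (snd b v))"
    by blast
  from bchoice[OF this] obtain t where t: "\<forall>w\<in>W. (\<exists>u\<in>fst a. w \<subseteq> u \<and> t w = FAr F u w (incl w u) (snd a u)) \<and>
      (\<exists>v\<in>fst b. w \<subseteq> v \<and> t w = FAr F v w (incl w v) (snd b v))" by (rule exE)
  have "(a, (W, restrict t W)) \<in> cstep S" "(b, (W, restrict t W)) \<in> cstep S"
    using cstep_refine[OF S a W(1,2), of t] cstep_refine[OF S b W(1,2), of t] t by blast+
  then have "(a, (W, restrict t W)) \<in> crel S" "((W, restrict t W), b) \<in> crel S"
    unfolding crel_def by blast+
  then show "(a, b) \<in> crel S" unfolding crel_def by (rule rtrancl_trans)
qed (use crel_prel[OF S a] in blast)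

lemma crel_class:
  assumes S: "S \<in> \<S>" and a: "a \<in> pts F S"
  shows "crel S `` {a} = {b \<in> pts F S. prel F S S (ident S) a b}"
  using crel_prel[OF S a] crel_iff[OF S a] by auto

lemma crel_class_eq_iff:
  assumes S: "S \<in> \<S>" and a: "a \<in> pts F S" and b: "b \<in> pts F S"
  shows "crel S `` {a} = crel S `` {b} \<longleftrightarrow> prel F S S (ident S) a b"
proof
  assume eq: "crel S `` {a} = crel S `` {b}"
  have "b \<in> crel S `` {b}" unfolding crel_class[OF S b] using b prel_refl[OF S b] by simp
  then have "b \<in> crel S `` {a}" unfolding eq .
  then show "prel F S S (ident S) a b" unfolding crel_class[OF S a] by simp
next
  assume ab: "prel F S S (ident S) a b"
  have ba: "prel F S S (ident S) b a" by (rule prel_sym[OF S a b ab])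
  show "crel S `` {a} = crel S `` {b}"
    unfolding crel_class[OF S a] crel_class[OF S b]
    using prel_trans[OF S a b _ ab] prel_trans[OF S b a _ ba] by blast
qed

lemma plus_colim_eq: "plus_colim F S = (\<lambda>a. crel S `` {a}) ` pts F S"
  by (auto simp: plus_colim_def colim_def quotient_def pts_def)

text \<open>
  Every \<open>\<beta>u\<close> with \<open>u \<noteq> {}\<close> is a retract of \<open>\<beta>S\<close>, so \<open>F(\<beta>u)\<close> embeds into \<open>F(\<beta>S)\<close>; this bounds the
  number of representatives although the universe need not be closed under families of sets.
\<close>

lemma small_pts:
  assumes S: "S \<in> \<S>" "S \<noteq> {}" shows "small \<S> (pts F S)"
proof -
  define r where "r u x = (if x \<in> u then x else (SOME y. y \<in> u))" for u and x :: 'u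
  define e where "e u s = FAr F u S (beta_map S u (r u)) s" for u s
  have ne: "u \<noteq> {}" "u \<subseteq> S" if "U \<in> Obj (Cov S)" "u \<in> U" for u U
    using that S(2) partition_on_nonempty[of S U u] partition_on_subset[of S U u] by (auto simp: Obj_Cov)
  have r: "r u \<in> S \<rightarrow> u" if "u \<noteq> {}" for u using that some_in_eq[of u] by (auto simp: r_def)
  have e_in: "e u s \<in> FOb F S" and e_inv: "FAr F S u (incl u S) (e u s) = s" if u: "u \<noteq> {}" "u \<subseteq> S" and s: "s \<in> FOb F u" for u s
  proof -
    have uS: "u \<in> \<S>" by (rule subset_in[OF S(1) u(2)])
    note b = beta_map_Arr[OF S(1) uS r[OF u(1)]] and i = incl_Arr[OF S(1) u(2)]
    show "e u s \<in> FOb F S" unfolding e_def by (rule bs_in[OF F S(1) uS b s])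
    have "compose (tb u) (beta_map S u (r u)) (incl u S) = beta_map u u (\<lambda>x. r u x)"
      by (rule beta_map_compose[OF uS S(1) uS _ r[OF u(1)]]) (use u in auto)
    also have "\<dots> = ident u" by (rule beta_map_id[OF uS]) (simp add: r_def)
    finally show "FAr F S u (incl u S) (e u s) = s"
      unfolding e_def using bs_comp[OF F uS S(1) uS i b s] bs_id[OF F uS s] by simp
  qed
  show ?thesis
  proof (rule small_inj_on)
    show "small \<S> (Pow (Pow S \<times> FOb F S))"
      using psh_ob[OF F] S(1) by (intro small_Pow small_Times small_in) simp_all
    \<comment> \<open>A representative is recorded by its graph, with each section replaced by its
      image in F(\<beta>S); restriction to the block recovers the section.\<close>
    show "inj_on (\<lambda>a. (\<lambda>u. (u, e u (snd a u))) ` fst a) (pts F S)"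
    proof (rule inj_onI)
      fix a b assume a: "a \<in> pts F S" and b: "b \<in> pts F S"
        and eq: "(\<lambda>u. (u, e u (snd a u))) ` fst a = (\<lambda>u. (u, e u (snd b u))) ` fst b"
      have U: "fst a = fst b" using arg_cong[OF eq, of "\<lambda>X. fst ` X"] by (simp add: image_image)
      have "snd a = snd b"
      proof (rule extensionalityI)
        show "snd a \<in> extensional (fst a)" "snd b \<in> extensional (fst a)"
          using a b U by (auto simp: mem_pts PiE_def)
        fix u assume u: "u \<in> fst a"
        have Ca: "fst a \<in> Obj (Cov S)" using a by (simp add: mem_pts)
        have "(u, e u (snd a u)) \<in> (\<lambda>u. (u, e u (snd b u))) ` fst b" using eq u by blast
        then have ee: "e u (snd a u) = e u (snd b u)" by blast
        show "snd a u = snd b u"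
          using e_inv[OF ne[OF Ca u] pts_in[OF a u]] e_inv[OF ne[OF Ca u] pts_in[OF b u[unfolded U]]]
          unfolding ee by (rule trans[OF sym])
      qed
      then show "a = b" using U by (simp add: prod_eq_iff)
    qed
    fix a assume a: "a \<in> pts F S"
    then have Ca: "fst a \<in> Obj (Cov S)" by (simp add: mem_pts)
    show "(\<lambda>u. (u, e u (snd a u))) ` fst a \<in> Pow (Pow S \<times> FOb F S)"
      using e_in[OF ne[OF Ca] pts_in[OF a]] ne(2)[OF Ca] by auto
  qed
qed

text \<open>The retraction bound covers nonempty \<open>S\<close>. For empty \<open>S\<close> the
  partition without blocks relates any two representatives, so the colimit is a single point, which
  is the effect of admitting the empty covering.\<close>

lemma small_plus_colim:
  assumes S: "S \<in> \<S>" shows "small \<S> (plus_colim F S)"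
proof (cases "S = {}")
  case False
  then show ?thesis unfolding plus_colim_eq by (intro small_image small_pts S)
next
  case True
  have "prel F S S (ident S) a b" for a b
    by (rule prelI[of "{}"]) (simp_all add: True partition_on_empty)
  then have eq: "crel S `` {a} = crel S `` {b}" if "a \<in> pts F S" "b \<in> pts F S" for a b
    using crel_class_eq_iff[OF S that] by simp
  have "({}, \<lambda>u. undefined) \<in> pts F S" by (simp add: mem_pts Obj_Cov True partition_on_empty)
  then have "plus_colim F S \<subseteq> {crel S `` {({}, \<lambda>u. undefined)}}"
    unfolding plus_colim_eq by (intro image_subsetI, subst singleton_iff) (rule eq)
  then show ?thesis by (rule small_subset[OF small_singleton])
qed


subsection \<open>The presheaf \<open>Plus\<close>\<close>

lemma plus_class_eq_iff:
  assumes S: "S \<in> \<S>" and a: "a \<in> pts F S" and b: "b \<in> pts F S"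
  shows "plus_class F S a = plus_class F S b \<longleftrightarrow> prel F S S (ident S) a b"
proof -
  have "plus_class F S a = plus_class F S b \<longleftrightarrow> crel S `` {a} = crel S `` {b}"
    unfolding plus_class_def
    by (rule inj_on_eq_iff[OF inj_on_enc[OF small_plus_colim[OF S]]]) (use a b in \<open>auto simp: plus_colim_eq\<close>)
  then show ?thesis using crel_class_eq_iff[OF S a b] by simp
qed

lemma FOb_plus_ob: "FOb (plus_ob F) S = plus_class F S ` pts F S"
  by (simp add: plus_ob_def plus_colim_eq plus_class_def image_image)

lemma plus_lift_class:
  assumes S: "S \<in> \<S>" and a: "a \<in> pts F S"
    and h: "\<And>b. b \<in> pts F S \<Longrightarrow> prel F S S (ident S) a b \<Longrightarrow> h b = h a"
  shows "plus_lift F S h (plus_class F S a) = h a"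
proof -
  have ca: "crel S `` {a} \<in> plus_colim F S" using a by (simp add: plus_colim_eq)
  have "h ` (crel S `` {a}) = {h a}"
    unfolding crel_class[OF S a]
  proof (intro equalityI subsetI)
    fix y assume "y \<in> h ` {b \<in> pts F S. prel F S S (ident S) a b}"
    then obtain b where "b \<in> pts F S" "prel F S S (ident S) a b" "y = h b" by blast
    then show "y \<in> {h a}" using h by simp
  qed (use a prel_refl[OF S a] in blast)
  then show ?thesis
    using ca by (simp add: plus_lift_def plus_class_def dec_enc[OF small_plus_colim[OF S]])
qed

text \<open>The definite description in \<open>section_preimage\<close> finds the right block: a
  nonempty preimage comes from exactly one block, since two blocks with a common preimage point
  meet.\<close>

lemma
  assumes S: "S \<in> \<S>" and T: "T \<in> \<S>" and f: "f \<in> bhom S T" and a: "a \<in> pts F T"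
  shows pullback_pts: "(cov_preimage S T f (fst a), section_preimage F S T f (fst a) (snd a)) \<in> pts F S"
    and pullback_prel: "prel F S T f a (cov_preimage S T f (fst a), section_preimage F S T f (fst a) (snd a))"
proof -
  let ?U = "fst a" and ?V = "cov_preimage S T f (fst a)" and ?t = "section_preimage F S T f (fst a) (snd a)"
  let ?cp = "clopen_preimage S T f"
  have C: "?U \<in> Obj (Cov T)" using a by (simp add: mem_pts)
  note cp = clopen_preimage[OF S T f Cov_subset[OF C]]
  have cp_empty: "?cp {} = {}"
  proof -
    have "hat S (?cp {}) = hat S {}" using clopen_preimage(2)[OF S T f, of "{}"] by simp
    then show ?thesis using hat_eqD[OF S clopen_preimage(1)[OF S T f]] by simp
  qed
  have V: "?V = ?cp ` (?U - {{}}) - {{}}" unfolding cov_preimage_def using cp_empty by auto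
  have fin: "finite ?V" and part: "partition_on S ?V"
    unfolding V using partition_on_preimage[OF S T f Cov_partition(2,1)[OF C]] Cov_finite[OF C] by simp_all
  have car: "carries S T f (?cp u) u" if "u \<in> ?U" for u
    using carries_iff[OF S T f Cov_subset[OF C that] cp(1)[OF that]] by simp
  have t: "?t v = FAr F u v (restricted_map S T f v u) (snd a u)" if v: "v \<in> ?V" and u: "u \<in> ?U" "?cp u = v" for u v
  proof -
    have "(THE u. u \<in> ?U \<and> ?cp u = v) = u"
    proof (rule the_equality)
      fix u' assume u': "u' \<in> ?U \<and> ?cp u' = v"
      have "v \<noteq> {}" using v by (simp add: cov_preimage_def)
      then obtain x where "x \<in> v" by blast
      then have "u' \<inter> u \<noteq> {}"
        using carries_disjoint[OF S car car, of u' u x] u u' by simp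
      then show "u' = u" using Cov_unique[OF C] u u' by blast
    qed (use u in simp)
    then show ?thesis using v by (simp add: section_preimage_def Let_def)
  qed
  have S': "u \<in> \<S>" "?cp u \<in> \<S>" if "u \<in> ?U" for u
    using subset_in[OF T Cov_subset[OF C that]] subset_in[OF S cp(1)[OF that]] .
  have t_in: "?t v \<in> FOb F v" if v: "v \<in> ?V" for v
  proof -
    obtain u where u: "u \<in> ?U" "?cp u = v" using v by (auto simp: cov_preimage_def)
    show ?thesis
      unfolding t[OF v u] using bs_in[OF F S'(2,1)[OF u(1)] restricted_map_Arr[OF S T f car[OF u(1)]] pts_in[OF a u(1)]]
      by (simp add: u(2))
  qed
  show "(?V, ?t) \<in> pts F S"
    using fin part t_in by (simp add: mem_pts Obj_Cov PiE_iff section_preimage_def)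
  show "prel F S T f a (?V, ?t)"
  proof (rule prelI[OF fin part])
    fix v assume v: "v \<in> ?V"
    then obtain u where u: "u \<in> ?U" "?cp u = v" by (auto simp: cov_preimage_def)
    have "FAr F v v (incl v v) (?t v) = ?t v"
      by (rule FAr_incl_refl[OF _ t_in[OF v]]) (use S'(2) u in auto)
    then show "\<exists>u\<in>fst a. \<exists>z\<in>fst (?V, ?t). carries S T f v u \<and> v \<subseteq> z \<and>
        FAr F u v (restricted_map S T f v u) (snd a u) = FAr F z v (incl v z) (snd (?V, ?t) z)"
      using u v car[OF u(1)] t[OF v u] by (intro bexI[of _ u] bexI[of _ v]) auto
  qed
qed

text \<open>Any \<open>b\<close> related to \<open>a\<close> computes the value, because pullbacks
  are unique up to equivalence. Later proofs choose a convenient representative instead of the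
  preimage covering.\<close>

lemma plus_ob_FAr:
  assumes S: "S \<in> \<S>" and T: "T \<in> \<S>" and f: "f \<in> bhom S T"
    and a: "a \<in> pts F T" and b: "b \<in> pts F S" and ab: "prel F S T f a b"
  shows "FAr (plus_ob F) T S f (plus_class F T a) = plus_class F S b"
proof -
  let ?p = "\<lambda>a. (cov_preimage S T f (fst a), section_preimage F S T f (fst a) (snd a))"
  note p = pullback_pts[OF S T f] and q = pullback_prel[OF S T f]
  have "FAr (plus_ob F) T S f (plus_class F T a) = plus_lift F T (\<lambda>a. plus_class F S (?p a)) (plus_class F T a)"
    by (simp add: plus_ob_def case_prod_unfold)
  also have "\<dots> = plus_class F S (?p a)"
  proof (rule plus_lift_class[OF T a])
    fix a' assume a': "a' \<in> pts F T" and aa': "prel F T T (ident T) a a'"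
    have "prel F S T (compose (tb S) (ident T) f) a (?p a')"
      by (rule prel_compose[OF S T T id_Arr_CH f a a' p[OF a'] aa' q[OF a']])
    then have "prel F S T f a (?p a')" unfolding ident_compose(2)[OF f] .
    then show "plus_class F S (?p a') = plus_class F S (?p a)"
      using plus_class_eq_iff[OF S p[OF a'] p[OF a]] prel_unique[OF S T f a p[OF a'] p[OF a] _ q[OF a]] by simp
  qed
  also have "\<dots> = plus_class F S b"
    using plus_class_eq_iff[OF S p[OF a] b] prel_unique[OF S T f a p[OF a] b q[OF a] ab] by simp
  finally show ?thesis .
qed

lemma plus_ob_FAr_pullback:
  assumes S: "S \<in> \<S>" and T: "T \<in> \<S>" and f: "f \<in> bhom S T" and a: "a \<in> pts F T"
  obtains b where "b \<in> pts F S" "prel F S T f a b" "FAr (plus_ob F) T S f (plus_class F T a) = plus_class F S b"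
  using pullback_pts[OF assms] pullback_prel[OF assms] plus_ob_FAr[OF assms] by blast

lemma plus_ob_PB: "plus_ob F \<in> Obj PB"
proof (rule PB_ObjI)
  fix S assume "S \<in> \<S>"
  then show "FOb (plus_ob F) S \<in> \<S>"
    unfolding plus_ob_def ftor.simps by (intro enc_image_in small_plus_colim)
next
  fix R T f assume *: "R \<in> \<S>" "T \<in> \<S>" "f \<in> bhom R T"
  have "FAr (plus_ob F) T R f x \<in> FOb (plus_ob F) R" if x: "x \<in> FOb (plus_ob F) T" for x
  proof -
    obtain a where a: "a \<in> pts F T" "x = plus_class F T a" using x unfolding FOb_plus_ob by blast
    obtain b where "b \<in> pts F R" "FAr (plus_ob F) T R f (plus_class F T a) = plus_class F R b"
      using plus_ob_FAr_pullback[OF * a(1)] by metis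
    then show ?thesis using a(2) by (simp add: FOb_plus_ob)
  qed
  moreover have "FAr (plus_ob F) T R f \<in> extensional (FOb (plus_ob F) T)"
    by (simp add: plus_ob_def plus_lift_def)
  ultimately show "FAr (plus_ob F) T R f \<in> FOb (plus_ob F) T \<rightarrow>\<^sub>E FOb (plus_ob F) R" by (simp add: PiE_iff)
next
  fix S x assume S: "S \<in> \<S>" and "x \<in> FOb (plus_ob F) S"
  then obtain a where a: "a \<in> pts F S" "x = plus_class F S a" unfolding FOb_plus_ob by blast
  show "FAr (plus_ob F) S S (ident S) x = x"
    unfolding a(2) by (rule plus_ob_FAr[OF S S id_Arr_CH a(1) a(1) prel_refl[OF S a(1)]])
next
  fix R S T f g x
  assume *: "R \<in> \<S>" "S \<in> \<S>" "T \<in> \<S>" "f \<in> bhom R S" "g \<in> bhom S T"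
    and "x \<in> FOb (plus_ob F) T"
  then obtain a where a: "a \<in> pts F T" "x = plus_class F T a" unfolding FOb_plus_ob by blast
  obtain b where b: "b \<in> pts F S" "prel F S T g a b" "FAr (plus_ob F) T S g (plus_class F T a) = plus_class F S b"
    by (rule plus_ob_FAr_pullback[OF *(2,3,5) a(1)])
  obtain d where d: "d \<in> pts F R" "prel F R S f b d" "FAr (plus_ob F) S R f (plus_class F S b) = plus_class F R d"
    by (rule plus_ob_FAr_pullback[OF *(1,2,4) b(1)])
  show "FAr (plus_ob F) T R (compose (tb R) g f) x = FAr (plus_ob F) S R f (FAr (plus_ob F) T S g x)"
    unfolding a(2) b(3) d(3)
    by (rule plus_ob_FAr[OF *(1,3) compose_Arr_CH[OF *(4,5)] a(1) d(1)
          prel_compose[OF *(1,2,3,5,4) a(1) b(1) d(1) b(2) d(2)]])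
qed

end

end


subsection \<open>\<open>Plus\<close> preserves products\<close>

context small_sets
begin

text \<open>The images of an abstract coproduct are clopen by \<open>BS_coproductD\<close>, hence of
  the form \<beta>Q_i for subsets Q_i of \<open>c\<close>. The factorisations \<open>\<rho>\<close>
  and \<open>\<tau>\<close> compare \<beta>S_i with \<beta>Q_i over \<beta>c, and the bijection is
  transported along them.\<close>

lemma products_from_subsets:
  assumes F: "F \<in> Obj PB"
    and bij: "\<And>(I :: nat set) Q c. finite I \<Longrightarrow> c \<in> \<S> \<Longrightarrow> (\<And>i. i \<in> I \<Longrightarrow> Q i \<subseteq> c) \<Longrightarrow>
      (\<And>i j. i \<in> I \<Longrightarrow> j \<in> I \<Longrightarrow> i \<noteq> j \<Longrightarrow> Q i \<inter> Q j = {}) \<Longrightarrow> c = (\<Union>i\<in>I. Q i) \<Longrightarrow>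
      bij_betw (\<lambda>s. \<lambda>i\<in>I. FAr F c (Q i) (incl (Q i) c) s) (FOb F c) (\<Pi>\<^sub>E i\<in>I. FOb F (Q i))"
  shows "coproducts_to_products BS F"
  unfolding coproducts_to_products_def
proof (intro allI impI)
  fix I :: "nat set" and S c \<iota> assume I: "finite I" and cop: "is_coproduct BS I S c \<iota>"
  have c: "c \<in> \<S>" and S: "\<And>i. i \<in> I \<Longrightarrow> S i \<in> \<S>"
    and \<iota>: "\<And>i. i \<in> I \<Longrightarrow> \<iota> i \<in> bhom (S i) c"
    using cop unfolding is_coproduct_def Arr_BS Obj_BS by auto
  note copD = BS_coproductD[OF I cop]
  define K where "K i = \<iota> i ` tb (S i)" for i
  have clK: "closedin (beta c) (K i)" if "i \<in> I" for i
    unfolding K_def by (rule CH_closed_image[OF beta_in_CHaus[OF S[OF that]] beta_in_CHaus[OF c] \<iota>[OF that]])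
  have disjK: "K i \<inter> K j = {}" if "i \<in> I" "j \<in> I" "i \<noteq> j" for i j
    using copD(2)[OF that(1,2)] that(3) unfolding K_def by blast
  have coverK: "tb c = (\<Union>i\<in>I. K i)" unfolding K_def by (rule copD(3))
  have opK: "openin (beta c) (K i)" if i: "i \<in> I" for i
    by (rule openin_closed_piece[OF I clK _ coverK i]) (use disjK i in auto)
  define Q where "Q i = {x \<in> c. pt c x \<in> K i}" for i
  have KQ: "K i = hat c (Q i)" if "i \<in> I" for i
    unfolding Q_def by (rule clopen_is_hat[OF c opK[OF that] clK[OF that]])
  have Qc: "Q i \<subseteq> c" for i by (auto simp: Q_def)
  have QS: "Q i \<in> \<S>" for i by (rule subset_in[OF c Qc])
  have disjQ: "Q i \<inter> Q j = {}" if "i \<in> I" "j \<in> I" "i \<noteq> j" for i j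
    using disjK[OF that] by (auto simp: Q_def)
  have coverQ: "c = (\<Union>i\<in>I. Q i)"
    using coverK pt_in[of _ c] by (auto simp: Q_def)
  have bQ: "bij_betw (\<lambda>s. \<lambda>i\<in>I. FAr F c (Q i) (incl (Q i) c) s) (FOb F c) (\<Pi>\<^sub>E i\<in>I. FOb F (Q i))"
    using I c Qc disjQ coverQ by (rule bij)
  note i_arr = incl_Arr[OF c Qc] and i_inj = incl_inj[OF c Qc] and i_im = incl_image[OF c Qc]
  have "\<exists>\<rho>\<in>bhom (Q i) (S i). compose (tb (Q i)) (\<iota> i) \<rho> = incl (Q i) c" if i: "i \<in> I" for i
    by (rule CH_factor[OF beta_in_CHaus[OF S[OF i]] beta_in_CHaus[OF c] \<iota>[OF i] copD(1)[OF i] i_arr])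
       (simp add: i_im KQ[OF i, symmetric] K_def)
  then obtain \<rho> where \<rho>: "\<And>i. i \<in> I \<Longrightarrow> \<rho> i \<in> bhom (Q i) (S i)"
    "\<And>i. i \<in> I \<Longrightarrow> compose (tb (Q i)) (\<iota> i) (\<rho> i) = incl (Q i) c" by metis
  have "\<exists>\<tau>\<in>bhom (S i) (Q i). compose (tb (S i)) (incl (Q i) c) \<tau> = \<iota> i" if i: "i \<in> I" for i
    by (rule CH_factor[OF beta_in_CHaus[OF QS] beta_in_CHaus[OF c] i_arr i_inj \<iota>[OF i]])
       (simp add: i_im KQ[OF i, symmetric] K_def)
  then obtain \<tau> where \<tau>: "\<And>i. i \<in> I \<Longrightarrow> \<tau> i \<in> bhom (S i) (Q i)"
    "\<And>i. i \<in> I \<Longrightarrow> compose (tb (S i)) (incl (Q i) c) (\<tau> i) = \<iota> i" by metis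
  have \<rho>\<tau>: "compose (tb (S i)) (\<rho> i) (\<tau> i) = ident (S i)" if i: "i \<in> I" for i
  proof (rule Arr_CH_eqI[OF compose_Arr_CH[OF \<tau>(1)[OF i] \<rho>(1)[OF i]] id_Arr_CH])
    fix p assume p: "p \<in> tb (S i)"
    note tp = Arr_CH_in[OF \<tau>(1)[OF i] p]
    have "\<iota> i (\<rho> i (\<tau> i p)) = \<iota> i p"
      using fun_cong[OF \<rho>(2)[OF i], of "\<tau> i p"] fun_cong[OF \<tau>(2)[OF i], of p] p tp by (simp add: compose_eq)
    then show "compose (tb (S i)) (\<rho> i) (\<tau> i) p = ident (S i) p"
      using inj_onD[OF copD(1)[OF i], of "\<rho> i (\<tau> i p)" p] Arr_CH_in[OF \<rho>(1)[OF i] tp] p by (simp add: compose_eq)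
  qed
  have f\<rho>: "FAr F (S i) (Q i) (\<rho> i) (FAr F c (S i) (\<iota> i) s) = FAr F c (Q i) (incl (Q i) c) s"
    if "i \<in> I" "s \<in> FOb F c" for i s
    using bs_comp[OF F QS S[OF that(1)] c \<rho>(1)[OF that(1)] \<iota>[OF that(1)] that(2)] \<rho>(2)[OF that(1)] by simp
  have f\<tau>: "FAr F (Q i) (S i) (\<tau> i) (FAr F c (Q i) (incl (Q i) c) s) = FAr F c (S i) (\<iota> i) s"
    if "i \<in> I" "s \<in> FOb F c" for i s
    using bs_comp[OF F S[OF that(1)] QS c \<tau>(1)[OF that(1)] i_arr that(2)] \<tau>(2)[OF that(1)] by simp
  have f\<tau>\<rho>: "FAr F (Q i) (S i) (\<tau> i) (FAr F (S i) (Q i) (\<rho> i) t) = t" if "i \<in> I" "t \<in> FOb F (S i)" for i t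
    using bs_comp[OF F S[OF that(1)] QS S[OF that(1)] \<tau>(1)[OF that(1)] \<rho>(1)[OF that(1)] that(2)]
      \<rho>\<tau>[OF that(1)] bs_id[OF F S[OF that(1)] that(2)] by simp
  let ?g = "\<lambda>s. \<lambda>i\<in>I. FAr F c (Q i) (incl (Q i) c) s" and ?h = "\<lambda>s. \<lambda>i\<in>I. FAr F c (S i) (\<iota> i) s"
  show "bij_betw ?h (FOb F c) (\<Pi>\<^sub>E i\<in>I. FOb F (S i))"
    unfolding bij_betw_def
  proof (intro conjI equalityI subsetI inj_onI)
    fix s t assume s: "s \<in> FOb F c" "t \<in> FOb F c" "?h s = ?h t"
    have "FAr F c (S i) (\<iota> i) s = FAr F c (S i) (\<iota> i) t" if "i \<in> I" for i
      using fun_cong[OF s(3), of i] that by simp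
    then have "?g s = ?g t"
      using f\<rho>[OF _ s(1)] f\<rho>[OF _ s(2)] by (intro restrict_ext) metis
    then show "s = t" using inj_onD[OF bij_betw_imp_inj_on[OF bQ]] s(1,2) by blast
  next
    fix t assume "t \<in> ?h ` FOb F c"
    then show "t \<in> (\<Pi>\<^sub>E i\<in>I. FOb F (S i))" using bs_in[OF F S c \<iota>] by auto
  next
    fix t assume t: "t \<in> (\<Pi>\<^sub>E i\<in>I. FOb F (S i))"
    have "(\<lambda>i\<in>I. FAr F (S i) (Q i) (\<rho> i) (t i)) \<in> (\<Pi>\<^sub>E i\<in>I. FOb F (Q i))"
      using bs_in[OF F QS S \<rho>(1)] t by auto
    then have "(\<lambda>i\<in>I. FAr F (S i) (Q i) (\<rho> i) (t i)) \<in> ?g ` FOb F c"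
      unfolding bij_betw_imp_surj_on[OF bQ] .
    then obtain s where s: "(\<lambda>i\<in>I. FAr F (S i) (Q i) (\<rho> i) (t i)) = ?g s" "s \<in> FOb F c" by (rule imageE)
    have "t = ?h s"
    proof (rule extensionalityI[of _ I])
      fix i assume i: "i \<in> I"
      then have "FAr F (S i) (Q i) (\<rho> i) (t i) = FAr F c (Q i) (incl (Q i) c) s" using fun_cong[OF s(1), of i] by simp
      then have "t i = FAr F c (S i) (\<iota> i) s"
        using f\<tau>\<rho>[OF i, of "t i"] f\<tau>[OF i s(2)] t i by (auto simp: PiE_iff)
      then show "t i = ?h s i" using i by simp
    qed (use t in \<open>auto simp: PiE_iff\<close>)
    then show "t \<in> ?h ` FOb F c" using s(2) by (rule image_eqI)
  qed
qed

text \<open>Product preservation is stated for index sets of natural numbers, so the blocks are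
  enumerated and the resulting bijection is reindexed by the blocks themselves.\<close>

lemma products_partition:
  assumes F: "F \<in> Obj PB" and prod: "coproducts_to_products BS F"
    and S: "S \<in> \<S>" and U: "finite U" "partition_on S U"
  shows "bij_betw (\<lambda>s. \<lambda>u\<in>U. FAr F S u (incl u S) s) (FOb F S) (\<Pi>\<^sub>E u\<in>U. FOb F u)"
proof -
  obtain e where e: "bij_betw e {0..<card U} U" using ex_bij_betw_nat_finite[OF U(1)] by blast
  let ?I = "{0..<card U}"
  have eU: "e i \<in> U" if "i \<in> ?I" for i using e that by (auto simp: bij_betw_def)
  have sub: "e i \<subseteq> S" if "i \<in> ?I" for i by (rule partition_on_subset[OF U(2) eU[OF that]])
  have "is_coproduct BS ?I e S (\<lambda>i. incl (e i) S)"
  proof (intro BS_coproductI beta_coproduct S subset_in[OF S sub] inj_on_id2)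
    show "(\<lambda>x. x) ` e i \<inter> (\<lambda>x. x) ` e j = {}" if "i \<in> ?I" "j \<in> ?I" "i \<noteq> j" for i j
    proof -
      have "e i \<noteq> e j" using e that by (auto simp: bij_betw_def inj_on_def)
      then show ?thesis using partition_on_unique[OF U(2) eU[OF that(1)] eU[OF that(2)]] by auto
    qed
    show "S \<subseteq> (\<Union>i\<in>?I. (\<lambda>x. x) ` e i)"
    proof -
      have "S = \<Union>(e ` ?I)" using U(2) e by (simp add: partition_on_def bij_betw_def)
      then show ?thesis by simp
    qed
  qed (use sub in auto)
  then have bij: "bij_betw (\<lambda>s. \<lambda>i\<in>?I. FAr F S (e i) (incl (e i) S) s) (FOb F S) (\<Pi>\<^sub>E i\<in>?I. FOb F (e i))" (is "bij_betw ?g _ _")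
    using prod unfolding coproducts_to_products_def by blast
  let ?h = "\<lambda>s. \<lambda>u\<in>U. FAr F S u (incl u S) s"
  show ?thesis
    unfolding bij_betw_def
  proof (intro conjI equalityI subsetI inj_onI)
    fix s t assume s: "s \<in> FOb F S" "t \<in> FOb F S" "?h s = ?h t"
    have "?g s = ?g t"
    proof (rule restrict_ext)
      fix i assume "i \<in> ?I"
      then show "FAr F S (e i) (incl (e i) S) s = FAr F S (e i) (incl (e i) S) t"
        using fun_cong[OF s(3), of "e i"] eU by simp
    qed
    then show "s = t" using inj_onD[OF bij_betw_imp_inj_on[OF bij]] s(1,2) by blast
  next
    fix t assume "t \<in> ?h ` FOb F S"
    moreover have "FAr F S u (incl u S) s \<in> FOb F u" if "u \<in> U" "s \<in> FOb F S" for u s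
      using partition_on_subset[OF U(2) that(1)] by (intro bs_in[OF F _ S _ that(2)] incl_Arr S subset_in[OF S])
    ultimately show "t \<in> (\<Pi>\<^sub>E u\<in>U. FOb F u)" by auto
  next
    fix t assume t: "t \<in> (\<Pi>\<^sub>E u\<in>U. FOb F u)"
    then have "(\<lambda>i\<in>?I. t (e i)) \<in> (\<Pi>\<^sub>E i\<in>?I. FOb F (e i))" using eU by auto
    then have "(\<lambda>i\<in>?I. t (e i)) \<in> ?g ` FOb F S" unfolding bij_betw_imp_surj_on[OF bij] .
    then obtain s where s: "(\<lambda>i\<in>?I. t (e i)) = ?g s" "s \<in> FOb F S" by (rule imageE)
    have "t = ?h s"
    proof (rule extensionalityI[of _ U])
      fix u assume u: "u \<in> U"
      then obtain i where i: "i \<in> ?I" "u = e i" using e unfolding bij_betw_def by blast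
      then show "t u = ?h s u" using fun_cong[OF s(1), of i] u by simp
    qed (use t in \<open>auto simp: PiE_iff\<close>)
    then show "t \<in> ?h ` FOb F S" using s(2) by (rule image_eqI)
  qed
qed

context
  fixes F assumes F: "F \<in> Obj PB"
begin

text \<open>The covering \<open>{{}}\<close> is equivalent to the empty one, so the empty block can
  be removed from a representative without changing its class.\<close>

lemma plus_class_partition:
  assumes S: "S \<in> \<S>" and x: "x \<in> FOb (plus_ob F) S"
  obtains a where "a \<in> pts F S" "partition_on S (fst a)" "finite (fst a)" "x = plus_class F S a"
proof -
  obtain b where b: "b \<in> pts F S" "x = plus_class F S b" using x unfolding FOb_plus_ob[OF F] by blast
  have C: "fst b \<in> Obj (Cov S)" using b by (simp add: mem_pts)
  note P = Cov_partition[OF C]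
  let ?a = "(fst b - {{}}, restrict (snd b) (fst b - {{}}))"
  have a: "?a \<in> pts F S" using b(1) P by (auto simp: mem_pts Obj_Cov)
  have "prel F S S (ident S) b ?a"
    unfolding prel_ident_iff[OF F S b(1)]
    by (intro exI[of _ "fst b - {{}}"] conjI P ballI) auto
  then have "x = plus_class F S ?a" using plus_class_eq_iff[OF F S b(1) a] b(2) by simp
  then show thesis using that[of ?a] a P by simp
qed

lemma restricted_map_incl:
  assumes c: "c \<in> \<S>" and Q: "Q \<subseteq> c" and w: "w \<subseteq> Q"
  shows "carries Q c (incl Q c) w u \<longleftrightarrow> w \<subseteq> u \<and> u \<subseteq> c"
    and "w \<subseteq> u \<Longrightarrow> u \<subseteq> c \<Longrightarrow> restricted_map Q c (incl Q c) w u = incl w u"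
proof -
  have QS: "Q \<in> \<S>" by (rule subset_in[OF c Q])
  have wc: "w \<subseteq> c" using Q w by blast
  have "incl Q c ` hat Q w = incl Q c ` (incl w Q ` tb w)" unfolding incl_image[OF QS w] ..
  also have "\<dots> = incl w c ` tb w"
    unfolding incl_compose[OF c w Q, symmetric] by (auto simp: compose_eq image_image)
  also have "\<dots> = hat c w" by (rule incl_image[OF c wc])
  finally have im: "incl Q c ` hat Q w = hat c w" .
  show car: "carries Q c (incl Q c) w u \<longleftrightarrow> w \<subseteq> u \<and> u \<subseteq> c"
    unfolding carries_def im using w wc hat_subsetD[OF c wc, of u] hat_mono[of w u c] by blast
  assume u: "w \<subseteq> u" "u \<subseteq> c"
  show "restricted_map Q c (incl Q c) w u = incl w u"
  proof (rule restricted_map_unique[OF QS c incl_Arr[OF c Q]])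
    show "carries Q c (incl Q c) w u" using car u by simp
    show "incl w u \<in> bhom w u" by (rule incl_Arr[OF subset_in[OF c u(2)] u(1)])
    show "compose (tb w) (incl u c) (incl w u) = compose (tb w) (incl Q c) (incl w Q)"
      unfolding incl_compose[OF c u] incl_compose[OF c w Q] ..
  qed
qed

text \<open>Finite partitions of finitely many disjoint pieces unite to a finite partition of
  \<open>c\<close>. For injectivity the witnessing partitions are united, for surjectivity the
  representatives.\<close>

lemma plus_products: "coproducts_to_products BS (plus_ob F)"
proof (rule products_from_subsets[OF plus_ob_PB[OF F]])
  fix I :: "nat set" and Q c
  assume I: "finite I" and c: "c \<in> \<S>" and Qc: "\<And>i. i \<in> I \<Longrightarrow> Q i \<subseteq> c"
    and disj: "\<And>i j. i \<in> I \<Longrightarrow> j \<in> I \<Longrightarrow> i \<noteq> j \<Longrightarrow> Q i \<inter> Q j = {}" and cover: "c = (\<Union>i\<in>I. Q i)"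
  have QS: "Q i \<in> \<S>" if "i \<in> I" for i by (rule subset_in[OF c Qc[OF that]])
  note inc = incl_Arr[OF c Qc]
  have union: "finite (\<Union>i\<in>I. W i)" "partition_on c (\<Union>i\<in>I. W i)"
    if W: "\<And>i. i \<in> I \<Longrightarrow> finite (W i)" "\<And>i. i \<in> I \<Longrightarrow> partition_on (Q i) (W i)" for W
  proof -
    show "finite (\<Union>i\<in>I. W i)" using I W(1) by auto
    show "partition_on c (\<Union>i\<in>I. W i)"
    proof (rule partition_onI)
      show "\<Union>(\<Union>i\<in>I. W i) = c"
      proof -
        have "\<Union>(\<Union>i\<in>I. W i) = (\<Union>i\<in>I. \<Union>(W i))" by blast
        also have "\<dots> = (\<Union>i\<in>I. Q i)" using W(2) by (simp add: partition_on_def)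
        finally show ?thesis using cover by simp
      qed
      fix a b assume "a \<in> (\<Union>i\<in>I. W i)" "b \<in> (\<Union>i\<in>I. W i)" "a \<noteq> b"
      then obtain i j where ij: "i \<in> I" "j \<in> I" "a \<in> W i" "b \<in> W j" by blast
      show "disjnt a b"
        unfolding disjnt_iff
      proof (intro allI notI, elim conjE)
        fix x assume x: "x \<in> a" "x \<in> b"
        have "x \<in> Q i" "x \<in> Q j"
          using x partition_on_subset[OF W(2)[OF ij(1)] ij(3)] partition_on_subset[OF W(2)[OF ij(2)] ij(4)] by auto
        then have "i = j" using disj[OF ij(1,2)] by blast
        then show False using partition_on_unique[OF W(2)[OF ij(1)] ij(3)] ij(4) x \<open>a \<noteq> b\<close> by blast
      qed
    qed (use partition_on_nonempty[OF W(2)] in blast)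
  qed
  let ?h = "\<lambda>s. \<lambda>i\<in>I. FAr (plus_ob F) c (Q i) (incl (Q i) c) s"
  show "bij_betw ?h (FOb (plus_ob F) c) (\<Pi>\<^sub>E i\<in>I. FOb (plus_ob F) (Q i))"
    unfolding bij_betw_def
  proof (intro conjI equalityI subsetI inj_onI)
    fix x y assume x: "x \<in> FOb (plus_ob F) c" "y \<in> FOb (plus_ob F) c" "?h x = ?h y"
    obtain a where a: "a \<in> pts F c" "x = plus_class F c a" using x(1) unfolding FOb_plus_ob[OF F] by blast
    obtain b where b: "b \<in> pts F c" "y = plus_class F c b" using x(2) unfolding FOb_plus_ob[OF F] by blast
    have Ca: "fst a \<in> Obj (Cov c)" "fst b \<in> Obj (Cov c)" using a b by (simp_all add: mem_pts)
    have "\<exists>W. finite W \<and> partition_on (Q i) W \<and> (\<forall>w\<in>W. \<exists>u\<in>fst a. \<exists>v\<in>fst b. w \<subseteq> u \<and> w \<subseteq> v \<and>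
        FAr F u w (incl w u) (snd a u) = FAr F v w (incl w v) (snd b v))" if i: "i \<in> I" for i
    proof -
      obtain a' where a': "a' \<in> pts F (Q i)" "prel F (Q i) c (incl (Q i) c) a a'"
        "FAr (plus_ob F) c (Q i) (incl (Q i) c) (plus_class F c a) = plus_class F (Q i) a'"
        by (rule plus_ob_FAr_pullback[OF F QS[OF i] c inc[OF i] a(1)])
      obtain b' where b': "b' \<in> pts F (Q i)" "prel F (Q i) c (incl (Q i) c) b b'"
        "FAr (plus_ob F) c (Q i) (incl (Q i) c) (plus_class F c b) = plus_class F (Q i) b'"
        by (rule plus_ob_FAr_pullback[OF F QS[OF i] c inc[OF i] b(1)])
      have "plus_class F (Q i) a' = plus_class F (Q i) b'"
        using fun_cong[OF x(3), of i] i a(2) b(2) a'(3) b'(3) by simp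
      then have "prel F (Q i) (Q i) (ident (Q i)) a' b'"
        using plus_class_eq_iff[OF F QS[OF i] a'(1) b'(1)] by simp
      from prel_compose[OF F QS[OF i] QS[OF i] c inc[OF i] id_Arr_CH a(1) a'(1) b'(1) a'(2) this]
      have "prel F (Q i) c (incl (Q i) c) a b'" unfolding ident_compose(1)[OF inc[OF i]] .
      from prel_equalizer[OF F QS[OF i] c inc[OF i] a(1) b(1) b'(1) this b'(2)]
      obtain W where W: "finite W" "partition_on (Q i) W" "\<And>w. w \<in> W \<Longrightarrow> \<exists>u\<in>fst a. \<exists>v\<in>fst b.
          carries (Q i) c (incl (Q i) c) w u \<and> carries (Q i) c (incl (Q i) c) w v \<and>
          FAr F u w (restricted_map (Q i) c (incl (Q i) c) w u) (snd a u) = FAr F v w (restricted_map (Q i) c (incl (Q i) c) w v) (snd b v)"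
        by metis
      have "\<exists>u\<in>fst a. \<exists>v\<in>fst b. w \<subseteq> u \<and> w \<subseteq> v \<and> FAr F u w (incl w u) (snd a u) = FAr F v w (incl w v) (snd b v)"
        if w: "w \<in> W" for w
      proof -
        note r = restricted_map_incl[OF c Qc[OF i] partition_on_subset[OF W(2) w]]
        show ?thesis using W(3)[OF w] r by (simp add: conj_ac) metis
      qed
      then show ?thesis using W(1,2) by blast
    qed
    then obtain W where W: "\<And>i. i \<in> I \<Longrightarrow> finite (W i)" "\<And>i. i \<in> I \<Longrightarrow> partition_on (Q i) (W i)"
      "\<And>i w. i \<in> I \<Longrightarrow> w \<in> W i \<Longrightarrow> \<exists>u\<in>fst a. \<exists>v\<in>fst b. w \<subseteq> u \<and> w \<subseteq> v \<and>
        FAr F u w (incl w u) (snd a u) = FAr F v w (incl w v) (snd b v)" by metis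
    have "prel F c c (ident c) a b"
      unfolding prel_ident_iff[OF F c a(1)]
      by (intro exI[of _ "\<Union>i\<in>I. W i"] conjI union W(1,2) ballI) (use W(3) in blast)+
    then show "x = y" using plus_class_eq_iff[OF F c a(1) b(1)] a(2) b(2) by simp
  next
    fix t assume "t \<in> ?h ` FOb (plus_ob F) c"
    then show "t \<in> (\<Pi>\<^sub>E i\<in>I. FOb (plus_ob F) (Q i))" using bs_in[OF plus_ob_PB[OF F] QS c inc] by auto
  next
    fix t assume t: "t \<in> (\<Pi>\<^sub>E i\<in>I. FOb (plus_ob F) (Q i))"
    have "\<exists>a. a \<in> pts F (Q i) \<and> partition_on (Q i) (fst a) \<and> finite (fst a) \<and> t i = plus_class F (Q i) a" if i: "i \<in> I" for i
    proof -
      have "t i \<in> FOb (plus_ob F) (Q i)" using t i by auto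
      then show ?thesis by (rule plus_class_partition[OF QS[OF i]]) blast
    qed
    then obtain a where a: "\<And>i. i \<in> I \<Longrightarrow> a i \<in> pts F (Q i)" "\<And>i. i \<in> I \<Longrightarrow> partition_on (Q i) (fst (a i))"
      "\<And>i. i \<in> I \<Longrightarrow> finite (fst (a i))" "\<And>i. i \<in> I \<Longrightarrow> t i = plus_class F (Q i) (a i)" by metis
    define U where "U = (\<Union>i\<in>I. fst (a i))"
    \<comment> \<open>Blocks are nonempty and the sets \<open>Q i\<close> are disjoint, so each
      block of \<open>U\<close> belongs to the covering of exactly one piece.\<close>
    define s where "s = (\<lambda>u\<in>U. snd (a (THE i. i \<in> I \<and> u \<in> fst (a i))) u)"
    have s: "s u = snd (a i) u" if u: "i \<in> I" "u \<in> fst (a i)" for u i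
    proof -
      have "(THE i. i \<in> I \<and> u \<in> fst (a i)) = i"
      proof (rule the_equality)
        fix j assume j: "j \<in> I \<and> u \<in> fst (a j)"
        have "u \<noteq> {}" "u \<subseteq> Q i" "u \<subseteq> Q j"
          using partition_on_nonempty[OF a(2)[OF u(1)] u(2)] partition_on_subset[OF a(2)[OF u(1)] u(2)]
            partition_on_subset[OF a(2), of j u] j by auto
        then show "j = i" using disj[OF u(1), of j] j by blast
      qed (use u in simp)
      then show ?thesis using u by (auto simp: s_def U_def)
    qed
    have U: "finite U" "partition_on c U" unfolding U_def by (rule union[OF a(3,2)]; assumption)+
    have pt: "(U, s) \<in> pts F c"
    proof -
      have "s u \<in> FOb F u" if "u \<in> U" for u
        using that s pts_in[OF F a(1)] unfolding U_def by auto
      then show ?thesis using U by (simp add: mem_pts Obj_Cov PiE_iff s_def)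
    qed
    have "FAr (plus_ob F) c (Q i) (incl (Q i) c) (plus_class F c (U, s)) = t i" if i: "i \<in> I" for i
      unfolding a(4)[OF i]
    proof (rule plus_ob_FAr[OF F QS[OF i] c inc[OF i] pt a(1)[OF i]], rule prelI[OF a(3)[OF i] a(2)[OF i]])
      fix w assume w: "w \<in> fst (a i)"
      have wQ: "w \<subseteq> Q i" by (rule partition_on_subset[OF a(2)[OF i] w])
      note r = restricted_map_incl[OF c Qc[OF i] wQ, of w]
      have "w \<subseteq> c" using wQ Qc[OF i] by blast
      then show "\<exists>u\<in>fst (U, s). \<exists>v\<in>fst (a i). carries (Q i) c (incl (Q i) c) w u \<and> w \<subseteq> v \<and>
          FAr F u w (restricted_map (Q i) c (incl (Q i) c) w u) (snd (U, s) u) = FAr F v w (incl w v) (snd (a i) v)"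
        using w i s[OF i w] r by (intro bexI[of _ w]) (auto simp: U_def)
    qed
    then have "t = ?h (plus_class F c (U, s))"
      using t by (intro extensionalityI[of _ I]) (auto simp: PiE_iff)
    then show "t \<in> ?h ` FOb (plus_ob F) c"
      using pt by (intro image_eqI[of _ _ "plus_class F c (U, s)"]) (simp_all add: FOb_plus_ob[OF F])
  qed
qed

end


subsection \<open>The functor \<open>Plus\<close>\<close>

definition map_pt :: "('u set \<Rightarrow> 'u \<Rightarrow> 'u) \<Rightarrow> 'u set set \<times> ('u set \<Rightarrow> 'u) \<Rightarrow> 'u set set \<times> ('u set \<Rightarrow> 'u)" where
  "map_pt \<alpha> a = (fst a, \<lambda>u\<in>fst a. \<alpha> u (snd a u))"

context
  fixes F G \<alpha> assumes F: "F \<in> Obj PB" and G: "G \<in> Obj PB" and \<alpha>: "\<alpha> \<in> Arr PB F G"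
begin

lemma map_pt_pts:
  assumes S: "S \<in> \<S>" and a: "a \<in> pts F S" shows "map_pt \<alpha> a \<in> pts G S"
proof -
  have C: "fst a \<in> Obj (Cov S)" using a by (simp add: mem_pts)
  have "\<alpha> u (snd a u) \<in> FOb G u" if "u \<in> fst a" for u
    by (rule bs_arr_in[OF \<alpha> subset_in[OF S Cov_subset[OF C that]] pts_in[OF F a that]])
  then show ?thesis using C by (simp add: mem_pts map_pt_def)
qed

lemma map_pt_prel:
  assumes S: "S \<in> \<S>" and T: "T \<in> \<S>" and f: "f \<in> bhom S T"
    and a: "a \<in> pts F T" and b: "b \<in> pts F S" and ab: "prel F S T f a b"
  shows "prel G S T f (map_pt \<alpha> a) (map_pt \<alpha> b)"
proof -
  obtain W where W: "finite W" "partition_on S W" "\<And>w. w \<in> W \<Longrightarrow> \<exists>u\<in>fst a. \<exists>v\<in>fst b. carries S T f w u \<and> w \<subseteq> v \<and>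
      FAr F u w (restricted_map S T f w u) (snd a u) = FAr F v w (incl w v) (snd b v)"
    using ab unfolding prel_def by metis
  show ?thesis
  proof (rule prelI[OF W(1,2)])
    fix w assume w: "w \<in> W"
    then obtain u v where uv: "u \<in> fst a" "v \<in> fst b" "carries S T f w u" "w \<subseteq> v"
      "FAr F u w (restricted_map S T f w u) (snd a u) = FAr F v w (incl w v) (snd b v)" using W(3) by blast
    have u: "u \<in> \<S>" and v: "v \<in> \<S>" and wS: "w \<in> \<S>"
      using subset_in[OF T Cov_subset[OF _ uv(1)]] subset_in[OF S Cov_subset[OF _ uv(2)]] a b
        subset_in[OF S partition_on_subset[OF W(2) w]] by (auto simp: mem_pts)
    have "FAr G u w (restricted_map S T f w u) (\<alpha> u (snd a u)) = \<alpha> w (FAr F u w (restricted_map S T f w u) (snd a u))"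
      by (rule bs_nat[OF \<alpha> wS u restricted_map_Arr[OF S T f uv(3)] pts_in[OF F a uv(1)], symmetric])
    also have "\<dots> = FAr G v w (incl w v) (\<alpha> v (snd b v))"
      unfolding uv(5) by (rule bs_nat[OF \<alpha> wS v incl_Arr[OF v uv(4)] pts_in[OF F b uv(2)]])
    finally show "\<exists>u\<in>fst (map_pt \<alpha> a). \<exists>v\<in>fst (map_pt \<alpha> b). carries S T f w u \<and> w \<subseteq> v \<and>
      FAr G u w (restricted_map S T f w u) (snd (map_pt \<alpha> a) u) = FAr G v w (incl w v) (snd (map_pt \<alpha> b) v)"
      using uv by (intro bexI[of _ u] bexI[of _ v]) (auto simp: map_pt_def)
  qed
qed

lemma Plus_FAr_class:
  assumes S: "S \<in> \<S>" and a: "a \<in> pts F S"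
  shows "FAr (Plus \<S>) F G \<alpha> S (plus_class F S a) = plus_class G S (map_pt \<alpha> a)"
proof -
  have "FAr (Plus \<S>) F G \<alpha> S (plus_class F S a) = plus_lift F S (\<lambda>a. plus_class G S (map_pt \<alpha> a)) (plus_class F S a)"
    using S by (simp add: Plus_def case_prod_unfold map_pt_def)
  also have "\<dots> = plus_class G S (map_pt \<alpha> a)"
  proof (rule plus_lift_class[OF F S a])
    fix b assume b: "b \<in> pts F S" "prel F S S (ident S) a b"
    show "plus_class G S (map_pt \<alpha> b) = plus_class G S (map_pt \<alpha> a)"
      using plus_class_eq_iff[OF G S map_pt_pts[OF S a] map_pt_pts[OF S b(1)]] map_pt_prel[OF S S id_Arr_CH a b] by simp
  qed
  finally show ?thesis .
qed

lemma Plus_FAr_Arr: "FAr (Plus \<S>) F G \<alpha> \<in> Arr PB (plus_ob F) (plus_ob G)"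
proof (rule PSh_ArrI[OF plus_ob_PB[OF F] plus_ob_PB[OF G]])
  show "FAr (Plus \<S>) F G \<alpha> \<in> extensional (Obj BS)" by (simp add: Plus_def)
  fix S assume "S \<in> Obj BS"
  then have S: "S \<in> \<S>" by simp
  have "FAr (Plus \<S>) F G \<alpha> S \<in> extensional (FOb (plus_ob F) S)"
    using S by (simp add: Plus_def plus_ob_def plus_lift_def)
  then show "FAr (Plus \<S>) F G \<alpha> S \<in> FOb (plus_ob F) S \<rightarrow>\<^sub>E FOb (plus_ob G) S"
    using Plus_FAr_class[OF S] map_pt_pts[OF S] by (auto simp: PiE_iff FOb_plus_ob[OF F] FOb_plus_ob[OF G])
next
  fix S T f x assume *: "S \<in> Obj BS" "T \<in> Obj BS" "f \<in> Arr BS S T" "x \<in> FOb (plus_ob F) T"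
  then have S: "S \<in> \<S>" and T: "T \<in> \<S>" and f: "f \<in> bhom S T" by simp_all
  obtain a where a: "x = plus_class F T a" "a \<in> pts F T" using *(4) unfolding FOb_plus_ob[OF F] by (rule imageE)
  obtain b where b: "b \<in> pts F S" "prel F S T f a b" "FAr (plus_ob F) T S f (plus_class F T a) = plus_class F S b"
    by (rule plus_ob_FAr_pullback[OF F S T f a(2)])
  show "FAr (Plus \<S>) F G \<alpha> S (FAr (plus_ob F) T S f x) = FAr (plus_ob G) T S f (FAr (Plus \<S>) F G \<alpha> T x)"
    unfolding a(1) b(3) Plus_FAr_class[OF S b(1)] Plus_FAr_class[OF T a(2)]
    by (rule plus_ob_FAr[OF G S T f map_pt_pts[OF T a(2)] map_pt_pts[OF S b(1)] map_pt_prel[OF S T f a(2) b(1,2)], symmetric])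
qed

end

lemma FOb_Plus [simp]: "FOb (Plus \<S>) = plus_ob"
  by (simp add: Plus_def)

lemma Plus_functor: "is_functor PB PB (Plus \<S>)"
proof (rule PSh_functorI[OF is_cat_PSh])
  fix F S x assume F: "F \<in> Obj PB" and S: "S \<in> Obj BS" and x: "x \<in> FOb (FOb (Plus \<S>) F) S"
  have S': "S \<in> \<S>" using S by simp
  obtain a where a: "x = plus_class F S a" "a \<in> pts F S" using x unfolding FOb_Plus FOb_plus_ob[OF F] by (rule imageE)
  have C: "fst a \<in> Obj (Cov S)" "snd a \<in> (\<Pi>\<^sub>E u\<in>fst a. FOb F u)" using a by (simp_all add: mem_pts)
  have "(\<lambda>u\<in>fst a. Idt PB F u (snd a u)) = snd a"
    by (rule extensionalityI[of _ "fst a"])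
      (use C subset_in[OF S' Cov_subset[OF C(1)]] in \<open>auto simp: PSh_Idt_apply PiE_iff\<close>)
  then have "map_pt (Idt PB F) a = a" by (simp add: map_pt_def)
  then show "FAr (Plus \<S>) F F (Idt PB F) S x = x"
    unfolding a(1) using Plus_FAr_class[OF F F PSh_Idt_Arr[OF F] S' a(2)] by simp
next
  fix F G H \<alpha> \<beta> S x
  assume F: "F \<in> Obj PB" and G: "G \<in> Obj PB" and H: "H \<in> Obj PB" and \<alpha>: "\<alpha> \<in> Arr PB F G" and \<beta>: "\<beta> \<in> Arr PB G H"
    and S: "S \<in> Obj BS" and x: "x \<in> FOb (FOb (Plus \<S>) F) S"
  have S': "S \<in> \<S>" using S by simp
  obtain a where a: "x = plus_class F S a" "a \<in> pts F S" using x unfolding FOb_Plus FOb_plus_ob[OF F] by (rule imageE)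
  have C: "fst a \<in> Obj (Cov S)" using a by (simp add: mem_pts)
  have "map_pt (Cmp PB F G H \<beta> \<alpha>) a = map_pt \<beta> (map_pt \<alpha> a)"
    unfolding map_pt_def prod.inject fst_conv snd_conv
    by (intro conjI refl restrict_ext)
      (use subset_in[OF S' Cov_subset[OF C]] pts_in[OF F a(2)] in \<open>simp add: PSh_Cmp_apply\<close>)
  then show "FAr (Plus \<S>) F H (Cmp PB F G H \<beta> \<alpha>) S x = FAr (Plus \<S>) G H \<beta> S (FAr (Plus \<S>) F G \<alpha> S x)"
    unfolding a(1) Plus_FAr_class[OF F H PSh_Cmp_Arr[OF F H \<alpha> \<beta>] S' a(2)] Plus_FAr_class[OF F G \<alpha> S' a(2)]
      Plus_FAr_class[OF G H \<beta> S' map_pt_pts[OF F G \<alpha> S' a(2)]] by simp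
qed (simp_all add: plus_ob_PB Plus_FAr_Arr)

lemma Plus_functor_PShx: "is_functor PB (PShx \<S>) (Plus \<S>)"
  unfolding PShx_def by (rule is_functor_into_full_subcat[OF Plus_functor]) (simp add: plus_products)


subsection \<open>The unit of \<open>Plus\<close>\<close>

text \<open>The covering of \<open>S\<close> by itself. Empty \<open>S\<close> is included, because
  \<open>Cov\<close> then has \<open>{{}}\<close> as an object, so every section over \<beta>S gives
  a point without case distinction.\<close>

definition single :: "'u set \<Rightarrow> 'u \<Rightarrow> 'u set set \<times> ('u set \<Rightarrow> 'u)" where
  "single S s = ({S}, \<lambda>u\<in>{S}. s)"

lemma block_partition: "partition_on S ({S} - {{}})"
  by (auto simp: partition_on_def disjoint_def)

context
  fixes F assumes F: "F \<in> Obj PB"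
begin

lemma single_pts: "s \<in> FOb F S \<Longrightarrow> single S s \<in> pts F S"
  using block_partition[of S] by (cases "S = {}") (auto simp: mem_pts single_def Obj_Cov)

lemma single_in_plus: "s \<in> FOb F S \<Longrightarrow> plus_class F S (single S s) \<in> FOb (plus_ob F) S"
  unfolding FOb_plus_ob[OF F] by (rule imageI[OF single_pts])

lemma single_natural:
  assumes S: "S \<in> \<S>" and T: "T \<in> \<S>" and f: "f \<in> bhom S T" and s: "s \<in> FOb F T"
  shows "FAr (plus_ob F) T S f (plus_class F T (single T s)) = plus_class F S (single S (FAr F T S f s))"
proof (rule plus_ob_FAr[OF F S T f single_pts[OF s] single_pts[OF bs_in[OF F S T f s]]], rule prelI[OF _ block_partition])
  fix w assume "w \<in> {S} - {{}}"
  then have w: "w = S" by simp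
  show "\<exists>u\<in>fst (single T s). \<exists>v\<in>fst (single S (FAr F T S f s)). carries S T f w u \<and> w \<subseteq> v \<and>
      FAr F u w (restricted_map S T f w u) (snd (single T s) u) = FAr F v w (incl w v) (snd (single S (FAr F T S f s)) v)"
    using carries_top[OF f] FAr_incl_refl[OF F S bs_in[OF F S T f s]] restricted_map_top[OF S T f]
    by (simp add: single_def w)
qed simp

text \<open>Over one of its own blocks a representative is already a single section. This is the
  local surjectivity of the map from \<open>F\<close> to \<open>plus_ob F\<close>, used in
  \<open>sheafify_local\<close>.\<close>

lemma single_block:
  assumes S: "S \<in> \<S>" and a: "a \<in> pts F S" and u: "u \<in> fst a"
  shows "FAr (plus_ob F) S u (incl u S) (plus_class F S a) = plus_class F u (single u (snd a u))"
proof -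
  have uS: "u \<subseteq> S" using Cov_subset[OF _ u] a by (simp add: mem_pts)
  note U = subset_in[OF S uS] and r = restricted_map_incl[OF F S uS order_refl, of u]
  show ?thesis
  proof (rule plus_ob_FAr[OF F U S incl_Arr[OF S uS] a single_pts[OF pts_in[OF F a u]]], rule prelI[OF _ block_partition])
    fix w assume "w \<in> {u} - {{}}"
    then show "\<exists>u'\<in>fst a. \<exists>v\<in>fst (single u (snd a u)). carries u S (incl u S) w u' \<and> w \<subseteq> v \<and>
      FAr F u' w (restricted_map u S (incl u S) w u') (snd a u') = FAr F v w (incl w v) (snd (single u (snd a u)) v)"
      using u uS r by (intro bexI[of _ u]) (auto simp: single_def)
  qed simp
qed

context
  assumes prod: "coproducts_to_products BS F"
begin

text \<open>Equivalent one-block representatives agree on some finite partition, and a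
  product-preserving \<open>F\<close> is determined by restrictions to its blocks.\<close>

lemma single_inj:
  assumes S: "S \<in> \<S>" and s: "s \<in> FOb F S" "t \<in> FOb F S"
    and eq: "plus_class F S (single S s) = plus_class F S (single S t)"
  shows "s = t"
proof -
  have "prel F S S (ident S) (single S s) (single S t)"
    using eq plus_class_eq_iff[OF F S single_pts[OF s(1)] single_pts[OF s(2)]] by simp
  then obtain W where W: "finite W" "partition_on S W" "\<And>w. w \<in> W \<Longrightarrow> FAr F S w (incl w S) s = FAr F S w (incl w S) t"
    unfolding prel_ident_iff[OF F S single_pts[OF s(1)]] by (auto simp: single_def)
  then show ?thesis
    using inj_onD[OF bij_betw_imp_inj_on[OF products_partition[OF F prod S W(1,2)]], of s t] s
    by (simp cong: restrict_cong)
qed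

text \<open>A representative on a partition is a family of sections over the blocks, which product
  preservation glues to one section over \<beta>S.\<close>

lemma single_surj:
  assumes S: "S \<in> \<S>" and x: "x \<in> FOb (plus_ob F) S"
  obtains s where "s \<in> FOb F S" "x = plus_class F S (single S s)"
proof -
  obtain a where a: "a \<in> pts F S" "partition_on S (fst a)" "finite (fst a)" "x = plus_class F S a"
    by (rule plus_class_partition[OF F S x])
  have "snd a \<in> (\<lambda>s. \<lambda>u\<in>fst a. FAr F S u (incl u S) s) ` FOb F S"
    unfolding bij_betw_imp_surj_on[OF products_partition[OF F prod S a(3,2)]] using a(1) by (simp add: mem_pts)
  then obtain s where s: "snd a = (\<lambda>u\<in>fst a. FAr F S u (incl u S) s)" "s \<in> FOb F S" by (rule imageE)
  have sub: "u \<subseteq> S" if "u \<in> fst a" for u by (rule partition_on_subset[OF a(2) that])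
  have "prel F S S (ident S) (single S s) a"
    unfolding prel_ident_iff[OF F S single_pts[OF s(2)]]
  proof (intro exI[of _ "fst a"] conjI a(2,3) ballI)
    fix w assume w: "w \<in> fst a"
    have "FAr F S w (incl w S) s = FAr F w w (incl w w) (snd a w)"
      using fun_cong[OF s(1), of w] w FAr_incl_refl[OF F subset_in[OF S sub[OF w]] pts_in[OF F a(1) w]] by simp
    then show "\<exists>u\<in>fst (single S s). \<exists>v\<in>fst a. w \<subseteq> u \<and> w \<subseteq> v \<and>
        FAr F u w (incl w u) (snd (single S s) u) = FAr F v w (incl w v) (snd a v)"
      using w sub[OF w] by (auto simp: single_def)
  qed
  then have "x = plus_class F S (single S s)" using plus_class_eq_iff[OF F S single_pts[OF s(2)] a(1)] a(4) by simp
  with s(2) show thesis by (rule that)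
qed

end

end

end


subsection \<open>Uniqueness of left adjoints\<close>

lemma
  assumes "is_cat C"
  shows cat_idt: "X \<in> Obj C \<Longrightarrow> Idt C X \<in> Arr C X X"
    and cat_id_right: "X \<in> Obj C \<Longrightarrow> Y \<in> Obj C \<Longrightarrow> f \<in> Arr C X Y \<Longrightarrow> Cmp C X X Y f (Idt C X) = f"
    and cat_id_left: "X \<in> Obj C \<Longrightarrow> Y \<in> Obj C \<Longrightarrow> f \<in> Arr C X Y \<Longrightarrow> Cmp C X Y Y (Idt C Y) f = f"
    and cat_cmp: "X \<in> Obj C \<Longrightarrow> Y \<in> Obj C \<Longrightarrow> Z \<in> Obj C \<Longrightarrow> f \<in> Arr C X Y \<Longrightarrow> g \<in> Arr C Y Z \<Longrightarrow>
      Cmp C X Y Z g f \<in> Arr C X Z"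
  using assms unfolding is_cat_def by simp_all

lemma left_adjointE:
  assumes "left_adjoint C D L R"
  obtains \<phi> where "\<And>c d. c \<in> Obj C \<Longrightarrow> d \<in> Obj D \<Longrightarrow> bij_betw (\<phi> c d) (Arr D (FOb L c) d) (Arr C c (FOb R d))"
    and "\<And>c c' d d' f k h. c \<in> Obj C \<Longrightarrow> c' \<in> Obj C \<Longrightarrow> d \<in> Obj D \<Longrightarrow> d' \<in> Obj D \<Longrightarrow>
      f \<in> Arr C c' c \<Longrightarrow> k \<in> Arr D d d' \<Longrightarrow> h \<in> Arr D (FOb L c) d \<Longrightarrow>
      \<phi> c' d' (Cmp D (FOb L c') d d' k (Cmp D (FOb L c') (FOb L c) d h (FAr L c' c f)))
        = Cmp C c' (FOb R d) (FOb R d') (FAr R d d' k) (Cmp C c' c (FOb R d) (\<phi> c d h) f)"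
proof -
  note ex = assms[unfolded left_adjoint_def, THEN conjunct2, THEN conjunct2]
  from ex show thesis
  proof (elim exE conjE)
    fix \<phi>
    assume bij: "\<forall>c\<in>Obj C. \<forall>d\<in>Obj D. bij_betw (\<phi> c d) (Arr D (FOb L c) d) (Arr C c (FOb R d))"
      and nat: "\<forall>c \<in> Obj C. \<forall>c' \<in> Obj C. \<forall>d \<in> Obj D. \<forall>d' \<in> Obj D. \<forall>f \<in> Arr C c' c. \<forall>k \<in> Arr D d d'. \<forall>h \<in> Arr D (FOb L c) d.
       \<phi> c' d' (Cmp D (FOb L c') d d' k (Cmp D (FOb L c') (FOb L c) d h (FAr L c' c f)))
         = Cmp C c' (FOb R d) (FOb R d') (FAr R d d' k) (Cmp C c' c (FOb R d) (\<phi> c d h) f)"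
    show thesis by (rule that[of \<phi>, OF bij[rule_format] nat[rule_format]])
  qed
qed

text \<open>
  \<open>\<phi>\<close> and \<open>\<phi>'\<close> are the two adjunction bijections. The comparison \<open>L c \<rightarrow> L' c\<close> is the transpose under
  \<open>\<phi>\<close> of the unit of \<open>L'\<close>.
\<close>

lemma left_adjoint_unique:
  assumes C: "is_cat C" and D: "is_cat D" and "left_adjoint C D L R" "left_adjoint C D L' R"
  shows "isomorphic_functors C D L L'"
proof -
  have L: "is_functor C D L" "is_functor C D L'" "is_functor D C R"
    using assms(3,4) by (simp_all add: left_adjoint_def)
  obtain \<phi> where bij: "\<And>c d. c \<in> Obj C \<Longrightarrow> d \<in> Obj D \<Longrightarrow> bij_betw (\<phi> c d) (Arr D (FOb L c) d) (Arr C c (FOb R d))"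
    and nat: "\<And>c c' d d' f k h. c \<in> Obj C \<Longrightarrow> c' \<in> Obj C \<Longrightarrow> d \<in> Obj D \<Longrightarrow> d' \<in> Obj D \<Longrightarrow>
      f \<in> Arr C c' c \<Longrightarrow> k \<in> Arr D d d' \<Longrightarrow> h \<in> Arr D (FOb L c) d \<Longrightarrow>
      \<phi> c' d' (Cmp D (FOb L c') d d' k (Cmp D (FOb L c') (FOb L c) d h (FAr L c' c f)))
        = Cmp C c' (FOb R d) (FOb R d') (FAr R d d' k) (Cmp C c' c (FOb R d) (\<phi> c d h) f)"
    by (rule left_adjointE[OF assms(3)]) (rule that; assumption)
  obtain \<phi>' where bij': "\<And>c d. c \<in> Obj C \<Longrightarrow> d \<in> Obj D \<Longrightarrow> bij_betw (\<phi>' c d) (Arr D (FOb L' c) d) (Arr C c (FOb R d))"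
    and nat': "\<And>c c' d d' f k h. c \<in> Obj C \<Longrightarrow> c' \<in> Obj C \<Longrightarrow> d \<in> Obj D \<Longrightarrow> d' \<in> Obj D \<Longrightarrow>
      f \<in> Arr C c' c \<Longrightarrow> k \<in> Arr D d d' \<Longrightarrow> h \<in> Arr D (FOb L' c) d \<Longrightarrow>
      \<phi>' c' d' (Cmp D (FOb L' c') d d' k (Cmp D (FOb L' c') (FOb L' c) d h (FAr L' c' c f)))
        = Cmp C c' (FOb R d) (FOb R d') (FAr R d d' k) (Cmp C c' c (FOb R d) (\<phi>' c d h) f)"
    by (rule left_adjointE[OF assms(4)]) (rule that; assumption)
  have Lo: "FOb L c \<in> Obj D" "FOb L' c \<in> Obj D" if "c \<in> Obj C" for c
    using L that by (simp_all add: is_functor_def)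
  have Ro: "FOb R d \<in> Obj C" if "d \<in> Obj D" for d using L that by (simp add: is_functor_def)
  have La: "FAr L c c' f \<in> Arr D (FOb L c) (FOb L c')" "FAr L' c c' f \<in> Arr D (FOb L' c) (FOb L' c')"
    if "c \<in> Obj C" "c' \<in> Obj C" "f \<in> Arr C c c'" for c c' f
    using L that by (simp_all add: is_functor_def)
  have Ra: "FAr R d d' f \<in> Arr C (FOb R d) (FOb R d')"
    if "d \<in> Obj D" "d' \<in> Obj D" "f \<in> Arr D d d'" for d d' f
    using L that by (simp add: is_functor_def)
  have Li: "FAr L c c (Idt C c) = Idt D (FOb L c)" "FAr L' c c (Idt C c) = Idt D (FOb L' c)" if "c \<in> Obj C" for c
    using L that by (simp_all add: is_functor_def)
  have Ri: "FAr R d d (Idt D d) = Idt C (FOb R d)" if "d \<in> Obj D" for d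
    using L that by (simp add: is_functor_def)
  have \<phi>_in: "\<phi> c d h \<in> Arr C c (FOb R d)" if "c \<in> Obj C" "d \<in> Obj D" "h \<in> Arr D (FOb L c) d" for c d h
    using bij_betwE[OF bij[OF that(1,2)]] that(3) by blast
  have \<phi>'_in: "\<phi>' c d h \<in> Arr C c (FOb R d)" if "c \<in> Obj C" "d \<in> Obj D" "h \<in> Arr D (FOb L' c) d" for c d h
    using bij_betwE[OF bij'[OF that(1,2)]] that(3) by blast
  have \<phi>_inj: "h = h'" if "c \<in> Obj C" "d \<in> Obj D" "h \<in> Arr D (FOb L c) d" "h' \<in> Arr D (FOb L c) d" "\<phi> c d h = \<phi> c d h'" for c d h h'
    using inj_onD[OF bij_betw_imp_inj_on[OF bij[OF that(1,2)]] that(5,3,4)] .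
  have \<phi>'_inj: "h = h'" if "c \<in> Obj C" "d \<in> Obj D" "h \<in> Arr D (FOb L' c) d" "h' \<in> Arr D (FOb L' c) d" "\<phi>' c d h = \<phi>' c d h'" for c d h h'
    using inj_onD[OF bij_betw_imp_inj_on[OF bij'[OF that(1,2)]] that(5,3,4)] .
  \<comment> \<open>Joint naturality is split into naturality in each variable by taking the other
    morphism to be an identity.\<close>
  have post: "\<phi> c d' (Cmp D (FOb L c) d d' k h) = Cmp C c (FOb R d) (FOb R d') (FAr R d d' k) (\<phi> c d h)"
    if c: "c \<in> Obj C" and d: "d \<in> Obj D" and d': "d' \<in> Obj D" and k: "k \<in> Arr D d d'" and h: "h \<in> Arr D (FOb L c) d" for c d d' k h
    using nat[OF c c d d' cat_idt[OF C c] k h] cat_id_right[OF D Lo(1)[OF c] d h]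
      cat_id_right[OF C c Ro[OF d] \<phi>_in[OF c d h]] by (simp add: Li[OF c])
  have post': "\<phi>' c d' (Cmp D (FOb L' c) d d' k h) = Cmp C c (FOb R d) (FOb R d') (FAr R d d' k) (\<phi>' c d h)"
    if c: "c \<in> Obj C" and d: "d \<in> Obj D" and d': "d' \<in> Obj D" and k: "k \<in> Arr D d d'" and h: "h \<in> Arr D (FOb L' c) d" for c d d' k h
    using nat'[OF c c d d' cat_idt[OF C c] k h] cat_id_right[OF D Lo(2)[OF c] d h]
      cat_id_right[OF C c Ro[OF d] \<phi>'_in[OF c d h]] by (simp add: Li[OF c])
  have pre: "\<phi> c' d (Cmp D (FOb L c') (FOb L c) d h (FAr L c' c f)) = Cmp C c' c (FOb R d) (\<phi> c d h) f"
    if c: "c \<in> Obj C" and c': "c' \<in> Obj C" and d: "d \<in> Obj D" and f: "f \<in> Arr C c' c" and h: "h \<in> Arr D (FOb L c) d" for c c' d f h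
    using nat[OF c c' d d f cat_idt[OF D d] h]
      cat_id_left[OF D Lo(1)[OF c'] d cat_cmp[OF D Lo(1)[OF c'] Lo(1)[OF c] d La(1)[OF c' c f] h]]
      cat_id_left[OF C c' Ro[OF d] cat_cmp[OF C c' c Ro[OF d] f \<phi>_in[OF c d h]]] by (simp add: Ri[OF d])
  have pre': "\<phi>' c' d (Cmp D (FOb L' c') (FOb L' c) d h (FAr L' c' c f)) = Cmp C c' c (FOb R d) (\<phi>' c d h) f"
    if c: "c \<in> Obj C" and c': "c' \<in> Obj C" and d: "d \<in> Obj D" and f: "f \<in> Arr C c' c" and h: "h \<in> Arr D (FOb L' c) d" for c c' d f h
    using nat'[OF c c' d d f cat_idt[OF D d] h]
      cat_id_left[OF D Lo(2)[OF c'] d cat_cmp[OF D Lo(2)[OF c'] Lo(2)[OF c] d La(2)[OF c' c f] h]]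
      cat_id_left[OF C c' Ro[OF d] cat_cmp[OF C c' c Ro[OF d] f \<phi>'_in[OF c d h]]] by (simp add: Ri[OF d])
  define u where "u c = \<phi>' c (FOb L' c) (Idt D (FOb L' c))" for c
  define v where "v c = \<phi> c (FOb L c) (Idt D (FOb L c))" for c
  have u: "u c \<in> Arr C c (FOb R (FOb L' c))" and v: "v c \<in> Arr C c (FOb R (FOb L c))" if "c \<in> Obj C" for c
    unfolding u_def v_def using \<phi>_in \<phi>'_in cat_idt[OF D] Lo that by simp_all
  define \<alpha> where "\<alpha> c = inv_into (Arr D (FOb L c) (FOb L' c)) (\<phi> c (FOb L' c)) (u c)" for c
  define \<beta> where "\<beta> c = inv_into (Arr D (FOb L' c) (FOb L c)) (\<phi>' c (FOb L c)) (v c)" for c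
  have \<alpha>: "\<alpha> c \<in> Arr D (FOb L c) (FOb L' c)" "\<phi> c (FOb L' c) (\<alpha> c) = u c" if c: "c \<in> Obj C" for c
    unfolding \<alpha>_def using u[OF c] bij_betw_imp_surj_on[OF bij[OF c Lo(2)[OF c]]]
    by (auto intro: inv_into_into f_inv_into_f)
  have \<beta>: "\<beta> c \<in> Arr D (FOb L' c) (FOb L c)" "\<phi>' c (FOb L c) (\<beta> c) = v c" if c: "c \<in> Obj C" for c
    unfolding \<beta>_def using v[OF c] bij_betw_imp_surj_on[OF bij'[OF c Lo(1)[OF c]]]
    by (auto intro: inv_into_into f_inv_into_f)
  have \<beta>\<alpha>: "Cmp D (FOb L c) (FOb L' c) (FOb L c) (\<beta> c) (\<alpha> c) = Idt D (FOb L c)" if c: "c \<in> Obj C" for c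
  proof (rule \<phi>_inj[OF c Lo(1)[OF c] cat_cmp[OF D Lo(1)[OF c] Lo(2)[OF c] Lo(1)[OF c] \<alpha>(1)[OF c] \<beta>(1)[OF c]]
        cat_idt[OF D Lo(1)[OF c]]])
    have "\<phi> c (FOb L c) (Cmp D (FOb L c) (FOb L' c) (FOb L c) (\<beta> c) (\<alpha> c))
        = Cmp C c (FOb R (FOb L' c)) (FOb R (FOb L c)) (FAr R (FOb L' c) (FOb L c) (\<beta> c)) (u c)"
      using post[OF c Lo(2)[OF c] Lo(1)[OF c] \<beta>(1)[OF c] \<alpha>(1)[OF c]] \<alpha>(2)[OF c] by simp
    also have "\<dots> = \<phi>' c (FOb L c) (\<beta> c)"
      using post'[OF c Lo(2)[OF c] Lo(1)[OF c] \<beta>(1)[OF c] cat_idt[OF D Lo(2)[OF c]]]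
        cat_id_right[OF D Lo(2)[OF c] Lo(1)[OF c] \<beta>(1)[OF c]] by (simp add: u_def)
    finally show "\<phi> c (FOb L c) (Cmp D (FOb L c) (FOb L' c) (FOb L c) (\<beta> c) (\<alpha> c)) = \<phi> c (FOb L c) (Idt D (FOb L c))"
      unfolding \<beta>(2)[OF c] v_def .
  qed
  have \<alpha>\<beta>: "Cmp D (FOb L' c) (FOb L c) (FOb L' c) (\<alpha> c) (\<beta> c) = Idt D (FOb L' c)" if c: "c \<in> Obj C" for c
  proof (rule \<phi>'_inj[OF c Lo(2)[OF c] cat_cmp[OF D Lo(2)[OF c] Lo(1)[OF c] Lo(2)[OF c] \<beta>(1)[OF c] \<alpha>(1)[OF c]]
        cat_idt[OF D Lo(2)[OF c]]])
    have "\<phi>' c (FOb L' c) (Cmp D (FOb L' c) (FOb L c) (FOb L' c) (\<alpha> c) (\<beta> c))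
        = Cmp C c (FOb R (FOb L c)) (FOb R (FOb L' c)) (FAr R (FOb L c) (FOb L' c) (\<alpha> c)) (v c)"
      using post'[OF c Lo(1)[OF c] Lo(2)[OF c] \<alpha>(1)[OF c] \<beta>(1)[OF c]] \<beta>(2)[OF c] by simp
    also have "\<dots> = \<phi> c (FOb L' c) (\<alpha> c)"
      using post[OF c Lo(1)[OF c] Lo(2)[OF c] \<alpha>(1)[OF c] cat_idt[OF D Lo(1)[OF c]]]
        cat_id_right[OF D Lo(1)[OF c] Lo(2)[OF c] \<alpha>(1)[OF c]] by (simp add: v_def)
    finally show "\<phi>' c (FOb L' c) (Cmp D (FOb L' c) (FOb L c) (FOb L' c) (\<alpha> c) (\<beta> c)) = \<phi>' c (FOb L' c) (Idt D (FOb L' c))"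
      unfolding \<alpha>(2)[OF c] u_def .
  qed
  \<comment> \<open>Both sides have the transpose
    \<open>\<phi>' c (FOb L' c') (FAr L' c c' f)\<close>: one by naturality in the source, the other
    by naturality in the target.\<close>
  have natural: "Cmp D (FOb L c) (FOb L c') (FOb L' c') (\<alpha> c') (FAr L c c' f) = Cmp D (FOb L c) (FOb L' c) (FOb L' c') (FAr L' c c' f) (\<alpha> c)"
    if c: "c \<in> Obj C" and c': "c' \<in> Obj C" and f: "f \<in> Arr C c c'" for c c' f
  proof (rule \<phi>_inj[OF c Lo(2)[OF c'] cat_cmp[OF D Lo(1)[OF c] Lo(1)[OF c'] Lo(2)[OF c'] La(1)[OF c c' f] \<alpha>(1)[OF c']]
        cat_cmp[OF D Lo(1)[OF c] Lo(2)[OF c] Lo(2)[OF c'] \<alpha>(1)[OF c] La(2)[OF c c' f]]])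
    have "\<phi> c (FOb L' c') (Cmp D (FOb L c) (FOb L c') (FOb L' c') (\<alpha> c') (FAr L c c' f))
        = Cmp C c c' (FOb R (FOb L' c')) (u c') f"
      using pre[OF c' c Lo(2)[OF c'] f \<alpha>(1)[OF c']] \<alpha>(2)[OF c'] by simp
    also have "\<dots> = \<phi>' c (FOb L' c') (FAr L' c c' f)"
      using pre'[OF c' c Lo(2)[OF c'] f cat_idt[OF D Lo(2)[OF c']]]
        cat_id_left[OF D Lo(2)[OF c] Lo(2)[OF c'] La(2)[OF c c' f]] by (simp add: u_def)
    also have "\<dots> = Cmp C c (FOb R (FOb L' c)) (FOb R (FOb L' c')) (FAr R (FOb L' c) (FOb L' c') (FAr L' c c' f)) (u c)"
      using post'[OF c Lo(2)[OF c] Lo(2)[OF c'] La(2)[OF c c' f] cat_idt[OF D Lo(2)[OF c]]]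
        cat_id_right[OF D Lo(2)[OF c] Lo(2)[OF c'] La(2)[OF c c' f]] by (simp add: u_def)
    also have "\<dots> = \<phi> c (FOb L' c') (Cmp D (FOb L c) (FOb L' c) (FOb L' c') (FAr L' c c' f) (\<alpha> c))"
      using post[OF c Lo(2)[OF c] Lo(2)[OF c'] La(2)[OF c c' f] \<alpha>(1)[OF c]] \<alpha>(2)[OF c] by simp
    finally show "\<phi> c (FOb L' c') (Cmp D (FOb L c) (FOb L c') (FOb L' c') (\<alpha> c') (FAr L c c' f))
        = \<phi> c (FOb L' c') (Cmp D (FOb L c) (FOb L' c) (FOb L' c') (FAr L' c c' f) (\<alpha> c))" .
  qed
  have "nat_trans C D L L' \<alpha>" unfolding nat_trans_def using \<alpha>(1) natural by simp
  moreover have "is_iso D (FOb L c) (FOb L' c) (\<alpha> c)" if "c \<in> Obj C" for c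
    unfolding is_iso_def using \<alpha>(1)[OF that] \<beta>(1)[OF that] \<beta>\<alpha>[OF that] \<alpha>\<beta>[OF that] by blast
  ultimately show ?thesis unfolding isomorphic_functors_def using L(1,2) by blast
qed


subsection \<open>The associated sheaf\<close>

context small_sets
begin

definition sheafify ::
    "(('u topology, 'u \<Rightarrow> 'u, 'u) presheaf, 'u topology \<Rightarrow> 'u \<Rightarrow> 'u,
     ('u topology, 'u \<Rightarrow> 'u, 'u) presheaf, 'u topology \<Rightarrow> 'u \<Rightarrow> 'u) ftor" where
  "sheafify = ftor_comp (Ext \<S>) (ftor_comp (Plus \<S>) (Res \<S>))"

definition eta :: "('u topology, 'u \<Rightarrow> 'u, 'u) presheaf \<Rightarrow> 'u topology \<Rightarrow> 'u \<Rightarrow> 'u" where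
  "eta P = (\<lambda>X\<in>Obj CH. \<lambda>x\<in>FOb P X. plus_class (Res_ob P) (topspace X)
     (single (topspace X) (FAr P X (beta (topspace X)) (uf_limit X) x)))"

lemma FOb_sheafify: "FOb sheafify P = Ext_ob (plus_ob (Res_ob P))"
  by (simp add: sheafify_def ftor_comp_def Ext_def Res_def)

lemma FAr_sheafify:
  "X \<in> Obj CH \<Longrightarrow> t \<in> Ext_set (plus_ob (Res_ob P)) X \<Longrightarrow>
    FAr sheafify P Q k X t = FAr (Plus \<S>) (Res_ob P) (Res_ob Q) (FAr (Res \<S>) P Q k) (topspace X) t"
  by (simp add: sheafify_def ftor_comp_def Ext_def Res_def)

lemma sheafify_functor: "is_functor PC (CSets \<S>) sheafify"
  unfolding sheafify_def
  by (intro is_functor_ftor_comp[OF is_functor_ftor_comp[OF Res_functor Plus_functor_PShx]] Ext_functor_CSets)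

lemma is_cat_CSets: "is_cat (CSets \<S>)"
  unfolding CSets_def by (intro is_cat_full_subcat is_cat_PSh)

lemma Obj_CSets: "G \<in> Obj (CSets \<S>) \<longleftrightarrow> G \<in> Obj PC \<and> coproducts_to_products CH G \<and> epi_descent \<S> G"
  by (simp add: CSets_def Obj_full_subcat)

lemma Arr_CSets [simp]: "Arr (CSets \<S>) = Arr PC"
  and Cmp_CSets [simp]: "Cmp (CSets \<S>) = Cmp PC"
  by (simp_all add: CSets_def)

lemma inclusion_functor: "is_functor (CSets \<S>) PC inclusion"
  unfolding is_functor_def CSets_def by (auto simp: inclusion_def Obj_full_subcat)

section \<open>The unit at an arbitrary presheaf\<close>

context
  fixes P assumes P: "P \<in> Obj PC"
begin

lemma sheafify_Obj: "FOb sheafify P \<in> Obj (CSets \<S>)"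
  using sheafify_functor P by (simp add: is_functor_def)

lemma xi_in:
  assumes X: "X \<in> Obj CH" and x: "x \<in> FOb P X"
  shows "FAr P X (beta (topspace X)) (uf_limit X) x \<in> FOb (Res_ob P) (topspace X)"
  using psh_in[OF P beta_in_CHaus X uf_limit_Arr[OF X] x] X by (simp add: Obj_CH)

lemma eta_apply:
  assumes "X \<in> Obj CH" "x \<in> FOb P X"
  shows "eta P X x = plus_class (Res_ob P) (topspace X)
     (single (topspace X) (FAr P X (beta (topspace X)) (uf_limit X) x))"
  using assms by (simp add: eta_def)

text \<open>If \<open>f\<close> and \<open>g\<close> agree after \<xi>, then \<open>x\<close> has
  equal restrictions along the two composites, and \<open>single_natural\<close> carries this
  equality into \<open>Plus\<close>.\<close>

lemma eta_in:
  assumes X: "X \<in> Obj CH" and x: "x \<in> FOb P X"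
  shows "eta P X x \<in> Ext_set (plus_ob (Res_ob P)) X"
proof -
  have S: "topspace X \<in> \<S>" using X by (simp add: Obj_CH)
  note R = Res_ob_PB[OF P] and xi = xi_in[OF X x] and B = beta_in_CHaus and \<xi> = uf_limit_Arr[OF X]
  show ?thesis
    unfolding eta_apply[OF X x]
  proof (rule Ext_setI[OF plus_ob_PB[OF R] X single_in_plus[OF R xi]])
    fix T f g assume T: "T \<in> \<S>" and f: "f \<in> bhom T (topspace X)"
      and g: "g \<in> bhom T (topspace X)"
      and eq: "compose (tb T) (uf_limit X) f = compose (tb T) (uf_limit X) g"
    have "FAr (Res_ob P) (topspace X) T f (FAr P X (beta (topspace X)) (uf_limit X) x)
       = FAr (Res_ob P) (topspace X) T g (FAr P X (beta (topspace X)) (uf_limit X) x)"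
      using ch_comp[OF P B[OF T] B[OF S] X f \<xi> x] ch_comp[OF P B[OF T] B[OF S] X g \<xi> x] eq by simp
    then show "FAr (plus_ob (Res_ob P)) (topspace X) T f (plus_class (Res_ob P) (topspace X)
         (single (topspace X) (FAr P X (beta (topspace X)) (uf_limit X) x)))
       = FAr (plus_ob (Res_ob P)) (topspace X) T g (plus_class (Res_ob P) (topspace X)
         (single (topspace X) (FAr P X (beta (topspace X)) (uf_limit X) x)))"
      unfolding single_natural[OF R T S f xi] single_natural[OF R T S g xi] by simp
  qed
qed

lemma eta_Arr: "eta P \<in> Arr PC P (FOb sheafify P)"
proof (rule PSh_ArrI[OF P])
  show "FOb sheafify P \<in> Obj PC" using sheafify_Obj by (simp add: Obj_CSets)
  show "eta P \<in> extensional (Obj CH)" by (simp add: eta_def)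
  show "eta P X \<in> FOb P X \<rightarrow>\<^sub>E FOb (FOb sheafify P) X" if X: "X \<in> Obj CH" for X
    using eta_in[OF X] X by (auto simp: FOb_sheafify PiE_iff) (simp add: eta_def)
  fix X Y f x assume X: "X \<in> Obj CH" and Y: "Y \<in> Obj CH" and f: "f \<in> Arr CH X Y" and x: "x \<in> FOb P Y"
  have S: "topspace X \<in> \<S>" "topspace Y \<in> \<S>" using X Y by (auto simp: Obj_CH)
  note R = Res_ob_PB[OF P] and B = beta_in_CHaus[OF S(1)] beta_in_CHaus[OF S(2)]
  have fx: "FAr P Y X f x \<in> FOb P X" by (rule psh_in[OF P X Y f x])
  have "FAr (FOb sheafify P) Y X f (eta P Y x) = FAr (plus_ob (Res_ob P)) (topspace Y) (topspace X)
      (beta_map (topspace X) (topspace Y) f) (plus_class (Res_ob P) (topspace Y)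
        (single (topspace Y) (FAr P Y (beta (topspace Y)) (uf_limit Y) x)))"
    using eta_in[OF Y x] by (simp add: FOb_sheafify FAr_Ext_ob eta_apply[OF Y x])
  also have "\<dots> = plus_class (Res_ob P) (topspace X) (single (topspace X)
      (FAr P (beta (topspace Y)) (beta (topspace X)) (beta_map (topspace X) (topspace Y) f)
        (FAr P Y (beta (topspace Y)) (uf_limit Y) x)))"
    unfolding single_natural[OF R S beta_map_CH[OF X Y f] xi_in[OF Y x]] by simp
  also have "FAr P (beta (topspace Y)) (beta (topspace X)) (beta_map (topspace X) (topspace Y) f)
        (FAr P Y (beta (topspace Y)) (uf_limit Y) x)
      = FAr P X (beta (topspace X)) (uf_limit X) (FAr P Y X f x)"
    using ch_comp[OF P B Y beta_map_CH[OF X Y f] uf_limit_Arr[OF Y] x]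
      ch_comp[OF P B(1) X Y uf_limit_Arr[OF X] f x] uf_limit_natural[OF X Y f] by simp
  finally show "eta P X (FAr P Y X f x) = FAr (FOb sheafify P) Y X f (eta P Y x)"
    by (simp add: eta_apply[OF X fx])
qed

text \<open>Restriction to \<beta>u acts through \<beta> of the whole composite \<beta>u ->
  \<beta>|X| -> X. The \<open>Ext\<close> condition allows replacing that map by \<xi> of \<beta>u
  followed by the inclusion, since both agree over \<open>X\<close>. The new map passes through the
  single block \<open>u\<close>, where \<open>single_block\<close> applies.\<close>

lemma sheafify_local:
  assumes X: "X \<in> Obj CH" and a: "a \<in> pts (Res_ob P) (topspace X)"
    and t: "plus_class (Res_ob P) (topspace X) a \<in> Ext_set (plus_ob (Res_ob P)) X" and u: "u \<in> fst a"
  shows "FAr (FOb sheafify P) X (beta u) (compose (tb u) (uf_limit X) (incl u (topspace X)))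
      (plus_class (Res_ob P) (topspace X) a) = eta P (beta u) (snd a u)"
proof -
  let ?R = "Res_ob P" and ?S = "topspace X" and ?t = "plus_class (Res_ob P) (topspace X) a"
  let ?k = "compose (tb u) (uf_limit X) (incl u ?S)" and ?T = "tb u"
  have S: "?S \<in> \<S>" using X by (simp add: Obj_CH)
  note R = Res_ob_PB[OF P]
  have uS: "u \<subseteq> ?S" using Cov_subset[OF _ u] a by (simp add: mem_pts)
  have U: "u \<in> \<S>" by (rule subset_in[OF S uS])
  note B = beta_in_CHaus[OF U]
  have T: "?T \<in> \<S>" using B by (simp add: Obj_CH)
  note i = incl_Arr[OF S uS]
  have k: "?k \<in> Arr CH (beta u) X" by (rule compose_Arr_CH[OF i uf_limit_Arr[OF X]])
  note \<xi> = uf_limit_Arr[OF B]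
  have s: "snd a u \<in> FOb ?R u" by (rule pts_in[OF R a u])
  have "FAr (FOb sheafify P) X (beta u) ?k ?t = FAr (plus_ob ?R) ?S ?T (beta_map ?T ?S ?k) ?t"
    using t by (simp add: FOb_sheafify FAr_Ext_ob)
  also have "\<dots> = FAr (plus_ob ?R) ?S ?T (compose (tb ?T) (incl u ?S) (uf_limit (beta u))) ?t"
  proof (rule Ext_setD[OF plus_ob_PB[OF R] X t T beta_map_CH[OF B X k] compose_Arr_CH[OF \<xi> i]])
    show "compose (tb ?T) (uf_limit X) (beta_map ?T ?S ?k)
        = compose (tb ?T) (uf_limit X) (compose (tb ?T) (incl u ?S) (uf_limit (beta u)))"
      unfolding uf_limit_natural[OF B X k] by (rule CH_assoc[OF \<xi>, symmetric])
  qed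
  also have "\<dots> = FAr (plus_ob ?R) u ?T (uf_limit (beta u)) (FAr (plus_ob ?R) ?S u (incl u ?S) ?t)"
    by (rule bs_comp[OF plus_ob_PB[OF R] T U S \<xi> i Ext_set_subset[OF t]])
  also have "\<dots> = plus_class ?R ?T (single ?T (FAr ?R u ?T (uf_limit (beta u)) (snd a u)))"
    unfolding single_block[OF R S a u] by (rule single_natural[OF R T U \<xi> s])
  finally show ?thesis using s by (simp add: eta_apply[OF B])
qed

end

lemma eta_natural:
  assumes P: "P \<in> Obj PC" and Q: "Q \<in> Obj PC" and k: "k \<in> Arr PC P Q" and X: "X \<in> Obj CH" and x: "x \<in> FOb P X"
  shows "FAr sheafify P Q k X (eta P X x) = eta Q X (k X x)"
proof -
  have S: "topspace X \<in> \<S>" using X by (simp add: Obj_CH)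
  have kr: "FAr (Res \<S>) P Q k \<in> Arr PB (Res_ob P) (Res_ob Q)"
    using Res_functor P Q k by (simp add: is_functor_def Res_def)
  have kx: "k X x \<in> FOb Q X" by (rule psh_arr_in[OF k X x])
  have "FAr sheafify P Q k X (eta P X x) = FAr (Plus \<S>) (Res_ob P) (Res_ob Q) (FAr (Res \<S>) P Q k) (topspace X) (eta P X x)"
    by (rule FAr_sheafify[OF X eta_in[OF P X x]])
  also have "\<dots> = plus_class (Res_ob Q) (topspace X) (map_pt (FAr (Res \<S>) P Q k)
      (single (topspace X) (FAr P X (beta (topspace X)) (uf_limit X) x)))"
    unfolding eta_apply[OF P X x]
    by (rule Plus_FAr_class[OF Res_ob_PB[OF P] Res_ob_PB[OF Q] kr S single_pts[OF Res_ob_PB[OF P] xi_in[OF P X x]]])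
  also have "map_pt (FAr (Res \<S>) P Q k) (single (topspace X) (FAr P X (beta (topspace X)) (uf_limit X) x))
      = single (topspace X) (FAr Q X (beta (topspace X)) (uf_limit X) (k X x))"
    using psh_nat[OF k beta_in_CHaus[OF S] X uf_limit_Arr[OF X] x] S by (auto simp: map_pt_def single_def Res_def)
  finally show ?thesis by (simp add: eta_apply[OF Q X kx])
qed

section \<open>Bijectivity of the unit at a sheaf, and maps from the composite into a sheaf\<close>

context
  fixes G assumes G: "G \<in> Obj (CSets \<S>)"
begin

lemma sheaf_PC: "G \<in> Obj PC"
  using G by (simp add: Obj_CSets)

lemma sheaf_epi_descent:
  assumes "is_epi CH Y X e"
  shows "bij_betw (FAr G X Y e) (FOb G X)
       {s \<in> FOb G Y. FAr G Y (fibprod Y Y e e) (fibprod_pr1 Y Y e e) s = FAr G Y (fibprod Y Y e e) (fibprod_pr2 Y Y e e) s}"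
  using assms G unfolding Obj_CSets epi_descent_def by blast

lemma sheaf_xi_inj:
  assumes X: "X \<in> Obj CH" and x: "x \<in> FOb G X" "y \<in> FOb G X"
    and "FAr G X (beta (topspace X)) (uf_limit X) x = FAr G X (beta (topspace X)) (uf_limit X) y"
  shows "x = y"
  by (rule inj_onD[OF bij_betw_imp_inj_on[OF sheaf_epi_descent[OF is_epi_uf_limit[OF X]]]]) (rule assms)+

text \<open>Decompositions into subsets are coproducts already in \<open>CHaus\<close> by
  \<open>beta_coproduct\<close>, so the product condition on \<open>G\<close> applies to
  them.\<close>

lemma Res_ob_products: "coproducts_to_products BS (Res_ob G)"
proof (rule products_from_subsets[OF Res_ob_PB[OF sheaf_PC]])
  fix I :: "nat set" and Q c
  assume I: "finite I" and c: "c \<in> \<S>" and Qc: "\<And>i. i \<in> I \<Longrightarrow> Q i \<subseteq> c"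
    and disj: "\<And>i j. i \<in> I \<Longrightarrow> j \<in> I \<Longrightarrow> i \<noteq> j \<Longrightarrow> Q i \<inter> Q j = {}" and cover: "c = (\<Union>i\<in>I. Q i)"
  have "is_coproduct CH I (\<lambda>i. beta (Q i)) (beta c) (\<lambda>i. incl (Q i) c)"
  proof (rule beta_coproduct[OF I c])
    show "Q i \<in> \<S>" if "i \<in> I" for i by (rule subset_in[OF c Qc[OF that]])
    show "(\<lambda>x. x) \<in> Q i \<rightarrow> c" if "i \<in> I" for i using Qc[OF that] by auto
    show "(\<lambda>x. x) ` Q i \<inter> (\<lambda>x. x) ` Q j = {}" if "i \<in> I" "j \<in> I" "i \<noteq> j" for i j using disj[OF that] by simp
    show "c \<subseteq> (\<Union>i\<in>I. (\<lambda>x. x) ` Q i)" using cover by simp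
  qed simp
  then show "bij_betw (\<lambda>s. \<lambda>i\<in>I. FAr (Res_ob G) c (Q i) (incl (Q i) c) s) (FOb (Res_ob G) c) (\<Pi>\<^sub>E i\<in>I. FOb (Res_ob G) (Q i))"
    using G I unfolding Obj_CSets coproducts_to_products_def Res_ob_simps by blast
qed

lemma eta_inj:
  assumes X: "X \<in> Obj CH" and x: "x \<in> FOb G X" "y \<in> FOb G X" and eq: "eta G X x = eta G X y"
  shows "x = y"
proof (rule sheaf_xi_inj[OF X x])
  have S: "topspace X \<in> \<S>" using X by (simp add: Obj_CH)
  note C = sheaf_PC
  show "FAr G X (beta (topspace X)) (uf_limit X) x = FAr G X (beta (topspace X)) (uf_limit X) y"
    by (rule single_inj[OF Res_ob_PB[OF C] Res_ob_products S xi_in[OF C X x(1)] xi_in[OF C X x(2)]])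
       (use eq in \<open>simp add: eta_apply[OF C X] x\<close>)
qed

text \<open>\<open>single_surj\<close> yields a section \<open>y\<close> over \<beta>|X|, and
  descent along \<xi> asks that its two pullbacks to the fibre product of \<beta>|X| with itself
  over \<open>X\<close> agree. That space need not be of the form \<beta>R, so agreement is tested
  after its own limit map, where the \<open>Ext\<close> condition applies and which
  \<open>sheaf_xi_inj\<close> cancels.\<close>

lemma eta_surj:
  assumes X: "X \<in> Obj CH" and t: "t \<in> FOb (FOb sheafify G) X"
  shows "t \<in> eta G X ` FOb G X"
proof -
  have S: "topspace X \<in> \<S>" using X by (simp add: Obj_CH)
  let ?B = "beta (topspace X)" and ?\<xi> = "uf_limit X"
  note C = sheaf_PC and R = Res_ob_PB[OF sheaf_PC] and \<xi> = uf_limit_Arr[OF X] and B = beta_in_CHaus[OF S]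
  have tE: "t \<in> Ext_set (plus_ob (Res_ob G)) X" using t by (simp add: FOb_sheafify)
  obtain y where y: "y \<in> FOb (Res_ob G) (topspace X)" "t = plus_class (Res_ob G) (topspace X) (single (topspace X) y)"
    by (rule single_surj[OF R Res_ob_products S Ext_set_subset[OF tE]])
  have yE: "FAr G ?B (beta T) f y = FAr G ?B (beta T) g y"
    if T: "T \<in> \<S>" and f: "f \<in> Arr CH (beta T) ?B" and g: "g \<in> Arr CH (beta T) ?B"
      and eq: "compose (tb T) ?\<xi> f = compose (tb T) ?\<xi> g" for T f g
    using single_inj[OF R Res_ob_products T bs_in[OF R T S f y(1)] bs_in[OF R T S g y(1)]]
      Ext_setD[OF plus_ob_PB[OF R] X tE T f g eq] unfolding y(2) single_natural[OF R T S f y(1)] single_natural[OF R T S g y(1)]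
    by simp
  let ?W = "fibprod ?B ?B ?\<xi> ?\<xi>" and ?p = "fibprod_pr1 ?B ?B ?\<xi> ?\<xi>" and ?q = "fibprod_pr2 ?B ?B ?\<xi> ?\<xi>"
  note W = fibprod_Obj[OF B B X \<xi> \<xi>] and p = fibprod_pr1_Arr[OF B B X \<xi> \<xi>] and q = fibprod_pr2_Arr[OF B B X \<xi> \<xi>]
  have SW: "topspace ?W \<in> \<S>" using W by (simp add: Obj_CH)
  note \<xi>W = uf_limit_Arr[OF W] and BW = beta_in_CHaus[OF SW]
  have y': "y \<in> FOb G ?B" using y(1) by simp
  have "FAr G ?B ?W ?p y = FAr G ?B ?W ?q y"
  proof (rule sheaf_xi_inj[OF W psh_in[OF C W B p y'] psh_in[OF C W B q y']])
    have "compose (tb (topspace ?W)) ?\<xi> (compose (tb (topspace ?W)) ?p (uf_limit ?W))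
        = compose (tb (topspace ?W)) ?\<xi> (compose (tb (topspace ?W)) ?q (uf_limit ?W))"
      unfolding CH_assoc[OF \<xi>W] fibprod_commute[OF B B X \<xi> \<xi>] ..
    from yE[OF SW compose_Arr_CH[OF \<xi>W p] compose_Arr_CH[OF \<xi>W q] this]
    show "FAr G ?W (beta (topspace ?W)) (uf_limit ?W) (FAr G ?B ?W ?p y) = FAr G ?W (beta (topspace ?W)) (uf_limit ?W) (FAr G ?B ?W ?q y)"
      using ch_comp[OF C BW W B \<xi>W p y'] ch_comp[OF C BW W B \<xi>W q y'] by simp
  qed
  then have "y \<in> FAr G X ?B ?\<xi> ` FOb G X"
    using bij_betw_imp_surj_on[OF sheaf_epi_descent[OF is_epi_uf_limit[OF X]]] y' by blast
  then obtain x where x: "x \<in> FOb G X" "y = FAr G X ?B ?\<xi> x" by blast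
  have "t = eta G X x" unfolding eta_apply[OF C X x(1)] y(2) x(2) ..
  then show ?thesis using x(1) by (rule image_eqI)
qed

lemma sheaf_partition_eqI:
  assumes S: "S \<in> \<S>" and U: "finite U" "partition_on S U" and x: "x \<in> FOb G (beta S)" "y \<in> FOb G (beta S)"
    and eq: "\<And>u. u \<in> U \<Longrightarrow> FAr G (beta S) (beta u) (incl u S) x = FAr G (beta S) (beta u) (incl u S) y"
  shows "x = y"
proof -
  have "(\<lambda>u\<in>U. FAr (Res_ob G) S u (incl u S) x) = (\<lambda>u\<in>U. FAr (Res_ob G) S u (incl u S) y)"
    using eq by (intro restrict_ext) simp
  then show ?thesis
    using inj_onD[OF bij_betw_imp_inj_on[OF products_partition[OF Res_ob_PB[OF sheaf_PC] Res_ob_products S U]], of x y] x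
    by simp
qed

text \<open>A section of the composite has a representative on a finite partition of |X|, and
  \<open>sheafify_local\<close> puts its restriction to each block in the image of
  \<open>eta\<close>. A section of \<open>G\<close> is determined by these restrictions, by descent
  along \<xi> and then by the product condition.\<close>

lemma sheafify_hom_eqI:
  assumes P: "P \<in> Obj PC" and h: "h \<in> Arr PC (FOb sheafify P) G" and h': "h' \<in> Arr PC (FOb sheafify P) G"
    and eq: "\<And>X x. X \<in> Obj CH \<Longrightarrow> x \<in> FOb P X \<Longrightarrow> h X (eta P X x) = h' X (eta P X x)"
  shows "h = h'"
proof (rule PSh_Arr_eqI[OF h h'])
  fix X t assume X: "X \<in> Obj CH" and t: "t \<in> FOb (FOb sheafify P) X"
  let ?R = "Res_ob P" and ?S = "topspace X" and ?\<xi> = "uf_limit X"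
  have S: "?S \<in> \<S>" using X by (simp add: Obj_CH)
  note R = Res_ob_PB[OF P] and \<xi> = uf_limit_Arr[OF X] and B = beta_in_CHaus[OF S] and C = sheaf_PC
  have tE: "t \<in> Ext_set (plus_ob ?R) X" using t by (simp add: FOb_sheafify)
  obtain a where a: "a \<in> pts ?R ?S" "partition_on ?S (fst a)" "finite (fst a)" "t = plus_class ?R ?S a"
    by (rule plus_class_partition[OF R S Ext_set_subset[OF tE]])
  have ht: "h X t \<in> FOb G X" "h' X t \<in> FOb G X"
    using psh_arr_in[OF h X t] psh_arr_in[OF h' X t] .
  show "h X t = h' X t"
  proof (rule sheaf_xi_inj[OF X ht],
      rule sheaf_partition_eqI[OF S a(3,2) psh_in[OF C B X \<xi> ht(1)] psh_in[OF C B X \<xi> ht(2)]])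
    fix u assume u: "u \<in> fst a"
    have uS: "u \<subseteq> ?S" by (rule partition_on_subset[OF a(2) u])
    note Bu = beta_in_CHaus[OF subset_in[OF S uS]] and i = incl_Arr[OF S uS]
    let ?k = "compose (tb u) ?\<xi> (incl u ?S)"
    note k = compose_Arr_CH[OF i \<xi>]
    have loc: "FAr (FOb sheafify P) X (beta u) ?k t = eta P (beta u) (snd a u)"
      using sheafify_local[OF P X a(1) _ u] tE a(4) by simp
    have su: "snd a u \<in> FOb P (beta u)" using pts_in[OF R a(1) u] by simp
    have "FAr G (beta ?S) (beta u) (incl u ?S) (FAr G X (beta ?S) ?\<xi> (h X t)) = FAr G X (beta u) ?k (h X t)"
      by (rule ch_comp[OF C Bu B X i \<xi> ht(1), symmetric])
    also have "\<dots> = h (beta u) (eta P (beta u) (snd a u))"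
      using psh_nat[OF h Bu X k t] loc by simp
    also have "\<dots> = h' (beta u) (eta P (beta u) (snd a u))" by (rule eq[OF Bu su])
    also have "\<dots> = FAr G X (beta u) ?k (h' X t)"
      using psh_nat[OF h' Bu X k t] loc by simp
    also have "\<dots> = FAr G (beta ?S) (beta u) (incl u ?S) (FAr G X (beta ?S) ?\<xi> (h' X t))"
      by (rule ch_comp[OF C Bu B X i \<xi> ht(2)])
    finally show "FAr G (beta ?S) (beta u) (incl u ?S) (FAr G X (beta ?S) ?\<xi> (h X t))
      = FAr G (beta ?S) (beta u) (incl u ?S) (FAr G X (beta ?S) ?\<xi> (h' X t))" .
  qed
qed

text \<open>The composite functor sends \<open>k\<close> to a map into the sheafification of
  \<open>G\<close>, where \<open>eta G\<close> can be inverted pointwise. Naturality of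
  \<open>h\<close> and the triangle both follow by cancelling \<open>eta G\<close>.\<close>

lemma sheafify_hom_exists:
  assumes P: "P \<in> Obj PC" and k: "k \<in> Arr PC P G"
  shows "\<exists>h\<in>Arr PC (FOb sheafify P) G. Cmp PC P (FOb sheafify P) G h (eta P) = k"
proof -
  note C = sheaf_PC
  have LP: "FOb sheafify P \<in> Obj PC"
    using sheafify_Obj[OF P] by (simp add: Obj_CSets)
  have Lk: "FAr sheafify P G k \<in> Arr PC (FOb sheafify P) (FOb sheafify G)"
    using sheafify_functor P C k by (simp add: is_functor_def)
  define h where "h = (\<lambda>X\<in>Obj CH. \<lambda>t\<in>FOb (FOb sheafify P) X. inv_into (FOb G X) (eta G X) (FAr sheafify P G k X t))"
  have inv: "h X t \<in> FOb G X" "eta G X (h X t) = FAr sheafify P G k X t"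
    if X: "X \<in> Obj CH" and t: "t \<in> FOb (FOb sheafify P) X" for X t
    using eta_surj[OF X psh_arr_in[OF Lk X t]] X t by (simp_all add: h_def inv_into_into f_inv_into_f)
  have hA: "h \<in> Arr PC (FOb sheafify P) G"
  proof (rule PSh_ArrI[OF LP C])
    show "h \<in> extensional (Obj CH)" by (simp add: h_def)
    show "h X \<in> FOb (FOb sheafify P) X \<rightarrow>\<^sub>E FOb G X" if "X \<in> Obj CH" for X
      using inv(1)[OF that] that by (auto simp: PiE_iff) (simp add: h_def)
    fix X Y f t assume X: "X \<in> Obj CH" and Y: "Y \<in> Obj CH" and f: "f \<in> Arr CH X Y" and t: "t \<in> FOb (FOb sheafify P) Y"
    note ft = psh_in[OF LP X Y f t]
    show "h X (FAr (FOb sheafify P) Y X f t) = FAr G Y X f (h Y t)"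
    proof (rule eta_inj[OF X inv(1)[OF X ft] psh_in[OF C X Y f inv(1)[OF Y t]]])
      have "eta G X (h X (FAr (FOb sheafify P) Y X f t)) = FAr (FOb sheafify G) Y X f (FAr sheafify P G k Y t)"
        unfolding inv(2)[OF X ft] by (rule psh_nat[OF Lk X Y f t])
      also have "\<dots> = eta G X (FAr G Y X f (h Y t))"
        unfolding inv(2)[OF Y t, symmetric] by (rule psh_nat[OF eta_Arr[OF C] X Y f inv(1)[OF Y t], symmetric])
      finally show "eta G X (h X (FAr (FOb sheafify P) Y X f t)) = eta G X (FAr G Y X f (h Y t))" .
    qed
  qed
  moreover have "Cmp PC P (FOb sheafify P) G h (eta P) = k"
  proof (rule PSh_Arr_eqI[OF PSh_Cmp_Arr[OF P C eta_Arr[OF P] hA] k])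
    fix X x assume X: "X \<in> Obj CH" and x: "x \<in> FOb P X"
    note ex = psh_arr_in[OF eta_Arr[OF P] X x] and kx = psh_arr_in[OF k X x]
    have "h X (eta P X x) = k X x"
      by (rule eta_inj[OF X inv(1)[OF X ex] kx]) (simp add: inv(2)[OF X ex] eta_natural[OF P C k X x])
    then show "Cmp PC P (FOb sheafify P) G h (eta P) X x = k X x" using X x by (simp add: PSh_Cmp_apply)
  qed
  ultimately show ?thesis by blast
qed

end

text \<open>Transposition is composition with \<open>eta P\<close>. It is bijective by
  \<open>sheafify_hom_eqI\<close> and \<open>sheafify_hom_exists\<close>, and its naturality in the
  presheaf variable is \<open>eta_natural\<close>.\<close>

theorem sheafify_left_adjoint: "left_adjoint PC (CSets \<S>) sheafify inclusion"
  unfolding left_adjoint_def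
proof (intro conjI sheafify_functor inclusion_functor exI[of _ "\<lambda>P G h. Cmp PC P (FOb sheafify P) G h (eta P)"] ballI)
  fix P G assume P: "P \<in> Obj PC" and G: "G \<in> Obj (CSets \<S>)"
  note C = sheaf_PC[OF G] and e = eta_Arr[OF P]
  show "bij_betw (\<lambda>h. Cmp PC P (FOb sheafify P) G h (eta P)) (Arr (CSets \<S>) (FOb sheafify P) G) (Arr PC P (FOb inclusion G))"
    unfolding bij_betw_def Arr_CSets
  proof (intro conjI inj_onI equalityI subsetI)
    fix h h' assume h: "h \<in> Arr PC (FOb sheafify P) G" "h' \<in> Arr PC (FOb sheafify P) G"
      and eq: "Cmp PC P (FOb sheafify P) G h (eta P) = Cmp PC P (FOb sheafify P) G h' (eta P)"
    show "h = h'"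
    proof (rule sheafify_hom_eqI[OF G P h])
      fix X x assume "X \<in> Obj CH" "x \<in> FOb P X"
      then show "h X (eta P X x) = h' X (eta P X x)"
        using fun_cong[OF fun_cong[OF eq, of X], of x] by (simp add: PSh_Cmp_apply)
    qed
  next
    fix k assume "k \<in> (\<lambda>h. Cmp PC P (FOb sheafify P) G h (eta P)) ` Arr PC (FOb sheafify P) G"
    then show "k \<in> Arr PC P (FOb inclusion G)" using PSh_Cmp_Arr[OF P C e] by (auto simp: inclusion_def)
  next
    fix k assume "k \<in> Arr PC P (FOb inclusion G)"
    then show "k \<in> (\<lambda>h. Cmp PC P (FOb sheafify P) G h (eta P)) ` Arr PC (FOb sheafify P) G"
      using sheafify_hom_exists[OF G P, of k] by (auto simp: inclusion_def)
  qed
next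
  fix P P' G G' f k h
  assume P: "P \<in> Obj PC" and P': "P' \<in> Obj PC" and G: "G \<in> Obj (CSets \<S>)" and G': "G' \<in> Obj (CSets \<S>)"
    and f: "f \<in> Arr PC P' P" and "k \<in> Arr (CSets \<S>) G G'" and "h \<in> Arr (CSets \<S>) (FOb sheafify P) G"
  then have k: "k \<in> Arr PC G G'" and h: "h \<in> Arr PC (FOb sheafify P) G" by simp_all
  note C = sheaf_PC[OF G] sheaf_PC[OF G'] and e = eta_Arr[OF P] and e' = eta_Arr[OF P']
  have L: "FOb sheafify P \<in> Obj PC" "FOb sheafify P' \<in> Obj PC"
    using sheafify_Obj[OF P] sheafify_Obj[OF P'] by (simp_all add: Obj_CSets)
  have Lf: "FAr sheafify P' P f \<in> Arr PC (FOb sheafify P') (FOb sheafify P)"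
    using sheafify_functor P P' f by (simp add: is_functor_def)
  note hf = PSh_Cmp_Arr[OF L(2) C(1) Lf h]
  note khf = PSh_Cmp_Arr[OF L(2) C(2) hf k]
  note he = PSh_Cmp_Arr[OF P C(1) e h]
  note hef = PSh_Cmp_Arr[OF P' C(1) f he]
  have "Cmp PC P' (FOb sheafify P') G' (Cmp PC (FOb sheafify P') G G' k
          (Cmp PC (FOb sheafify P') (FOb sheafify P) G h (FAr sheafify P' P f))) (eta P')
      = Cmp PC P' G G' k (Cmp PC P' P G (Cmp PC P (FOb sheafify P) G h (eta P)) f)"
  proof (rule PSh_Arr_eqI[OF PSh_Cmp_Arr[OF P' C(2) e' khf] PSh_Cmp_Arr[OF P' C(2) hef k]])
    fix X x assume X: "X \<in> Obj CH" and x: "x \<in> FOb P' X"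
    note ex = psh_arr_in[OF e' X x] and fx = psh_arr_in[OF f X x]
    show "Cmp PC P' (FOb sheafify P') G' (Cmp PC (FOb sheafify P') G G' k
          (Cmp PC (FOb sheafify P') (FOb sheafify P) G h (FAr sheafify P' P f))) (eta P') X x
      = Cmp PC P' G G' k (Cmp PC P' P G (Cmp PC P (FOb sheafify P) G h (eta P)) f) X x"
      by (simp add: PSh_Cmp_apply X x ex fx eta_natural[OF P' P f X x])
  qed
  then show "Cmp PC P' (FOb sheafify P') G' (Cmp (CSets \<S>) (FOb sheafify P') G G' k
          (Cmp (CSets \<S>) (FOb sheafify P') (FOb sheafify P) G h (FAr sheafify P' P f))) (eta P')
      = Cmp PC P' (FOb inclusion G) (FOb inclusion G') (FAr inclusion G G' k)
          (Cmp PC P' P (FOb inclusion G) (Cmp PC P (FOb sheafify P) G h (eta P)) f)"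
    by (simp add: inclusion_def)
qed

end

text \<open>A left adjoint is determined only up to isomorphism, so the comparison is made with
  every left adjoint of the inclusion; that one exists is witnessed by the composite itself.\<close>

theorem corollary4p3:
  fixes \<S> :: "'u set set"
  assumes "sets_universe \<S>"
  shows "is_functor (PSh \<S> (CHaus \<S>)) (PSh \<S> (betaSets \<S>)) (Res \<S>)
    \<and> is_functor (PSh \<S> (betaSets \<S>)) (PShx \<S>) (Plus \<S>)
    \<and> is_functor (PShx \<S>) (CSets \<S>) (Ext \<S>)
    \<and> (\<exists>sharp. left_adjoint (PSh \<S> (CHaus \<S>)) (CSets \<S>) sharp inclusion)
    \<and> (\<forall>sharp. left_adjoint (PSh \<S> (CHaus \<S>)) (CSets \<S>) sharp inclusion \<longrightarrow>
         isomorphic_functors (PSh \<S> (CHaus \<S>)) (CSets \<S>)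
           (ftor_comp (Ext \<S>) (ftor_comp (Plus \<S>) (Res \<S>))) sharp)"
proof -
  interpret small_sets \<S> by (rule small_sets.intro[OF assms])
  have adj: "left_adjoint (PSh \<S> (CHaus \<S>)) (CSets \<S>) (ftor_comp (Ext \<S>) (ftor_comp (Plus \<S>) (Res \<S>))) inclusion"
    using sheafify_left_adjoint unfolding sheafify_def .
  show ?thesis
  proof (intro conjI allI impI Res_functor Plus_functor_PShx Ext_functor_CSets)
    show "\<exists>sharp. left_adjoint (PSh \<S> (CHaus \<S>)) (CSets \<S>) sharp inclusion" using adj by (rule exI)
    fix sharp assume "left_adjoint (PSh \<S> (CHaus \<S>)) (CSets \<S>) sharp inclusion"
    with adj show "isomorphic_functors (PSh \<S> (CHaus \<S>)) (CSets \<S>)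
        (ftor_comp (Ext \<S>) (ftor_comp (Plus \<S>) (Res \<S>))) sharp"
      by (rule left_adjoint_unique[OF is_cat_PSh is_cat_CSets])
  qed
qed

end
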